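(* Let $\delta>0$ and let $K\ge1$, $T=KH$. Consider the algorithm UCBVI-BF (UCBVI with the Bernstein–Freedman bonus) run for $K$ episodes on any MDP satisfying the standing assumptions. Then, with probability at least $1-\delta$, $$\mathrm{Regret}(K)\;\le\;30\,HL\sqrt{SAK}+2500\,H^2S^2A\,L^2+4H^{3/2}\sqrt{KL},$$ where $L=\ln(5HSAT/\delta)$.
   Context: Setting: a finite-horizon episodic Markov decision process with finite state set $\mathcal S$ ($|\mathcal S|=S$), finite action set $\mathcal A$ ($|\mathcal A|=A$), unknown transition kernel $P(\cdot\mid x,a)$, known deterministic reward function $R:\mathcal S\times\mathcal A\to[0,1]$, and known horizon $H$. In each episode $k=1,\dots,K$, an initial state $x_{k,1}$ is chosen arbitrarily by the environment; then for $h=1,\dots,H$ the agent picks $a_{k,h}\in\mathcal A$ and observes $x_{k,h+1}\sim P(\cdot\mid x_{k,h},a_{k,h})$. A policy is a map $\pi:\mathcal S\times[H]\to\mathcal A$, with value $V^\pi_h(x)=\mathbb E\big[\sum_{j=h}^{H}R(x_j,\pi(x_j,j))\mid x_h=x\big]$, $V^\pi_{H+1}\equiv0$, and $V^*_h(x)=\sup_\pi V^\pi_h(x)$. If $\pi_k$ is the policy followed in episode $k$, $\mathrm{Regret}(K)=\sum_{k=1}^K\big(V^*_1(x_{k,1})-V^{\pi_k}_1(x_{k,1})\big)$. $T=KH$. Algorithm UCBVI (with a bonus rule $b$): before episode $k$, using all transitions from episodes $i<k$, let $N_k(x,a,y)$ be the number of transitions $(x_{i,h},a_{i,h},x_{i,h+1})=(x,a,y)$,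 $N_k(x,a)=\sum_yN_k(x,a,y)$, $\widehat P_k(y\mid x,a)=N_k(x,a,y)/N_k(x,a)$ when $N_k(x,a)>0$, and for $j\in\{1,\dots,H+1\}$ let $N'_{k,j}(y)$ be the number of episodes $i<k$ with $x_{i,j}=y$. Set $V_{k,H+1}\equiv0$, $Q_{0,h}\equiv H$. For $h=H,\dots,1$ and every $(x,a)$: if $N_k(x,a)>0$, $Q_{k,h}(x,a)=\min\big(Q_{k-1,h}(x,a),H,R(x,a)+\sum_y\widehat P_k(y\mid x,a)V_{k,h+1}(y)+b_{k,h}(x,a)\big)$, otherwise $Q_{k,h}(x,a)=H$; $V_{k,h}(x)=\max_aQ_{k,h}(x,a)$. In episode $k$ the agent takes $a_{k,h}\in\arg\max_aQ_{k,h}(x_{k,h},a)$; $\pi_k$ is this greedy policy. UCBVI-BF is UCBVI with bonus $$b_{k,h}(x,a)=\sqrt{\frac{8L'\,\mathrm{Var}_{Y\sim\widehat P_k(\cdot\mid x,a)}\big(V_{k,h+1}(Y)\big)}{N_k(x,a)}}+\frac{14HL'}{3N_k(x,a)}+\sqrt{\frac{8\sum_y\widehat P_k(y\mid x,a)\min\!\Big(\frac{100^2H^3S^2AL'^2}{N'_{k,h+1}(y)},H^2\Big)}{N_k(x,a)}},$$ where $L'=\ln(5SAT/\delta)$ and the minimum is $H^2$ when $N'_{k,h+1}(y)=0$. *)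

theory Defs
  imports "HOL-Probability.Probability"
begin

text \<open>Episodes are lists of transitions (x_h, a_h, x_{h+1}), h = 1..H (stored 0-indexed).
  A history is the list of completed episodes, oldest first.
  Policies are represented as functions pol h x (step h, state x).\<close>

type_synonym ('s,'a) episode = "('s \<times> 'a \<times> 's) list"
type_synonym ('s,'a) hist = "('s,'a) episode list"

fun gen_steps :: "('s \<Rightarrow> 'a \<Rightarrow> 's pmf) \<Rightarrow> (nat \<Rightarrow> 's \<Rightarrow> 'a) \<Rightarrow> nat \<Rightarrow> nat \<Rightarrow> 's
                   \<Rightarrow> ('s,'a) episode pmf" where
  "gen_steps P pol h 0 x = return_pmf []"
| "gen_steps P pol h (Suc n) x =
     bind_pmf (P x (pol h x))
       (\<lambda>y. map_pmf (\<lambda>rest. (x, pol h x, y) # rest) (gen_steps P pol (Suc h) n y))"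

definition Vpi :: "('s \<Rightarrow> 'a \<Rightarrow> 's pmf) \<Rightarrow> ('s \<Rightarrow> 'a \<Rightarrow> real) \<Rightarrow> nat \<Rightarrow> (nat \<Rightarrow> 's \<Rightarrow> 'a)
                   \<Rightarrow> nat \<Rightarrow> 's \<Rightarrow> real" where
  "Vpi P R H pol h x = measure_pmf.expectation (gen_steps P pol h (Suc H - h) x)
                          (\<lambda>tr. \<Sum>t\<leftarrow>tr. R (fst t) (fst (snd t)))"

definition Vstar :: "('s \<Rightarrow> 'a \<Rightarrow> 's pmf) \<Rightarrow> ('s \<Rightarrow> 'a \<Rightarrow> real) \<Rightarrow> nat \<Rightarrow> nat \<Rightarrow> 's \<Rightarrow> real" where
  "Vstar P R H h x = (SUP pol. Vpi P R H pol h x)"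

fun gen_hist :: "('s \<Rightarrow> 'a \<Rightarrow> 's pmf) \<Rightarrow> nat \<Rightarrow> (('s,'a) hist \<Rightarrow> nat \<Rightarrow> 's \<Rightarrow> 'a)
                  \<Rightarrow> (('s,'a) hist \<Rightarrow> 's) \<Rightarrow> nat \<Rightarrow> ('s,'a) hist pmf" where
  "gen_hist P H act init 0 = return_pmf []"
| "gen_hist P H act init (Suc k) =
     bind_pmf (gen_hist P H act init k)
       (\<lambda>hs. map_pmf (\<lambda>ep. hs @ [ep]) (gen_steps P (act hs) 1 H (init hs)))"

definition regret :: "('s \<Rightarrow> 'a \<Rightarrow> 's pmf) \<Rightarrow> ('s \<Rightarrow> 'a \<Rightarrow> real) \<Rightarrow> nat
                      \<Rightarrow> (('s,'a) hist \<Rightarrow> nat \<Rightarrow> 's \<Rightarrow> 'a) \<Rightarrow> (('s,'a) hist \<Rightarrow> 's)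
                      \<Rightarrow> nat \<Rightarrow> ('s,'a) hist \<Rightarrow> real" where
  "regret P R H act init K hs =
     (\<Sum>k=1..K. Vstar P R H 1 (init (take (k-1) hs))
               - Vpi P R H (act (take (k-1) hs)) 1 (init (take (k-1) hs)))"

definition Ncnt :: "('s,'a) hist \<Rightarrow> 's \<Rightarrow> 'a \<Rightarrow> 's \<Rightarrow> nat" where
  "Ncnt hs x a y = (\<Sum>ep\<leftarrow>hs. length (filter (\<lambda>t. t = (x,a,y)) ep))"

definition Nsa :: "('s::finite,'a) hist \<Rightarrow> 's \<Rightarrow> 'a \<Rightarrow> nat" where
  "Nsa hs x a = (\<Sum>y\<in>UNIV. Ncnt hs x a y)"

definition Phat :: "('s::finite,'a) hist \<Rightarrow> 's \<Rightarrow> 'a \<Rightarrow> 's \<Rightarrow> real" where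
  "Phat hs x a y = real (Ncnt hs x a y) / real (Nsa hs x a)"

text \<open>State x_j of an episode, j in 1..H+1 (1-indexed).\<close>
definition state_at :: "('s,'a) episode \<Rightarrow> nat \<Rightarrow> 's" where
  "state_at ep j = (if j \<le> length ep then fst (ep ! (j-1)) else snd (snd (ep ! (j-2))))"

definition Nprime :: "('s,'a) hist \<Rightarrow> nat \<Rightarrow> 's \<Rightarrow> nat" where
  "Nprime hs j y = length (filter (\<lambda>ep. state_at ep j = y) hs)"

definition phat_mean :: "('s::finite,'a) hist \<Rightarrow> 's \<Rightarrow> 'a \<Rightarrow> ('s \<Rightarrow> real) \<Rightarrow> real" where
  "phat_mean hs x a V = (\<Sum>y\<in>UNIV. Phat hs x a y * V y)"

definition phat_var :: "('s::finite,'a) hist \<Rightarrow> 's \<Rightarrow> 'a \<Rightarrow> ('s \<Rightarrow> real) \<Rightarrow> real" where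
  "phat_var hs x a V = (\<Sum>y\<in>UNIV. Phat hs x a y * (V y - phat_mean hs x a V)^2)"

text \<open>A bonus rule bon hs h V x a receives the history, the step h, and V_{k,h+1}.\<close>
definition Qnew :: "nat \<Rightarrow> ('s::finite \<Rightarrow> 'a::finite \<Rightarrow> real)
      \<Rightarrow> (('s,'a) hist \<Rightarrow> nat \<Rightarrow> ('s \<Rightarrow> real) \<Rightarrow> 's \<Rightarrow> 'a \<Rightarrow> real)
      \<Rightarrow> ('s,'a) hist \<Rightarrow> (nat \<Rightarrow> 's \<Rightarrow> 'a \<Rightarrow> real) \<Rightarrow> nat \<Rightarrow> ('s \<Rightarrow> real) \<Rightarrow> 's \<Rightarrow> 'a \<Rightarrow> real" where
  "Qnew H R bon hs prevQ h V' x a =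
     (if Nsa hs x a > 0
      then min (prevQ h x a) (min (real H) (R x a + phat_mean hs x a V' + bon hs h V' x a))
      else real H)"

text \<open>Vback ... m = V_{k,H+1-m}.\<close>
fun Vback :: "nat \<Rightarrow> ('s::finite \<Rightarrow> 'a::finite \<Rightarrow> real)
      \<Rightarrow> (('s,'a) hist \<Rightarrow> nat \<Rightarrow> ('s \<Rightarrow> real) \<Rightarrow> 's \<Rightarrow> 'a \<Rightarrow> real)
      \<Rightarrow> ('s,'a) hist \<Rightarrow> (nat \<Rightarrow> 's \<Rightarrow> 'a \<Rightarrow> real) \<Rightarrow> nat \<Rightarrow> 's \<Rightarrow> real" where
  "Vback H R bon hs prevQ 0 = (\<lambda>x. 0)"
| "Vback H R bon hs prevQ (Suc m) =
     (\<lambda>x. Max (range (Qnew H R bon hs prevQ (H - m) (Vback H R bon hs prevQ m) x)))"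

definition Qat :: "nat \<Rightarrow> ('s::finite \<Rightarrow> 'a::finite \<Rightarrow> real)
      \<Rightarrow> (('s,'a) hist \<Rightarrow> nat \<Rightarrow> ('s \<Rightarrow> real) \<Rightarrow> 's \<Rightarrow> 'a \<Rightarrow> real)
      \<Rightarrow> ('s,'a) hist \<Rightarrow> (nat \<Rightarrow> 's \<Rightarrow> 'a \<Rightarrow> real) \<Rightarrow> nat \<Rightarrow> 's \<Rightarrow> 'a \<Rightarrow> real" where
  "Qat H R bon hs prevQ h = Qnew H R bon hs prevQ h (Vback H R bon hs prevQ (H - h))"

text \<open>Qseq ... hs k = Q_k computed from the first k-1 episodes of hs; Q_0 = H.\<close>
fun Qseq :: "nat \<Rightarrow> ('s::finite \<Rightarrow> 'a::finite \<Rightarrow> real)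
      \<Rightarrow> (('s,'a) hist \<Rightarrow> nat \<Rightarrow> ('s \<Rightarrow> real) \<Rightarrow> 's \<Rightarrow> 'a \<Rightarrow> real)
      \<Rightarrow> ('s,'a) hist \<Rightarrow> nat \<Rightarrow> nat \<Rightarrow> 's \<Rightarrow> 'a \<Rightarrow> real" where
  "Qseq H R bon hs 0 = (\<lambda>h x a. real H)"
| "Qseq H R bon hs (Suc j) = Qat H R bon (take j hs) (Qseq H R bon hs j)"

text \<open>Q_{k,h} used in episode k = length hs + 1, where hs are the previous episodes.\<close>
definition ucbvi_Q :: "nat \<Rightarrow> ('s::finite \<Rightarrow> 'a::finite \<Rightarrow> real)
      \<Rightarrow> (('s,'a) hist \<Rightarrow> nat \<Rightarrow> ('s \<Rightarrow> real) \<Rightarrow> 's \<Rightarrow> 'a \<Rightarrow> real)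
      \<Rightarrow> ('s,'a) hist \<Rightarrow> nat \<Rightarrow> 's \<Rightarrow> 'a \<Rightarrow> real" where
  "ucbvi_Q H R bon hs = Qseq H R bon hs (Suc (length hs))"

definition bf_bonus :: "nat \<Rightarrow> nat \<Rightarrow> real \<Rightarrow> ('s::finite,'a::finite) hist \<Rightarrow> nat
      \<Rightarrow> ('s \<Rightarrow> real) \<Rightarrow> 's \<Rightarrow> 'a \<Rightarrow> real" where
  "bf_bonus H K \<delta> hs h V x a =
    (let S = real CARD('s); A = real CARD('a); Hr = real H;
         L' = ln (5 * S * A * (real K * Hr) / \<delta>); N = real (Nsa hs x a)
     in sqrt (8 * L' * phat_var hs x a V / N) + 14 * Hr * L' / (3 * N)
        + sqrt (8 * (\<Sum>y\<in>UNIV. Phat hs x a y *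
              (if Nprime hs (Suc h) y = 0 then Hr^2
               else min (100^2 * Hr^3 * S^2 * A * L'^2 / real (Nprime hs (Suc h) y)) (Hr^2))) / N))"

end

theory Submission
  imports Defs
begin

text \<open>
  The value functions are optimistic without any help from the third term of the bonus. With
  q = L' / N, the functional
    V \<mapsto> \<Sum>y. Phat y * V y + max (sqrt (14/3 * q * Var V)) (14/3 * q * H)
  is monotone in V, so passing from V* to V_{k,h+1} \<ge> V* can only increase it, and an empirical
  Bernstein inequality for the fixed function V* suffices. That inequality comes from the
  supermartingale exp (t \<xi> - t^2 \<xi>^2 / (2 (1 - t))), for t on the grid j / K, and Ville's maximal
  inequality at episode granularity.

  The regret is then bounded in expectation over each episode: unrolling the one-step error along
  the state distribution of the current policy leaves expected sums of sqrt (Var / N), of 1 / N and of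
  the third bonus term. Visit counts are compared with their conditional means, the variances sum
  to at most H^2 per episode by the law of total variance, and replacing the variance of V_{k,h+1}
  by that of V^pi costs H times the error itself, which the resulting quadratic inequality absorbs.
  If K \<le> 2500 H S^2 A L'^2, the trivial bound H K on the regret already suffices.
\<close>

section \<open>Weighted means and variances\<close>

text \<open>The obstacle is that the bonus is evaluated at V_{k,h+1}, which depends on the same data
  as \<open>Phat\<close>, while concentration is available only for a fixed function, here V*. The
  constant 14/3 is read off the linear bonus term 14 H L' / (3 N): monotonicity needs the floor of
  the deviation to be H times the square of the factor in front of the standard deviation, and 14/3
  \<le> 8 fits under the first bonus term. The random square \<xi>^2 in the exponent puts an
  empirical second moment straight into the bound. Since exp (-L') = \<delta> / (5 S A K H), the
  union bound can afford only a multiple of S A K H events; the maximal inequality covers all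
  episodes at once, which frees the factor K for the grid of t. Large K also makes this grid fine
  enough, gives L' \<ge> 8 and lets the S A S transition events fit the budget. Regret is a sum of
  values, hence of conditional expectations given the past, so the error sums carry state laws as
  weights and realised trajectories enter only through counts.\<close>

text \<open>Weights are plain real functions, so that the kernel \<open>P\<close> and the
  frequencies \<open>Phat\<close>, which are no distribution while the count is zero, share one
  calculus.\<close>

definition prob_weights :: "('s::finite \<Rightarrow> real) \<Rightarrow> bool" where
  "prob_weights p \<longleftrightarrow> (\<forall>y. 0 \<le> p y) \<and> (\<Sum>y\<in>UNIV. p y) = 1"

definition wmean :: "('s::finite \<Rightarrow> real) \<Rightarrow> ('s \<Rightarrow> real) \<Rightarrow> real" where
  "wmean p f = (\<Sum>y\<in>UNIV. p y * f y)"

definition wvar :: "('s::finite \<Rightarrow> real) \<Rightarrow> ('s \<Rightarrow> real) \<Rightarrow> real" where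
  "wvar p f = (\<Sum>y\<in>UNIV. p y * (f y - wmean p f)\<^sup>2)"

lemma wmean_mono:
  assumes "prob_weights p" "\<And>y. f y \<le> g y"
  shows "wmean p f \<le> wmean p g"
  using assms unfolding wmean_def prob_weights_def by (intro sum_mono mult_left_mono) auto

lemma wmean_const: "prob_weights p \<Longrightarrow> wmean p (\<lambda>_. c) = c"
  unfolding wmean_def prob_weights_def by (simp flip: sum_distrib_right)

lemma wmean_add: "wmean p (\<lambda>y. f y + g y) = wmean p f + wmean p g"
  unfolding wmean_def by (simp add: distrib_left sum.distrib)

lemma wmean_diff: "wmean p (\<lambda>y. f y - g y) = wmean p f - wmean p g"
  unfolding wmean_def by (simp add: right_diff_distrib sum_subtractf)

lemma wmean_cmult: "wmean p (\<lambda>y. c * f y) = c * wmean p f"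
  unfolding wmean_def by (simp add: sum_distrib_left mult_ac)

lemma wmean_nonneg: "prob_weights p \<Longrightarrow> (\<And>y. 0 \<le> f y) \<Longrightarrow> 0 \<le> wmean p f"
  using wmean_mono[of p "\<lambda>_. 0" f] wmean_const[of p 0] by simp

lemma wmean_le: "prob_weights p \<Longrightarrow> (\<And>y. f y \<le> c) \<Longrightarrow> wmean p f \<le> c"
  using wmean_mono[of p f "\<lambda>_. c"] wmean_const[of p c] by simp

lemma wvar_conv: "wvar p f = wmean p (\<lambda>y. (f y - wmean p f)\<^sup>2)"
  unfolding wvar_def wmean_def ..

lemma wvar_nonneg: "prob_weights p \<Longrightarrow> 0 \<le> wvar p f"
  unfolding wvar_conv by (rule wmean_nonneg) auto

text \<open>Bias-variance decomposition. Its main use takes empirical weights and the true mean as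
  \<open>c\<close>, where the bias is the very deviation to be bounded.\<close>

lemma second_moment_about:
  assumes "prob_weights p"
  shows "wmean p (\<lambda>y. (f y - c)\<^sup>2) = wvar p f + (wmean p f - c)\<^sup>2"
proof -
  let ?m = "wmean p f"
  have "(\<lambda>y. (f y - c)\<^sup>2) = (\<lambda>y. (f y - ?m)\<^sup>2 + (2 * (?m - c) * (f y - ?m) + (?m - c)\<^sup>2))"
    by (rule ext) (simp add: power2_eq_square algebra_simps)
  then show ?thesis
    by (simp only: wmean_add wmean_cmult wmean_diff wmean_const[OF assms] wvar_conv) simp
qed

lemma wvar_le_second_moment:
  "prob_weights p \<Longrightarrow> wvar p f \<le> wmean p (\<lambda>y. (f y - c)\<^sup>2)"
  by (simp add: second_moment_about)

lemma wvar_eq: "prob_weights p \<Longrightarrow> wvar p f = wmean p (\<lambda>y. (f y)\<^sup>2) - (wmean p f)\<^sup>2"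
  using second_moment_about[of p f 0] by simp

lemma wvar_le_quarter:
  assumes p: "prob_weights p" and f: "\<And>y. 0 \<le> f y \<and> f y \<le> h"
  shows "wvar p f \<le> h\<^sup>2 / 4"
proof -
  have "wvar p f \<le> wmean p (\<lambda>y. (f y - h/2)\<^sup>2)"
    by (rule wvar_le_second_moment[OF p])
  also have "\<dots> \<le> h\<^sup>2 / 4"
  proof (rule wmean_le[OF p])
    fix y
    have "\<bar>f y - h/2\<bar> \<le> h/2" using f[of y] by (auto simp: abs_le_iff field_simps)
    then have "(f y - h/2)\<^sup>2 \<le> (h/2)\<^sup>2" by (rule power2_le_iff_abs_le[THEN iffD2, rotated]) (use f[of y] in auto)
    then show "(f y - h/2)\<^sup>2 \<le> h\<^sup>2/4" by (simp add: power_divide)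
  qed
  finally show ?thesis .
qed

lemma wvar_perturb:
  assumes p: "prob_weights p"
  shows "wvar p f \<le> 2 * wvar p g + 2 * wmean p (\<lambda>y. (f y - g y)\<^sup>2)"
proof -
  have "wvar p f \<le> wmean p (\<lambda>y. (f y - wmean p g)\<^sup>2)"
    by (rule wvar_le_second_moment[OF p])
  also have "\<dots> \<le> wmean p (\<lambda>y. 2 * (g y - wmean p g)\<^sup>2 + 2 * (f y - g y)\<^sup>2)"
  proof (rule wmean_mono[OF p])
    fix y
    show "(f y - wmean p g)\<^sup>2 \<le> 2 * (g y - wmean p g)\<^sup>2 + 2 * (f y - g y)\<^sup>2"
      using zero_le_power2[of "(g y - wmean p g) - (f y - g y)"]
      by (simp add: power2_eq_square algebra_simps)
  qed
  also have "\<dots> = 2 * wvar p g + 2 * wmean p (\<lambda>y. (f y - g y)\<^sup>2)"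
    by (simp only: wmean_add wmean_cmult wvar_conv)
  finally show ?thesis .
qed

section \<open>Deterministic inequalities behind the empirical Bernstein bound\<close>

text \<open>Raising \<open>f\<close> to \<open>g\<close> raises the mean by some D and cannot lower
  the second moment, so the variance drops by at most 2 h D. Above the floor s h the square root has
  slope at most 1 / (2 s h), so s times the standard deviation loses at most D, which the mean has
  gained.\<close>

lemma mean_plus_deviation_mono:
  fixes h s :: real
  assumes p: "prob_weights p" and f: "\<And>y. 0 \<le> f y" and fg: "\<And>y. f y \<le> g y"
    and g: "\<And>y. g y \<le> h" and s: "0 < s" and h: "0 < h"
  shows "wmean p f + max (s * sqrt (wvar p f)) (s\<^sup>2 * h)
       \<le> wmean p g + max (s * sqrt (wvar p g)) (s\<^sup>2 * h)"
proof -
  let ?D = "wmean p g - wmean p f"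
  have D: "0 \<le> ?D" using wmean_mono[OF p fg] by simp
  have fgb: "wmean p g \<le> h" "wmean p f \<le> h"
    using wmean_le[OF p] g fg by (meson order_trans)+
  have m2: "wmean p (\<lambda>y. (f y)\<^sup>2) \<le> wmean p (\<lambda>y. (g y)\<^sup>2)"
    by (rule wmean_mono[OF p]) (simp add: power_mono f fg)
  have "wvar p f - wvar p g \<le> (wmean p g)\<^sup>2 - (wmean p f)\<^sup>2"
    using m2 by (simp add: wvar_eq[OF p])
  also have "\<dots> = ?D * (wmean p g + wmean p f)"
    by (simp add: power2_eq_square algebra_simps)
  also have "\<dots> \<le> ?D * (2 * h)"
    using D fgb by (intro mult_left_mono) auto
  finally have vd: "wvar p f - wvar p g \<le> 2 * h * ?D" by (simp add: mult_ac)
  define M where "M = max (sqrt (wvar p g)) (s * h)"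
  have M: "max (s * sqrt (wvar p g)) (s\<^sup>2 * h) = s * M"
    unfolding M_def using s by (simp add: max_mult_distrib_left power2_eq_square mult_ac)
  have M0: "s * h \<le> M" "0 < M" "sqrt (wvar p g) \<le> M" unfolding M_def using s h by (auto simp: less_max_iff_disj)
  have "s * sqrt (wvar p f) \<le> ?D + s * M"
  proof (cases "sqrt (wvar p f) \<le> M")
    case True
    then show ?thesis using D s by (simp add: add_increasing)
  next
    case False
    then have gt: "M < sqrt (wvar p f)" by simp
    have "(sqrt (wvar p f) - M) * (2 * (s * h)) \<le> (sqrt (wvar p f) - M) * (sqrt (wvar p f) + M)"
      using gt M0 by (intro mult_left_mono) auto
    also have "\<dots> = wvar p f - M\<^sup>2"
      using wvar_nonneg[OF p, of f] by (simp add: algebra_simps power2_eq_square)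
    also have "\<dots> \<le> wvar p f - wvar p g"
    proof -
      have "(sqrt (wvar p g))\<^sup>2 \<le> M\<^sup>2" by (rule power_mono) (use M0 wvar_nonneg[OF p] in auto)
      then show ?thesis using wvar_nonneg[OF p, of g] by simp
    qed
    also note vd
    finally have "(s * (sqrt (wvar p f) - M)) * (2 * h) \<le> ?D * (2 * h)" by (simp add: mult_ac)
    then have "s * (sqrt (wvar p f) - M) \<le> ?D" using h by simp
    then show ?thesis by (simp add: algebra_simps)
  qed
  moreover have "s\<^sup>2 * h \<le> ?D + s * M"
    using s D mult_left_mono[OF M0(1), of s] unfolding power2_eq_square mult.assoc by linarith
  ultimately show ?thesis unfolding M by simp
qed

text \<open>The grid point just below the minimiser \<open>sqrt (2 q) / (sqrt v + sqrt (2 q))\<close> of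
  \<open>t * v / (2 * (1 - t)) + q / t\<close> loses only the factor 101/100.\<close>

lemma bernstein_grid:
  fixes d q v :: real and n :: nat
  assumes grid: "\<And>j. 1 \<le> j \<Longrightarrow> j < n \<Longrightarrow>
      (real j / n) * d \<le> (real j / n)\<^sup>2 / (2 * (1 - real j / n)) * v + q"
    and q: "0 < q" "q \<le> 1/4" and v: "0 \<le> v" "v \<le> 1"
    and n: "202 \<le> real n * sqrt (2 * q)"
  shows "d \<le> 101/100 * (sqrt (2 * q * v) + q)"
proof -
  define s where "s = sqrt (2 * q)"
  have s0: "0 < s" and s2: "s\<^sup>2 = 2 * q" using q by (auto simp: s_def)
  have "s\<^sup>2 \<le> 1" using s2 q by simp
  then have s1: "s \<le> 1" using s0 power2_le_imp_le[of s 1] by simp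
  have sv: "sqrt v \<le> 1" "0 \<le> sqrt v" using v by auto
  define l where "l = s / (sqrt v + s)"
  have vs: "0 < sqrt v + s" using s0 sv by linarith
  have l0: "0 < l" "l \<le> 1" using s0 sv vs by (auto simp: l_def pos_divide_le_eq)
  have n0: "0 < real n" using n s0 by (cases n) auto
  \<comment> \<open>Both \<open>sqrt v\<close> and \<open>s\<close> are at most 1, so
    \<open>l\<close> is at least s / 2. The value 101 makes the grid index at least 100, whence
    rounding down costs at most the factor 101/100.\<close>
  have nl: "101 \<le> real n * l"
  proof -
    have "s / 2 \<le> l" unfolding l_def using s0 s1 sv vs by (intro divide_left_mono) (linarith | simp)+
    then have "real n * (s / 2) \<le> real n * l" using n0 by (intro mult_left_mono) auto
    then show ?thesis using n s_def by simp
  qed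
  \<comment> \<open>Ceiling minus one instead of floor: \<open>t\<close> must stay strictly below
    \<open>l\<close>, since \<open>l\<close> equals 1 when \<open>v\<close> is 0 and the bound
    divides by 1 - t.\<close>
  define j where "j = nat (\<lceil>real n * l\<rceil> - 1)"
  have c: "\<lceil>real n * l\<rceil> \<ge> 101" using nl by linarith
  have jr: "real j = of_int \<lceil>real n * l\<rceil> - 1" using c by (simp add: j_def)
  have j_lo: "real n * l - 1 \<le> real j" and j_hi: "real j < real n * l"
    using jr by linarith+
  have j1: "1 \<le> j" using j_lo nl by linarith
  have "real n * l \<le> real n" using l0 n0 by simp
  then have jn: "j < n" using j_hi by linarith
  define t where "t = real j / n"
  have t0: "0 < t" "t < 1" using j1 jn by (auto simp: t_def)
  have tl: "t < l" using j_hi n0 by (simp add: t_def field_simps)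
  have lt: "l \<le> 101/100 * t"
  proof -
    have "real n * l \<le> 101/100 * real j" using j_lo nl by linarith
    then show ?thesis using n0 by (simp add: t_def field_simps)
  qed
  have "t * d \<le> t\<^sup>2 / (2 * (1 - t)) * v + q" using grid[OF j1 jn] by (simp add: t_def)
  then have "d \<le> (t\<^sup>2 / (2 * (1 - t)) * v + q) / t" using t0 by (simp add: pos_le_divide_eq mult.commute)
  also have "\<dots> = t * v / (2 * (1 - t)) + q / t"
    using t0 by (simp add: field_simps power2_eq_square)
  also have "t * v / (2 * (1 - t)) \<le> s * sqrt v / 2"
  proof -
    have "t * (sqrt v + s) \<le> l * (sqrt v + s)" using tl s0 sv by (intro mult_right_mono) auto
    also have "\<dots> = s" unfolding l_def using vs by simp
    finally have "t * sqrt v \<le> s * (1 - t)" by (simp add: algebra_simps)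
    then have "t * sqrt v * sqrt v \<le> s * (1 - t) * sqrt v" using sv by (intro mult_right_mono) auto
    then have "t * v \<le> s * (1 - t) * sqrt v" using v by (simp add: mult.assoc)
    then show ?thesis using t0 by (simp add: field_simps)
  qed
  also have "q / t \<le> 101/100 * (q / l)"
  proof -
    have "q * l \<le> q * (101/100 * t)" using lt q by (intro mult_left_mono) auto
    then show ?thesis using t0 l0 by (simp add: field_simps)
  qed
  also have "q / l = s * sqrt v / 2 + q"
  proof -
    have "q = s\<^sup>2 / 2" using s2 by simp
    then have "q / l = s\<^sup>2 / 2 / (s / (sqrt v + s))" by (simp only: l_def)
    also have "\<dots> = s * (sqrt v + s) / 2" using s0 vs by (simp add: field_simps power2_eq_square)
    also have "\<dots> = s * sqrt v / 2 + s\<^sup>2 / 2" by (simp add: field_simps power2_eq_square)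
    finally show ?thesis using s2 by simp
  qed
  finally have "d \<le> s * sqrt v / 2 + 101/100 * (s * sqrt v / 2 + q)" by simp
  moreover have "0 \<le> s * sqrt v" using s0 sv by simp
  ultimately have "d \<le> 101/100 * (s * sqrt v + q)" by argo
  then show ?thesis by (simp add: s_def real_sqrt_mult)
qed

text \<open>\<open>D\<close> is the deviation of the mean and \<open>U\<close> the empirical
  variance, in units of H and H^2; the second moment about the true mean is then U + D^2, so
  \<open>D\<close> occurs on both sides. If \<open>D\<close> exceeded both arguments of the maximum,
  then q < 3 D / 14 and q U < 3 D^2 / 14, and the right-hand side would be smaller than
  \<open>D\<close>.\<close>

lemma bernstein_self_bound:
  fixes D q U :: real
  assumes hyp: "D \<le> 101/100 * (sqrt (2 * q * (U + D\<^sup>2)) + q)"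
    and U: "0 \<le> U" "U \<le> 1/4" and D1: "D \<le> 1" and q: "0 < q"
  shows "D \<le> max (sqrt (14/3 * q * U)) (14/3 * q)"
proof (rule ccontr)
  assume "\<not> ?thesis"
  then have D_sq: "sqrt (14/3 * q * U) < D" and D_q: "14/3 * q < D" by auto
  have D0: "0 < D" using D_q q by simp
  have "(sqrt (14/3 * q * U))\<^sup>2 < D\<^sup>2" by (rule power_strict_mono) (use D_sq q U in auto)
  then have qU: "14/3 * (q * U) < D\<^sup>2" using q U by simp
  \<comment> \<open>The threshold is just below 100/101 - 3/14: a square root of at most this
    multiple of \<open>D\<close> together with q < 3 D / 14 contradicts the hypothesis.\<close>
  have sm: "sqrt (2 * q * (U + D\<^sup>2)) \<le> r * D \<Longrightarrow> r < 7758/10000 \<Longrightarrow> False" for r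
  proof -
    assume a: "sqrt (2 * q * (U + D\<^sup>2)) \<le> r * D" "r < 7758/10000"
    have "r * D < 7758/10000 * D" using a(2) D0 by simp
    then have "sqrt (2 * q * (U + D\<^sup>2)) + q < 7758/10000 * D + 3/14 * D"
      using a(1) D_q by simp
    then have "101/100 * (sqrt (2 * q * (U + D\<^sup>2)) + q) < 101/100 * (7758/10000 * D + 3/14 * D)"
      by (intro mult_strict_left_mono) auto
    also have "\<dots> \<le> D" using D0 by simp
    finally show False using hyp by simp
  qed
  show False
  proof (cases "q \<le> 1/20")
    case True
    have "2 * q * D\<^sup>2 \<le> 1/10 * D\<^sup>2" using True by (intro mult_right_mono) auto
    then have "2 * q * (U + D\<^sup>2) \<le> (3/7 + 1/10) * D\<^sup>2" using qU by (simp add: algebra_simps)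
    also have "\<dots> \<le> (73/100 * D)\<^sup>2" by (simp add: power_mult_distrib power2_eq_square)
    finally have "sqrt (2 * q * (U + D\<^sup>2)) \<le> 73/100 * D" using D0 by (intro real_le_lsqrt) auto
    then show False using sm by fastforce
  next
    case False
    then have Dl: "2333/10000 < D" using D_q by simp
    have "2 * q * (U + D\<^sup>2) \<le> 3/7 * D * (1/4 + D\<^sup>2)"
      by (rule mult_mono) (use D_q U q D0 in auto)
    also have "\<dots> \<le> (775/1000 * D)\<^sup>2"
    proof -
      \<comment> \<open>The required inequality is quadratic and convex in \<open>D\<close>, so it
        holds between the endpoints 2333/10000 and 1 once it holds at both; this product is the
        corresponding chord estimate.\<close>
      have "0 \<le> (D - 2333/10000) * (1 - D)" using Dl D1 by simp
      then have "3/7 * (1/4 + D\<^sup>2) \<le> (775/1000)\<^sup>2 * D"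
        using Dl unfolding power2_eq_square left_diff_distrib right_diff_distrib
          distrib_left distrib_right mult_1_right by linarith
      then have "D * (3/7 * (1/4 + D\<^sup>2)) \<le> D * ((775/1000)\<^sup>2 * D)" using D0 by (intro mult_left_mono) auto
      then show ?thesis by (simp add: power2_eq_square mult_ac)
    qed
    finally have "sqrt (2 * q * (U + D\<^sup>2)) \<le> 775/1000 * D" using D0 by (intro real_le_lsqrt) auto
    then show False using sm by fastforce
  qed
qed

section \<open>Concentration along the learning process\<close>

lemma expectation_finite_type:
  fixes p :: "'s::finite pmf"
  shows "measure_pmf.expectation p f = wmean (pmf p) f"
  by (subst integral_measure_pmf_real[of UNIV]) (auto simp: wmean_def mult.commute)

lemma prob_weights_pmf: "prob_weights (pmf (p :: 's::finite pmf))"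
  unfolding prob_weights_def by (simp add: sum_pmf_eq_1)

lemma expectation_bind_finite:
  assumes "finite (set_pmf p)" "\<And>x. x \<in> set_pmf p \<Longrightarrow> finite (set_pmf (f x))"
  shows "measure_pmf.expectation (bind_pmf p f) g
       = measure_pmf.expectation p (\<lambda>x. measure_pmf.expectation (f x) (g :: _ \<Rightarrow> real))"
  by (subst pmf_expectation_bind[of "set_pmf p"], (use assms in auto)[3],
      subst integral_measure_pmf_real[of "set_pmf p"]) (use assms in \<open>auto simp: mult.commute\<close>)

lemma expectation_of_bool:
  "measure_pmf.expectation p (\<lambda>x. of_bool (Q x) :: real) = measure_pmf.prob p {x. Q x}"
proof -
  have "(\<lambda>x. of_bool (Q x) :: real) = indicator {x. Q x}" by (auto simp: indicator_def)
  then show ?thesis by simp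
qed

lemma expectation_mono_finite:
  fixes f g :: "'b \<Rightarrow> real"
  assumes "finite (set_pmf p)" "\<And>x. x \<in> set_pmf p \<Longrightarrow> f x \<le> g x"
  shows "measure_pmf.expectation p f \<le> measure_pmf.expectation p g"
  using assms by (intro integral_mono_AE integrable_measure_pmf_finite) (auto simp: AE_measure_pmf_iff)

lemma finite_set_pmf_gen_steps:
  "finite (set_pmf (gen_steps (P :: 's::finite \<Rightarrow> 'a \<Rightarrow> 's pmf) pol h n x))"
  by (induction n arbitrary: h x) auto

lemma finite_set_pmf_gen_hist:
  "finite (set_pmf (gen_hist (P :: 's::finite \<Rightarrow> 'a \<Rightarrow> 's pmf) H act init k))"
  by (induction k) (auto simp: finite_set_pmf_gen_steps)

lemma length_gen_steps: "ep \<in> set_pmf (gen_steps P pol h n x) \<Longrightarrow> length ep = n"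
  by (induction n arbitrary: h x ep) auto

lemma length_gen_hist: "hs \<in> set_pmf (gen_hist P H act init k) \<Longrightarrow> length hs = k"
  by (induction k arbitrary: hs) auto

lemma length_episode_gen_hist:
  "hs \<in> set_pmf (gen_hist P H act init k) \<Longrightarrow> ep \<in> set hs \<Longrightarrow> length ep = H"
  by (induction k arbitrary: hs) (auto dest: length_gen_steps)

section \<open>Exponential supermartingales over whole episodes\<close>

lemma expectation_path_product_le_1:
  fixes P :: "'s::finite \<Rightarrow> 'a \<Rightarrow> 's pmf" and \<phi> :: "'s \<times> 'a \<times> 's \<Rightarrow> real"
  assumes nonneg: "\<And>t. 0 \<le> \<phi> t"
    and step: "\<And>x a. measure_pmf.expectation (P x a) (\<lambda>y. \<phi> (x, a, y)) \<le> 1"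
  shows "measure_pmf.expectation (gen_steps P pol h n x) (\<lambda>ep. \<Prod>t\<leftarrow>ep. \<phi> t) \<le> 1"
proof (induction n arbitrary: h x)
  case 0
  show ?case by simp
next
  case (Suc n)
  have "measure_pmf.expectation (gen_steps P pol h (Suc n) x) (\<lambda>ep. \<Prod>t\<leftarrow>ep. \<phi> t)
      = measure_pmf.expectation (P x (pol h x)) (\<lambda>y. \<phi> (x, pol h x, y) *
           measure_pmf.expectation (gen_steps P pol (Suc h) n y) (\<lambda>ep. \<Prod>t\<leftarrow>ep. \<phi> t))"
    by (simp add: expectation_bind_finite finite_set_pmf_gen_steps)
  also have "\<dots> \<le> measure_pmf.expectation (P x (pol h x)) (\<lambda>y. \<phi> (x, pol h x, y))"
    by (rule expectation_mono_finite) (auto intro!: mult_left_le Suc nonneg)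
  also have "\<dots> \<le> 1" by (rule step)
  finally show ?case .
qed

text \<open>Ville's inequality with the process observed only at the ends of episodes. A prefix
  length beyond the history just returns the history, so \<open>k\<close> may be unbounded.\<close>

lemma gen_hist_maximal_inequality:
  fixes P :: "'s::finite \<Rightarrow> 'a \<Rightarrow> 's pmf" and M :: "('s,'a) hist \<Rightarrow> real"
  assumes M0: "\<And>hs. 0 \<le> M hs" "M [] \<le> 1"
    and step: "\<And>hs. measure_pmf.expectation (gen_steps P (act hs) 1 H (init hs)) (\<lambda>ep. M (hs @ [ep])) \<le> M hs"
    and c: "0 < c"
  shows "measure_pmf.prob (gen_hist P H act init K) {hs. \<exists>k. c \<le> M (take k hs)} \<le> 1 / c"
proof -
  \<comment> \<open>The process is frozen at first crossing, at the level \<open>c\<close> instead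
    of the value attained. This keeps it below \<open>M\<close> at the crossing, so it is still a
    supermartingale, and at least \<open>c\<close> on the event, so Markov's inequality
    applies.\<close>
  define stopped where "stopped hs = (if \<exists>k. c \<le> M (take k hs) then c else M hs)" for hs
  have snoc: "(\<exists>k. c \<le> M (take k (hs @ [ep]))) \<longleftrightarrow> (\<exists>k. c \<le> M (take k hs)) \<or> c \<le> M (hs @ [ep])" for hs ep
  proof
    assume "\<exists>k. c \<le> M (take k (hs @ [ep]))"
    then obtain k where k: "c \<le> M (take k (hs @ [ep]))" by blast
    show "(\<exists>k. c \<le> M (take k hs)) \<or> c \<le> M (hs @ [ep])"
    proof (cases "k \<le> length hs")
      case True
      then show ?thesis using k by auto
    next
      case False
      then have "take k (hs @ [ep]) = hs @ [ep]" by simp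
      then show ?thesis using k by metis
    qed
  next
    assume "(\<exists>k. c \<le> M (take k hs)) \<or> c \<le> M (hs @ [ep])"
    then show "\<exists>k. c \<le> M (take k (hs @ [ep]))"
    proof
      assume "\<exists>k. c \<le> M (take k hs)"
      then obtain k where "c \<le> M (take k hs)" by blast
      then have "c \<le> M (take (min k (length hs)) (hs @ [ep]))" by (cases "k \<le> length hs") (auto simp: min_def)
      then show ?thesis by blast
    next
      assume "c \<le> M (hs @ [ep])"
      then have "c \<le> M (take (Suc (length hs)) (hs @ [ep]))" by simp
      then show ?thesis by blast
    qed
  qed
  have st: "measure_pmf.expectation (gen_steps P (act hs) 1 H (init hs)) (\<lambda>ep. stopped (hs @ [ep]))
      \<le> stopped hs" for hs
  proof (cases "\<exists>k. c \<le> M (take k hs)")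
    case True
    then have "stopped (hs @ [ep]) = c" for ep unfolding stopped_def snoc by simp
    then show ?thesis using True by (simp add: stopped_def)
  next
    case False
    then have "stopped (hs @ [ep]) \<le> M (hs @ [ep])" for ep unfolding stopped_def snoc by simp
    then have "measure_pmf.expectation (gen_steps P (act hs) 1 H (init hs)) (\<lambda>ep. stopped (hs @ [ep]))
      \<le> measure_pmf.expectation (gen_steps P (act hs) 1 H (init hs)) (\<lambda>ep. M (hs @ [ep]))"
      by (intro expectation_mono_finite finite_set_pmf_gen_steps)
    also have "\<dots> \<le> M hs" by (rule step)
    finally show ?thesis using False by (simp add: stopped_def)
  qed
  have E: "measure_pmf.expectation (gen_hist P H act init K) stopped \<le> 1"
  proof (induction K)
    case 0
    show ?case using M0(2) by (auto simp: stopped_def)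
  next
    case (Suc K)
    have "measure_pmf.expectation (gen_hist P H act init (Suc K)) stopped
      = measure_pmf.expectation (gen_hist P H act init K)
         (\<lambda>hs. measure_pmf.expectation (gen_steps P (act hs) 1 H (init hs)) (\<lambda>ep. stopped (hs @ [ep])))"
      by (simp add: expectation_bind_finite finite_set_pmf_gen_steps finite_set_pmf_gen_hist)
    also have "\<dots> \<le> measure_pmf.expectation (gen_hist P H act init K) stopped"
      by (intro expectation_mono_finite finite_set_pmf_gen_hist st)
    finally show ?case using Suc by simp
  qed
  let ?B = "{hs. \<exists>k. c \<le> M (take k hs)}"
  have "c * measure_pmf.prob (gen_hist P H act init K) ?B
     = measure_pmf.expectation (gen_hist P H act init K) (\<lambda>hs. c * indicator ?B hs)"
    by simp
  also have "\<dots> \<le> measure_pmf.expectation (gen_hist P H act init K) stopped"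
    by (intro expectation_mono_finite finite_set_pmf_gen_hist)
       (auto simp: stopped_def indicator_def M0)
  also note E
  finally show ?thesis using c by (simp add: field_simps)
qed

text \<open>Transitions from other pairs contribute 0 to the exponent, so the exponential of the
  count sum is a product over all observed transitions, each factor having conditional mean at most
  1 whatever the policy does.\<close>

lemma transition_sum_concentration:
  fixes P :: "'s::finite \<Rightarrow> 'a \<Rightarrow> 's pmf" and z :: "'s \<Rightarrow> real"
  assumes "measure_pmf.expectation (P x a) (\<lambda>y. exp (z y)) \<le> 1"
  shows "measure_pmf.prob (gen_hist P H act init K)
     {hs. \<exists>k. l \<le> (\<Sum>y\<in>UNIV. real (Ncnt (take k hs) x a y) * z y)} \<le> exp (- l)"
proof -
  define \<zeta> where "\<zeta> t = (if fst t = x \<and> fst (snd t) = a then z (snd (snd t)) else 0)" for t :: "'s \<times> 'a \<times> 's"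
  have ep: "(\<Sum>y\<in>UNIV. real (length (filter (\<lambda>t. t = (x,a,y)) ep)) * z y) = (\<Sum>t\<leftarrow>ep. \<zeta> t)" for ep
  proof (induction ep)
    case Nil
    show ?case by simp
  next
    case (Cons t ep)
    have "(\<Sum>y\<in>UNIV. real (length (filter (\<lambda>t. t = (x,a,y)) (t # ep))) * z y)
       = (\<Sum>y\<in>UNIV. (if t = (x,a,y) then z y else 0)) + (\<Sum>y\<in>UNIV. real (length (filter (\<lambda>t. t = (x,a,y)) ep)) * z y)"
      by (subst sum.distrib[symmetric], rule sum.cong) (auto simp: algebra_simps)
    also have "(\<Sum>y\<in>UNIV. (if t = (x,a,y) then z y else 0)) = \<zeta> t"
    proof (cases t)
      case (fields u b v)
      have "(\<Sum>y\<in>UNIV. (if t = (x,a,y) then z y else 0)) = (\<Sum>y\<in>UNIV. if v = y then (if u = x \<and> b = a then z y else 0) else 0)"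
        by (rule sum.cong) (auto simp: fields)
      then show ?thesis by (simp add: \<zeta>_def fields)
    qed
    finally show ?case using Cons by simp
  qed
  have hist: "(\<Sum>y\<in>UNIV. real (Ncnt hs x a y) * z y) = (\<Sum>ep\<leftarrow>hs. \<Sum>t\<leftarrow>ep. \<zeta> t)" for hs
    by (induction hs) (simp_all add: Ncnt_def distrib_right sum.distrib ep)
  define M where "M hs = exp (\<Sum>y\<in>UNIV. real (Ncnt hs x a y) * z y)" for hs
  have M_snoc: "M (hs @ [ep]) = M hs * (\<Prod>t\<leftarrow>ep. exp (\<zeta> t))" for hs ep
  proof -
    have "exp (\<Sum>t\<leftarrow>ep. \<zeta> t) = (\<Prod>t\<leftarrow>ep. exp (\<zeta> t))" by (induction ep) (auto simp: exp_add)
    then show ?thesis by (simp add: M_def hist exp_add)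
  qed
  have "measure_pmf.prob (gen_hist P H act init K) {hs. \<exists>k. exp l \<le> M (take k hs)} \<le> 1 / exp l"
  proof (rule gen_hist_maximal_inequality)
    show "0 \<le> M hs" for hs by (simp add: M_def)
    show "M [] \<le> 1" by (simp add: M_def Ncnt_def)
    fix hs
    have "measure_pmf.expectation (gen_steps P (act hs) 1 H (init hs)) (\<lambda>ep. \<Prod>t\<leftarrow>ep. exp (\<zeta> t)) \<le> 1"
    proof (rule expectation_path_product_le_1)
      show "measure_pmf.expectation (P x' a') (\<lambda>y. exp (\<zeta> (x', a', y))) \<le> 1" for x' a'
        using assms by (cases "x' = x \<and> a' = a") (auto simp: \<zeta>_def)
    qed auto
    then show "measure_pmf.expectation (gen_steps P (act hs) 1 H (init hs)) (\<lambda>ep. M (hs @ [ep])) \<le> M hs"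
      unfolding M_snoc by (simp add: mult_left_le M_def[of hs])
  qed auto
  then show ?thesis by (simp add: M_def exp_minus inverse_eq_divide)
qed

text \<open>The chord of exp over the interval from -1 to 0 has slope 1 - 1/e, which is at least 5/8
  because e \<ge> 8/3. This is the origin of the factor 5/8 in all count comparisons.\<close>

lemma exp_minus_chord:
  fixes u :: real
  assumes "0 \<le> u" "u \<le> 1"
  shows "exp (- u) \<le> 1 - 5/8 * u"
proof -
  have "convex_on UNIV (exp :: real \<Rightarrow> real)" by (rule exp_convex)
  then have "exp ((1 - u) *\<^sub>R 0 + u *\<^sub>R (-1)) \<le> (1 - u) * exp 0 + u * exp (-1 :: real)"
    using assms by (intro convex_onD) auto
  moreover have "exp (-1 :: real) \<le> 3/8"
  proof -
    have "(41/32 :: real) ^ 4 \<le> exp (1/4) ^ 4"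
      using exp_lower_Taylor_quadratic[of "1/4::real"] by (intro power_mono) (auto simp: power2_eq_square)
    also have "\<dots> = exp 1" by (simp flip: exp_of_nat_mult)
    finally have "8/3 \<le> exp (1::real)" by (simp add: power_divide)
    then show ?thesis by (simp add: exp_minus field_simps)
  qed
  then have "u * exp (-1) \<le> u * (3/8)" using assms by (intro mult_left_mono)
  ultimately show ?thesis by simp
qed

text \<open>Multiplicative lower tail: E exp (-c) \<le> 1 - 5/8 m \<le> exp (-5/8 m) for an episode
  with conditional mean m. The loss is a constant factor plus \<open>l\<close>, with no square-root
  term in the number of episodes.\<close>

lemma episode_count_concentration:
  fixes P :: "'s::finite \<Rightarrow> 'a \<Rightarrow> 's pmf" and c :: "('s,'a) episode \<Rightarrow> real"
    and H :: nat and act init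
  defines "m \<equiv> \<lambda>hs. measure_pmf.expectation (gen_steps P (act hs) 1 H (init hs)) c"
  assumes c: "\<And>ep. length ep = H \<Longrightarrow> 0 \<le> c ep \<and> c ep \<le> 1"
  shows "measure_pmf.prob (gen_hist P H act init K)
     {hs. \<exists>k\<le>length hs. l \<le> (\<Sum>i<k. 5/8 * m (take i hs) - c (hs ! i))} \<le> exp (- l)"
proof -
  define M where "M hs = exp (\<Sum>i<length hs. 5/8 * m (take i hs) - c (hs ! i))" for hs
  have M_snoc: "M (hs @ [ep]) = M hs * exp (5/8 * m hs) * exp (- c ep)" for hs ep
  proof -
    have "(\<Sum>i<length hs. 5/8 * m (take i (hs @ [ep])) - c ((hs @ [ep]) ! i))
        = (\<Sum>i<length hs. 5/8 * m (take i hs) - c (hs ! i))"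
      by (rule sum.cong) (auto simp: nth_append)
    then show ?thesis by (simp add: M_def exp_add[symmetric])
  qed
  have "measure_pmf.prob (gen_hist P H act init K) {hs. \<exists>k. exp l \<le> M (take k hs)} \<le> 1 / exp l"
  proof (rule gen_hist_maximal_inequality)
    show "0 \<le> M hs" for hs by (simp add: M_def)
    show "M [] \<le> 1" by (simp add: M_def)
    fix hs
    let ?E = "measure_pmf.expectation (gen_steps P (act hs) 1 H (init hs))"
    have "?E (\<lambda>ep. exp (- c ep)) \<le> ?E (\<lambda>ep. 1 - 5/8 * c ep)"
      using c by (intro expectation_mono_finite finite_set_pmf_gen_steps exp_minus_chord)
        (auto dest: length_gen_steps)
    also have "\<dots> = 1 - 5/8 * m hs"
      unfolding m_def
      by (subst Bochner_Integration.integral_diff)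
         (auto intro!: integrable_measure_pmf_finite finite_set_pmf_gen_steps)
    also have "\<dots> \<le> exp (- (5/8 * m hs))" using exp_ge_add_one_self[of "- (5/8 * m hs)"] by simp
    finally have "M hs * exp (5/8 * m hs) * ?E (\<lambda>ep. exp (- c ep)) \<le> M hs * exp (5/8 * m hs) * exp (- (5/8 * m hs))"
      by (intro mult_left_mono) (auto simp: M_def)
    also have "\<dots> = M hs" by (simp add: mult.assoc flip: exp_add)
    finally show "?E (\<lambda>ep. M (hs @ [ep])) \<le> M hs" by (simp add: M_snoc)
  qed auto
  moreover have "{hs. \<exists>k\<le>length hs. l \<le> (\<Sum>i<k. 5/8 * m (take i hs) - c (hs ! i))}
     \<subseteq> {hs. \<exists>k. exp l \<le> M (take k hs)}"
  proof safe
    fix hs :: "('s,'a) hist" and k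
    assume k: "k \<le> length hs" "l \<le> (\<Sum>i<k. 5/8 * m (take i hs) - c (hs ! i))"
    have "(\<Sum>i<k. 5/8 * m (take i hs) - c (hs ! i)) = (\<Sum>i<k. 5/8 * m (take i (take k hs)) - c (take k hs ! i))"
      by (rule sum.cong) (auto simp: min_def)
    then have "exp l \<le> M (take k hs)" using k by (simp add: M_def min_def)
    then show "\<exists>k. exp l \<le> M (take k hs)" ..
  qed
  then have "measure_pmf.prob (gen_hist P H act init K)
     {hs. \<exists>k\<le>length hs. l \<le> (\<Sum>i<k. 5/8 * m (take i hs) - c (hs ! i))}
    \<le> measure_pmf.prob (gen_hist P H act init K) {hs. \<exists>k. exp l \<le> M (take k hs)}"
    by (intro measure_pmf.finite_measure_mono) auto
  ultimately show ?thesis by (simp add: exp_minus inverse_eq_divide)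
qed

section \<open>Exponential moments of a single transition\<close>

text \<open>The difference of the two sides has derivative v (1 / (1 - t) - 1 / (1 + v)), which has
  the sign of v on the whole range, so its minimum is 0 at v = 0.\<close>

lemma ln_one_plus_lower_bound_quadratic:
  fixes u t :: real
  assumes t: "0 \<le> t" "t < 1" and u: "- t \<le> u"
  shows "u - u\<^sup>2 / (2 * (1 - t)) \<le> ln (1 + u)"
proof -
  define f where "f v = ln (1 + v) - v + v\<^sup>2 / (2 * (1 - t))" for v
  have der: "(f has_real_derivative v * (1 / (1 - t) - 1 / (1 + v))) (at v)" if "- t \<le> v" for v
  proof -
    have "(f has_real_derivative (1 / (1 + v) - 1 + 2 * v / (2 * (1 - t)))) (at v)"
      unfolding f_def using that t by (auto intro!: derivative_eq_intros)
    moreover have "1 / (1 + v) - 1 = - (v / (1 + v))" using that t by (simp add: field_simps)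
    moreover have "2 * v / (2 * (1 - t)) = v / (1 - t)" by (rule mult_divide_mult_cancel_left) simp
    ultimately show ?thesis by (simp add: right_diff_distrib del: mult_divide_mult_cancel_left_if)
  qed
  have frac: "0 \<le> 1 / (1 - t) - 1 / (1 + v)" if "- t \<le> v" for v
    using that t frac_le[of 1 1 "1 - t" "1 + v"] by simp
  have "f 0 \<le> f u"
  proof (cases "0 \<le> u")
    case True
    show ?thesis
    proof (rule DERIV_nonneg_imp_nondecreasing[OF True])
      fix v assume "0 \<le> v" "v \<le> u"
      then show "\<exists>y. DERIV f v :> y \<and> 0 \<le> y" using der[of v] frac[of v] t
        by (intro exI[of _ "v * (1 / (1 - t) - 1 / (1 + v))"] conjI mult_nonneg_nonneg) auto
    qed
  next
    case False
    then have "u \<le> 0" by simp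
    then show ?thesis
    proof (rule DERIV_nonpos_imp_nonincreasing)
      fix v assume "u \<le> v" "v \<le> 0"
      then show "\<exists>y. DERIV f v :> y \<and> y \<le> 0" using der[of v] frac[of v] u
        by (intro exI[of _ "v * (1 / (1 - t) - 1 / (1 + v))"] conjI mult_nonpos_nonneg) auto
    qed
  qed
  then show ?thesis by (simp add: f_def)
qed

text \<open>The logarithmic bound at u = t \<xi> gives, pointwise, an exponential of at most 1 + t
  \<xi>, whose mean is 1. Keeping \<xi>^2 random in the exponent is what later yields empirical
  rather than true second moments.\<close>

lemma self_normalized_exp_bound:
  fixes p :: "'s::finite pmf" and \<xi> :: "'s \<Rightarrow> real"
  assumes \<xi>: "\<And>y. -1 \<le> \<xi> y" and mean: "wmean (pmf p) \<xi> = 0" and t: "0 \<le> t" "t < 1"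
  shows "measure_pmf.expectation p (\<lambda>y. exp (t * \<xi> y - t\<^sup>2 / (2 * (1 - t)) * (\<xi> y)\<^sup>2)) \<le> 1"
proof -
  have "exp (t * \<xi> y - t\<^sup>2 / (2 * (1 - t)) * (\<xi> y)\<^sup>2) \<le> 1 + t * \<xi> y" for y
  proof -
    have lo: "- t \<le> t * \<xi> y" using \<xi>[of y] t mult_left_mono[of "-1" "\<xi> y" t] by simp
    have "t * \<xi> y - t\<^sup>2 / (2 * (1 - t)) * (\<xi> y)\<^sup>2 \<le> ln (1 + t * \<xi> y)"
      using ln_one_plus_lower_bound_quadratic[OF t lo] by (simp add: power_mult_distrib)
    then have "exp (t * \<xi> y - t\<^sup>2 / (2 * (1 - t)) * (\<xi> y)\<^sup>2) \<le> exp (ln (1 + t * \<xi> y))" by simp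
    also have "\<dots> = 1 + t * \<xi> y" using lo t by (intro exp_ln) auto
    finally show ?thesis .
  qed
  then have "wmean (pmf p) (\<lambda>y. exp (t * \<xi> y - t\<^sup>2 / (2 * (1 - t)) * (\<xi> y)\<^sup>2)) \<le> wmean (pmf p) (\<lambda>y. 1 + t * \<xi> y)"
    by (intro wmean_mono prob_weights_pmf)
  also have "\<dots> = 1" by (simp only: wmean_add wmean_cmult wmean_const[OF prob_weights_pmf] mean)
  finally show ?thesis by (simp add: expectation_finite_type)
qed

text \<open>Chernoff bound for the upper tail of one transition frequency, from exp t \<le> 1 + t +
  t^2. The parameter \<open>t\<close> becomes the relative inflation in
  \<open>Phat_le\<close>.\<close>

lemma indicator_exp_bound:
  fixes p :: "'s::finite pmf"
  assumes t: "0 \<le> t" "t \<le> 1"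
  shows "measure_pmf.expectation p (\<lambda>y. exp (t * of_bool (y = z) - (t + t\<^sup>2) * pmf p z)) \<le> 1"
proof -
  have e: "exp (t * of_bool (y = z)) \<le> 1 + (t + t\<^sup>2) * of_bool (y = z)" for y
    using exp_bound[OF t] by auto
  have "wmean (pmf p) (\<lambda>y. exp (t * of_bool (y = z))) \<le> wmean (pmf p) (\<lambda>y. 1 + (t + t\<^sup>2) * of_bool (y = z))"
    by (intro wmean_mono prob_weights_pmf e)
  also have "\<dots> = 1 + (t + t\<^sup>2) * pmf p z"
    by (simp only: wmean_add wmean_cmult wmean_const[OF prob_weights_pmf])
       (simp add: wmean_def of_bool_def if_distrib[of "\<lambda>x. _ * x"] cong: if_cong)
  also have "\<dots> \<le> exp ((t + t\<^sup>2) * pmf p z)" by (rule exp_ge_add_one_self)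
  finally have "exp (- ((t + t\<^sup>2) * pmf p z)) * wmean (pmf p) (\<lambda>y. exp (t * of_bool (y = z)))
     \<le> exp (- ((t + t\<^sup>2) * pmf p z)) * exp ((t + t\<^sup>2) * pmf p z)"
    by (intro mult_left_mono) auto
  then have "wmean (pmf p) (\<lambda>y. exp (- ((t + t\<^sup>2) * pmf p z)) * exp (t * of_bool (y = z))) \<le> 1"
    by (simp only: wmean_cmult) (simp flip: exp_add)
  then show ?thesis by (simp add: expectation_finite_type flip: exp_add)
qed

section \<open>State laws under a fixed policy\<close>

text \<open>\<open>occ P pol h x i\<close> is the law of the state \<open>i\<close> transitions after being in \<open>x\<close> at step \<open>h\<close>.\<close>

fun occ :: "('s \<Rightarrow> 'a \<Rightarrow> 's pmf) \<Rightarrow> (nat \<Rightarrow> 's \<Rightarrow> 'a) \<Rightarrow> nat \<Rightarrow> 's \<Rightarrow> nat \<Rightarrow> 's pmf" where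
  "occ P pol h x 0 = return_pmf x"
| "occ P pol h x (Suc i) = bind_pmf (occ P pol h x i) (\<lambda>y. P y (pol (h + i) y))"

text \<open>\<open>occ\<close> extends a path at its end, \<open>gen_steps\<close> at its beginning;
  this identity reconciles the two recursions.\<close>

lemma occ_front: "occ P pol h x (Suc i) = bind_pmf (P x (pol h x)) (\<lambda>y. occ P pol (Suc h) y i)"
proof (induction i)
  case 0
  show ?case by (simp add: bind_return_pmf bind_return_pmf')
next
  case (Suc i)
  have "occ P pol h x (Suc (Suc i)) = bind_pmf (occ P pol h x (Suc i)) (\<lambda>y. P y (pol (h + Suc i) y))"
    by simp
  also have "\<dots> = bind_pmf (P x (pol h x)) (\<lambda>y. occ P pol (Suc h) y (Suc i))"
    by (simp only: Suc bind_assoc_pmf) simp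
  finally show ?case .
qed

lemma gen_steps_state: "i < n \<Longrightarrow> map_pmf (\<lambda>ep. fst (ep ! i)) (gen_steps P pol h n x) = occ P pol h x i"
proof (induction n arbitrary: i h x)
  case (Suc n)
  show ?case
  proof (cases i)
    case 0
    then show ?thesis by (simp add: map_bind_pmf pmf.map_comp o_def map_pmf_const)
  next
    case (Suc j)
    then show ?thesis using Suc.IH[of j] Suc.prems
      by (simp add: map_bind_pmf pmf.map_comp o_def occ_front del: occ.simps)
  qed
qed simp

lemma gen_steps_next_state:
  "i < n \<Longrightarrow> map_pmf (\<lambda>ep. snd (snd (ep ! i))) (gen_steps P pol h n x) = occ P pol h x (Suc i)"
proof (induction n arbitrary: i h x)
  case (Suc n)
  show ?case
  proof (cases i)
    case 0
    then show ?thesis by (simp add: map_bind_pmf pmf.map_comp o_def map_pmf_const bind_return_pmf bind_return_pmf')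
  next
    case (Suc j)
    then show ?thesis using Suc.IH[of j] Suc.prems
      by (simp add: map_bind_pmf pmf.map_comp o_def occ_front del: occ.simps)
  qed
qed simp

lemma gen_steps_action:
  "ep \<in> set_pmf (gen_steps P pol h n x) \<Longrightarrow> i < n \<Longrightarrow> fst (snd (ep ! i)) = pol (h + i) (fst (ep ! i))"
proof (induction n arbitrary: i h x ep)
  case (Suc n)
  then show ?case by (cases i) auto
qed simp

lemma expectation_visits:
  fixes P :: "'s::finite \<Rightarrow> 'a \<Rightarrow> 's pmf"
  shows "measure_pmf.expectation (gen_steps P pol h n x0)
      (\<lambda>ep. real (length (filter (\<lambda>t. fst t = x \<and> fst (snd t) = a) ep)))
    = (\<Sum>i<n. pmf (occ P pol h x0 i) x * of_bool (pol (h + i) x = a))"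
proof -
  let ?p = "gen_steps P pol h n x0"
  have "measure_pmf.expectation ?p (\<lambda>ep. real (length (filter (\<lambda>t. fst t = x \<and> fst (snd t) = a) ep)))
     = measure_pmf.expectation ?p (\<lambda>ep. \<Sum>i<n. of_bool (fst (ep ! i) = x) * of_bool (pol (h + i) x = a))"
  proof (rule integral_cong_AE)
    show "AE ep in measure_pmf ?p. real (length (filter (\<lambda>t. fst t = x \<and> fst (snd t) = a) ep))
       = (\<Sum>i<n. of_bool (fst (ep ! i) = x) * of_bool (pol (h + i) x = a))"
    proof (subst AE_measure_pmf_iff, safe)
      fix ep assume ep: "ep \<in> set_pmf ?p"
      have len: "length ep = n" using length_gen_steps[OF ep] .
      have "real (length (filter (\<lambda>t. fst t = x \<and> fst (snd t) = a) ep))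
         = (\<Sum>i<n. of_bool (fst (ep ! i) = x \<and> fst (snd (ep ! i)) = a))"
        unfolding length_filter_conv_card len by (simp add: of_bool_def sum.If_cases Int_def)
      also have "\<dots> = (\<Sum>i<n. of_bool (fst (ep ! i) = x) * of_bool (pol (h + i) x = a))"
        by (rule sum.cong) (use gen_steps_action[OF ep] in auto)
      finally show "real (length (filter (\<lambda>t. fst t = x \<and> fst (snd t) = a) ep))
       = (\<Sum>i<n. of_bool (fst (ep ! i) = x) * of_bool (pol (h + i) x = a))" .
    qed
  qed auto
  also have "\<dots> = (\<Sum>i<n. measure_pmf.expectation ?p (\<lambda>ep. of_bool (fst (ep ! i) = x)) * of_bool (pol (h + i) x = a))"
    by (subst Bochner_Integration.integral_sum)
       (auto intro!: integrable_measure_pmf_finite finite_set_pmf_gen_steps)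
  also have "\<dots> = (\<Sum>i<n. pmf (occ P pol h x0 i) x * of_bool (pol (h + i) x = a))"
  proof (rule sum.cong[OF refl])
    fix i assume "i \<in> {..<n}"
    then have "pmf (occ P pol h x0 i) x = pmf (map_pmf (\<lambda>ep. fst (ep ! i)) ?p) x"
      by (simp add: gen_steps_state)
    also have "\<dots> = measure_pmf.prob ?p {ep. fst (ep ! i) = x}"
      by (simp add: pmf_map vimage_def)
    also have "\<dots> = measure_pmf.expectation ?p (\<lambda>ep. of_bool (fst (ep ! i) = x))"
      by (simp add: expectation_of_bool)
    finally show "measure_pmf.expectation ?p (\<lambda>ep. of_bool (fst (ep ! i) = x)) * of_bool (pol (h + i) x = a)
      = pmf (occ P pol h x0 i) x * of_bool (pol (h + i) x = a)" by simp
  qed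
  finally show ?thesis .
qed

lemma expectation_state_at:
  fixes P :: "'s::finite \<Rightarrow> 'a \<Rightarrow> 's pmf"
  assumes i: "i < n"
  shows "measure_pmf.expectation (gen_steps P pol h n x0) (\<lambda>ep. of_bool (state_at ep (Suc (Suc i)) = y))
    = pmf (occ P pol h x0 (Suc i)) y"
proof -
  let ?p = "gen_steps P pol h n x0"
  have "map_pmf (\<lambda>ep. state_at ep (Suc (Suc i))) ?p = occ P pol h x0 (Suc i)"
  \<comment> \<open>The state after the last transition starts no further transition, so it is read
    off the third component of the last triple.\<close>
  proof (cases "Suc i < n")
    case True
    have "map_pmf (\<lambda>ep. state_at ep (Suc (Suc i))) ?p = map_pmf (\<lambda>ep. fst (ep ! Suc i)) ?p"
      by (rule map_pmf_cong) (use True in \<open>auto simp: state_at_def dest!: length_gen_steps\<close>)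
    then show ?thesis using gen_steps_state[OF True] by metis
  next
    case False
    have "map_pmf (\<lambda>ep. state_at ep (Suc (Suc i))) ?p = map_pmf (\<lambda>ep. snd (snd (ep ! i))) ?p"
      by (rule map_pmf_cong) (use False i in \<open>auto simp: state_at_def dest!: length_gen_steps\<close>)
    then show ?thesis using gen_steps_next_state[OF i] by metis
  qed
  then have "pmf (occ P pol h x0 (Suc i)) y = pmf (map_pmf (\<lambda>ep. state_at ep (Suc (Suc i))) ?p) y" by simp
  also have "\<dots> = measure_pmf.prob ?p {ep. state_at ep (Suc (Suc i)) = y}"
    by (simp add: pmf_map vimage_def)
  finally show ?thesis by (simp add: expectation_of_bool)
qed

section \<open>Value functions, occupancies and counts\<close>

lemma Vpi_step:
  fixes P :: "'s::finite \<Rightarrow> 'a \<Rightarrow> 's pmf"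
  assumes h: "h \<le> H"
  shows "Vpi P R H pol h x = R x (pol h x) + wmean (pmf (P x (pol h x))) (Vpi P R H pol (Suc h))"
proof -
  have "Suc H - h = Suc (H - h)" using h by simp
  then have "Vpi P R H pol h x = measure_pmf.expectation (P x (pol h x))
     (\<lambda>y. measure_pmf.expectation (gen_steps P pol (Suc h) (H - h) y)
        (\<lambda>tr. R x (pol h x) + (\<Sum>t\<leftarrow>tr. R (fst t) (fst (snd t)))))"
    unfolding Vpi_def by (simp add: expectation_bind_finite finite_set_pmf_gen_steps)
  also have "\<dots> = measure_pmf.expectation (P x (pol h x)) (\<lambda>y. R x (pol h x) + Vpi P R H pol (Suc h) y)"
    unfolding Vpi_def
    by (subst Bochner_Integration.integral_add)
       (auto intro!: integrable_measure_pmf_finite finite_set_pmf_gen_steps)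
  also have "\<dots> = R x (pol h x) + wmean (pmf (P x (pol h x))) (Vpi P R H pol (Suc h))"
    by (simp only: expectation_finite_type wmean_add wmean_const[OF prob_weights_pmf])
  finally show ?thesis .
qed

lemma Vpi_end: "Vpi P R H pol (Suc H) x = 0"
  by (simp add: Vpi_def)

lemma Vpi_range:
  fixes P :: "'s::finite \<Rightarrow> 'a \<Rightarrow> 's pmf"
  assumes R: "\<forall>x a. 0 \<le> R x a \<and> R x a \<le> 1"
  shows "0 \<le> Vpi P R H pol h x" "Vpi P R H pol h x \<le> real (Suc H - h)"
proof -
  have nn: "0 \<le> (\<Sum>t\<leftarrow>tr. R (fst t) (fst (snd t)))" for tr
    using R by (induction tr) auto
  have le: "(\<Sum>t\<leftarrow>tr. R (fst t) (fst (snd t))) \<le> real (length tr)" for tr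
    using R by (induction tr) (auto simp: add_mono)
  let ?p = "gen_steps P pol h (Suc H - h) x"
  show "0 \<le> Vpi P R H pol h x" unfolding Vpi_def by (rule Bochner_Integration.integral_nonneg) (simp add: nn)
  have "Vpi P R H pol h x \<le> measure_pmf.expectation ?p (\<lambda>_. real (Suc H - h))"
    unfolding Vpi_def
  proof (rule expectation_mono_finite[OF finite_set_pmf_gen_steps])
    fix tr assume "tr \<in> set_pmf ?p"
    then have "length tr = Suc H - h" by (rule length_gen_steps)
    then show "(\<Sum>t\<leftarrow>tr. R (fst t) (fst (snd t))) \<le> real (Suc H - h)" using le[of tr] by simp
  qed
  then show "Vpi P R H pol h x \<le> real (Suc H - h)" by simp
qed

lemma Vpi_le_Vstar:
  fixes P :: "'s::finite \<Rightarrow> 'a \<Rightarrow> 's pmf"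
  assumes R: "\<forall>x a. 0 \<le> R x a \<and> R x a \<le> 1"
  shows "Vpi P R H pol h x \<le> Vstar P R H h x"
  unfolding Vstar_def
  by (rule cSUP_upper) (auto intro!: bdd_aboveI[of _ "real (Suc H - h)"] Vpi_range(2)[OF R])

lemma Vstar_range:
  fixes P :: "'s::finite \<Rightarrow> 'a \<Rightarrow> 's pmf"
  assumes R: "\<forall>x a. 0 \<le> R x a \<and> R x a \<le> 1"
  shows "0 \<le> Vstar P R H h x" "Vstar P R H h x \<le> real (Suc H - h)"
proof -
  show "0 \<le> Vstar P R H h x"
    using Vpi_le_Vstar[OF R] Vpi_range(1)[OF R] by (rule order_trans[rotated])
  show "Vstar P R H h x \<le> real (Suc H - h)"
    unfolding Vstar_def by (rule cSUP_least) (auto intro!: Vpi_range(2)[OF R])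
qed

text \<open>The half of the Bellman optimality equation on which the backward induction for optimism
  rests.\<close>

lemma Vstar_le:
  fixes P :: "'s::finite \<Rightarrow> 'a \<Rightarrow> 's pmf"
  assumes R: "\<forall>x a. 0 \<le> R x a \<and> R x a \<le> 1" and h: "h \<le> H"
    and c: "\<And>a. R x a + wmean (pmf (P x a)) (Vstar P R H (Suc h)) \<le> c"
  shows "Vstar P R H h x \<le> c"
  unfolding Vstar_def
proof (rule cSUP_least)
  fix pol :: "nat \<Rightarrow> 's \<Rightarrow> 'a"
  have "Vpi P R H pol h x \<le> R x (pol h x) + wmean (pmf (P x (pol h x))) (Vstar P R H (Suc h))"
    unfolding Vpi_step[OF h] by (intro add_left_mono wmean_mono prob_weights_pmf Vpi_le_Vstar[OF R])
  then show "Vpi P R H pol h x \<le> c" using c[of "pol h x"] by simp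
qed auto

lemma wmean_occ_Suc:
  fixes P :: "'s::finite \<Rightarrow> 'a \<Rightarrow> 's pmf"
  shows "wmean (pmf (occ P pol h x0 (Suc i))) f
    = wmean (pmf (occ P pol h x0 i)) (\<lambda>x. wmean (pmf (P x (pol (h + i) x))) f)"
  by (simp add: expectation_bind_finite flip: expectation_finite_type)

lemma wmean_occ_0: "wmean (pmf (occ P pol h x0 0)) f = f x0"
  by (simp flip: expectation_finite_type)

text \<open>Law of total variance by telescoping. From V_h = r + E V_{h+1} and V_h \<le> H, each
  conditional variance is at most E V_{h+1}^2 - V_h^2 + 2 H r; the squares telescope, and the
  expected rewards sum to V_1.\<close>

lemma total_variance_bound:
  fixes P :: "'s::finite \<Rightarrow> 'a \<Rightarrow> 's pmf"
  assumes R: "\<forall>x a. 0 \<le> R x a \<and> R x a \<le> 1"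
  shows "(\<Sum>i<H. wmean (pmf (occ P pol 1 x0 i))
     (\<lambda>x. wvar (pmf (P x (pol (Suc i) x))) (Vpi P R H pol (Suc (Suc i))))) \<le> (real H)\<^sup>2"
proof -
  define E where "E i = wmean (pmf (occ P pol 1 x0 i))" for i
  define V where "V = Vpi P R H pol"
  define r where "r i x = R x (pol (Suc i) x)" for i x
  define p where "p i x = pmf (P x (pol (Suc i) x))" for i x
  have pw: "prob_weights (p i x)" for i x unfolding p_def by (rule prob_weights_pmf)
  have ES: "E (Suc i) f = E i (\<lambda>x. wmean (p i x) f)" for i f
    unfolding E_def p_def using wmean_occ_Suc[of P pol 1 x0 i f] by simp
  have Vs: "V (Suc i) x = r i x + wmean (p i x) (V (Suc (Suc i)))" if "i < H" for i x
    unfolding V_def r_def p_def using that by (intro Vpi_step) simp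
  have r: "0 \<le> r i x" for i x using R by (simp add: r_def)
  have Vb: "0 \<le> V (Suc i) x" "V (Suc i) x \<le> real H" for i x
    using Vpi_range[OF R, of P H pol "Suc i" x] by (auto simp: V_def)
  have "n \<le> H \<Longrightarrow> (\<Sum>i<n. E i (\<lambda>x. wvar (p i x) (V (Suc (Suc i)))))
    \<le> E n (\<lambda>x. (V (Suc n) x)\<^sup>2) - (V 1 x0)\<^sup>2 + 2 * real H * (V 1 x0 - E n (V (Suc n)))" for n
  proof (induction n)
    case 0
    show ?case by (simp add: E_def wmean_occ_0 del: occ.simps)
  next
    case (Suc n)
    then have n: "n < H" by simp
    have Er: "E n (r n) = E n (V (Suc n)) - E (Suc n) (V (Suc (Suc n)))"
    proof -
      have "E n (V (Suc n)) = E n (\<lambda>x. r n x + wmean (p n x) (V (Suc (Suc n))))"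
        by (rule arg_cong[of _ _ "E n"]) (rule ext, rule Vs[OF n])
      also have "\<dots> = E n (r n) + E (Suc n) (V (Suc (Suc n)))"
        by (subst ES) (simp add: E_def wmean_add)
      finally show ?thesis by simp
    qed
    have "E n (\<lambda>x. wvar (p n x) (V (Suc (Suc n))))
       \<le> E n (\<lambda>x. wmean (p n x) (\<lambda>y. (V (Suc (Suc n)) y)\<^sup>2) - (V (Suc n) x)\<^sup>2 + 2 * real H * r n x)"
      unfolding E_def
    proof (rule wmean_mono[OF prob_weights_pmf])
      fix x
      have "wmean (p n x) (V (Suc (Suc n))) = V (Suc n) x - r n x" using Vs[OF n, of x] by simp
      then have "wvar (p n x) (V (Suc (Suc n)))
         = wmean (p n x) (\<lambda>y. (V (Suc (Suc n)) y)\<^sup>2) - (V (Suc n) x - r n x)\<^sup>2"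
        by (simp add: wvar_eq[OF pw])
      moreover have "V (Suc n) x * r n x \<le> real H * r n x" using Vb r by (intro mult_right_mono) auto
      moreover have "(V (Suc n) x - r n x)\<^sup>2 = (V (Suc n) x)\<^sup>2 - 2 * (V (Suc n) x * r n x) + (r n x)\<^sup>2"
        by (simp add: power2_eq_square algebra_simps)
      ultimately show "wvar (p n x) (V (Suc (Suc n))) \<le>
          wmean (p n x) (\<lambda>y. (V (Suc (Suc n)) y)\<^sup>2) - (V (Suc n) x)\<^sup>2 + 2 * real H * r n x"
        using zero_le_power2[of "r n x"] by linarith
    qed
    also have "\<dots> = E (Suc n) (\<lambda>y. (V (Suc (Suc n)) y)\<^sup>2) - E n (\<lambda>x. (V (Suc n) x)\<^sup>2) + 2 * real H * E n (r n)"
      unfolding ES by (simp only: E_def wmean_add wmean_diff wmean_cmult)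
    finally show ?case using Suc n Er by (simp add: algebra_simps)
  qed
  from this[of H] have "(\<Sum>i<H. E i (\<lambda>x. wvar (p i x) (V (Suc (Suc i)))))
     \<le> E H (\<lambda>x. (V (Suc H) x)\<^sup>2) - (V 1 x0)\<^sup>2 + 2 * real H * (V 1 x0 - E H (V (Suc H)))" by simp
  also have "E H (\<lambda>x. (V (Suc H) x)\<^sup>2) = 0" by (simp add: V_def Vpi_end E_def wmean_def)
  also have "E H (V (Suc H)) = 0" by (simp add: V_def Vpi_end E_def wmean_def)
  \<comment> \<open>Completing the square: 2 H V_1 - V_1^2 never exceeds H^2.\<close>
  also have "0 - (V 1 x0)\<^sup>2 + 2 * real H * (V 1 x0 - 0) \<le> (real H)\<^sup>2"
    using zero_le_power2[of "V 1 x0 - real H"] by (simp add: power2_eq_square algebra_simps)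
  finally show ?thesis by (simp add: E_def p_def V_def)
qed

section \<open>Empirical frequencies and visit counts\<close>

lemma phat_mean_eq: "phat_mean hs x a = wmean (Phat hs x a)"
  by (rule ext) (simp add: phat_mean_def wmean_def)

lemma phat_var_eq: "phat_var hs x a = wvar (Phat hs x a)"
  by (rule ext) (simp add: phat_var_def wvar_def phat_mean_eq)

lemma prob_weights_Phat: "0 < Nsa hs x a \<Longrightarrow> prob_weights (Phat hs x a)"
proof -
  assume n: "0 < Nsa hs x a"
  have "(\<Sum>y\<in>UNIV. real (Ncnt hs x a y)) = real (Nsa hs x a)" by (simp add: Nsa_def)
  then show ?thesis using n by (simp add: prob_weights_def Phat_def flip: sum_divide_distrib)
qed

lemma sum_Ncnt_eq:
  "0 < Nsa hs x a \<Longrightarrow> (\<Sum>y\<in>UNIV. real (Ncnt hs x a y) * z y) = real (Nsa hs x a) * wmean (Phat hs x a) z"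
  by (simp add: wmean_def Phat_def sum_distrib_left)

definition visits :: "'s \<Rightarrow> 'a \<Rightarrow> ('s,'a) episode \<Rightarrow> nat" where
  "visits x a ep = length (filter (\<lambda>t. fst t = x \<and> fst (snd t) = a) ep)"

lemma visits_le: "visits x a ep \<le> length ep"
  by (simp add: visits_def)

lemma Nsa_eq_sum_visits: "Nsa hs x a = (\<Sum>i<length hs. visits x a (hs ! i))"
proof -
  have ep: "(\<Sum>y\<in>UNIV. length (filter (\<lambda>t. t = (x,a,y)) ep)) = visits x a ep" for ep
  proof (induction ep)
    case Nil
    show ?case by (simp add: visits_def)
  next
    case (Cons t ep)
    obtain u b v where t: "t = (u, b, v)" by (cases t)
    have "(\<Sum>y\<in>UNIV. length (filter (\<lambda>t. t = (x,a,y)) (t # ep)))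
      = (\<Sum>y\<in>UNIV. of_bool (v = y) * of_bool (u = x \<and> b = a) + length (filter (\<lambda>t. t = (x,a,y)) ep))"
      by (rule sum.cong) (auto simp: t)
    also have "\<dots> = of_bool (u = x \<and> b = a) + visits x a ep"
      by (simp only: sum.distrib Cons) (simp add: of_bool_def if_distrib[of "\<lambda>x. x * _"] cong: if_cong)
    finally show ?case by (simp add: visits_def t)
  qed
  have "Nsa hs x a = (\<Sum>ep\<leftarrow>hs. visits x a ep)"
  proof (induction hs)
    case Nil
    show ?case by (simp add: Nsa_def Ncnt_def)
  next
    case (Cons e hs)
    have "Nsa (e # hs) x a = (\<Sum>y\<in>UNIV. length (filter (\<lambda>t. t = (x,a,y)) e)) + Nsa hs x a"
      by (simp add: Nsa_def Ncnt_def sum.distrib)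
    then show ?case using Cons by (simp add: ep)
  qed
  then show ?thesis by (simp add: sum_list_sum_nth atLeast0LessThan)
qed

lemma Nprime_eq_sum: "real (Nprime hs j y) = (\<Sum>i<length hs. of_bool (state_at (hs ! i) j = y))"
  unfolding Nprime_def length_filter_conv_card by (simp add: of_bool_def sum.If_cases Int_def)

section \<open>Sums controlled by their own cumulative weight\<close>

text \<open>The cumulative weight is tested before the current weight is added, so the counted mass
  overshoots \<open>c\<close> by at most one term.\<close>

lemma sum_below_threshold:
  fixes w :: "nat \<Rightarrow> real"
  assumes w: "\<And>k. 0 \<le> w k" "\<And>k. w k \<le> B" and c: "0 \<le> c"
  shows "(\<Sum>k<n. if (\<Sum>i<k. w i) < c then w k else 0) \<le> c + B"
proof (induction n)
  case 0
  show ?case using w[of 0] c by simp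
next
  case (Suc n)
  show ?case
  proof (cases "(\<Sum>i<n. w i) < c")
    case True
    have "(\<Sum>k<n. if (\<Sum>i<k. w i) < c then w k else 0) \<le> (\<Sum>k<n. w k)"
      by (rule sum_mono) (simp add: w)
    then show ?thesis using True w(2)[of n] by simp
  next
    case False
    then show ?thesis using Suc by simp
  qed
qed

text \<open>The potential is ln (max W c / c), which stays 0 up to the threshold. Past it the
  relative increment u is at most 1 / (8 l), and u \<le> (1 + u) ln (1 + u) compares it with the
  growth of the potential. The final potential is at most ln K - ln (8 l) \<le> l - 1, and this
  slack pays for the factor 1 + 1 / (8 l), leaving leading constant 1.\<close>

lemma sum_harmonic_above_threshold:
  fixes w :: "nat \<Rightarrow> real"
  assumes w: "\<And>k. 0 \<le> w k" "\<And>k. w k \<le> B" and B: "0 < B" and l: "1 \<le> l" and K: "1 \<le> K" "ln (real K) \<le> l"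
  shows "(\<Sum>k<K. if 8 * B * l \<le> (\<Sum>i<k. w i) then w k / (\<Sum>i<k. w i) else 0) \<le> l"
proof -
  define c where "c = 8 * B * l"
  define W where "W n = (\<Sum>i<n. w i)" for n
  have c0: "0 < c" using B l by (simp add: c_def)
  have Bc: "B / c = 1 / (8 * l)" using B l by (simp add: c_def)
  have pot: "(\<Sum>k<n. if c \<le> W k then w k / W k else 0) \<le> (1 + 1 / (8 * l)) * ln (max (W n) c / c)" for n
  proof (induction n)
    case 0
    show ?case using c0 by (simp add: W_def)
  next
    case (Suc n)
    have WS: "W (Suc n) = W n + w n" by (simp add: W_def)
    show ?case
    proof (cases "c \<le> W n")
      case False
      have "ln (max (W n) c / c) \<le> ln (max (W (Suc n)) c / c)"
        using c0 w(1)[of n] by (auto simp: WS divide_le_cancel max_def)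
      then have "(1 + 1 / (8 * l)) * ln (max (W n) c / c) \<le> (1 + 1 / (8 * l)) * ln (max (W (Suc n)) c / c)"
        using l by (intro mult_left_mono) auto
      then show ?thesis using Suc False by simp
    next
      case True
      define u where "u = w n / W n"
      have Wn: "0 < W n" using True c0 by simp
      have u0: "0 \<le> u" using w Wn by (simp add: u_def)
      have "u \<le> B / c" unfolding u_def using w True c0 B by (intro frac_le) auto
      then have u1: "u \<le> 1 / (8 * l)" using Bc by simp
      have "u / (1 + u) \<le> ln (1 + u)"
        using ln_diff_le[of 1 "1 + u"] u0 by (simp add: field_simps)
      then have "u \<le> (1 + u) * ln (1 + u)" using u0 by (simp add: field_simps)
      also have "\<dots> \<le> (1 + 1 / (8 * l)) * ln (1 + u)"
        using u0 u1 by (intro mult_right_mono) auto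
      finally have u: "u \<le> (1 + 1 / (8 * l)) * ln (1 + u)" .
      have "max (W (Suc n)) c / c = (1 + u) * (max (W n) c / c)"
      proof -
        have "max (W (Suc n)) c = W n + w n" "max (W n) c = W n" using True w(1)[of n] by (auto simp: WS)
        moreover have "(1 + u) * W n = W n + w n" using Wn by (simp add: u_def distrib_right)
        ultimately show ?thesis by simp
      qed
      then have "ln (max (W (Suc n)) c / c) = ln (1 + u) + ln (max (W n) c / c)"
        using u0 c0 by (simp only:) (intro ln_mult_pos, auto simp: less_max_iff_disj)
      then show ?thesis using Suc u True by (simp add: u_def algebra_simps)
    qed
  qed
  have "W K \<le> (\<Sum>i<K. B)" unfolding W_def by (rule sum_mono) (rule w)
  then have WK: "W K \<le> real K * B" by simp
  have "(1 + 1 / (8 * l)) * ln (max (W K) c / c) \<le> l"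
  proof (cases "W K \<le> c")
    case True
    then show ?thesis using c0 l by (simp add: max_def)
  next
    case False
    then have "max (W K) c / c \<le> real K * B / c" using WK c0 by (simp add: divide_right_mono)
    also have "\<dots> = real K / (8 * l)" using B l by (simp add: c_def)
    finally have "ln (max (W K) c / c) \<le> ln (real K / (8 * l))"
      using c0 by (intro ln_mono) (auto simp: less_max_iff_disj)
    also have "\<dots> = ln (real K) - ln (8 * l)" using K l by (simp add: ln_div)
    also have "\<dots> \<le> l - 1"
    proof -
      have "exp 1 \<le> 8 * l" using exp_le l by linarith
      then have "1 \<le> ln (8 * l)" using l by (simp add: ln_ge_iff)
      then show ?thesis using K by simp
    qed
    finally have "(1 + 1 / (8 * l)) * ln (max (W K) c / c) \<le> (1 + 1 / (8 * l)) * (l - 1)"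
      using l by (intro mult_left_mono) auto
    also have "\<dots> \<le> l" using l by (simp add: field_simps)
    finally show ?thesis .
  qed
  then show ?thesis using pot[of K] unfolding c_def W_def by linarith
qed

lemma weighted_Cauchy_Schwarz:
  fixes \<omega> f g :: "'i \<Rightarrow> real"
  assumes "\<And>i. i \<in> I \<Longrightarrow> 0 \<le> \<omega> i" "\<And>i. i \<in> I \<Longrightarrow> 0 \<le> f i" "\<And>i. i \<in> I \<Longrightarrow> 0 \<le> g i"
  shows "(\<Sum>i\<in>I. \<omega> i * sqrt (f i * g i)) \<le> sqrt (\<Sum>i\<in>I. \<omega> i * f i) * sqrt (\<Sum>i\<in>I. \<omega> i * g i)"
proof -
  have "(\<Sum>i\<in>I. \<omega> i * sqrt (f i * g i)) = (\<Sum>i\<in>I. \<bar>sqrt (\<omega> i * f i)\<bar> * \<bar>sqrt (\<omega> i * g i)\<bar>)"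
  proof (rule sum.cong[OF refl])
    fix i assume i: "i \<in> I"
    have "sqrt (\<omega> i * f i) * sqrt (\<omega> i * g i) = sqrt ((\<omega> i)\<^sup>2 * (f i * g i))"
      by (simp add: power2_eq_square mult_ac flip: real_sqrt_mult)
    also have "\<dots> = \<omega> i * sqrt (f i * g i)"
      using assms(1)[OF i] by (subst real_sqrt_mult) simp
    finally show "\<omega> i * sqrt (f i * g i) = \<bar>sqrt (\<omega> i * f i)\<bar> * \<bar>sqrt (\<omega> i * g i)\<bar>"
      using assms i by simp
  qed
  also have "\<dots> \<le> L2_set (\<lambda>i. sqrt (\<omega> i * f i)) I * L2_set (\<lambda>i. sqrt (\<omega> i * g i)) I"
    by (rule L2_set_mult_ineq)
  also have "\<dots> = sqrt (\<Sum>i\<in>I. \<omega> i * f i) * sqrt (\<Sum>i\<in>I. \<omega> i * g i)"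
    unfolding L2_set_def using assms by simp
  finally show ?thesis .
qed

section \<open>Optimism\<close>

text \<open>\<open>ell\<close> is the logarithm L' of the bonus.\<close>

locale ucbvi_bf =
  fixes P :: "'s::finite \<Rightarrow> 'a::finite \<Rightarrow> 's pmf" and R :: "'s \<Rightarrow> 'a \<Rightarrow> real"
    and H K :: nat and \<delta> :: real
    and act :: "('s,'a) hist \<Rightarrow> nat \<Rightarrow> 's \<Rightarrow> 'a" and init :: "('s,'a) hist \<Rightarrow> 's"
    and S A ell :: real
  assumes R_range: "\<forall>x a. 0 \<le> R x a \<and> R x a \<le> 1"
    and H_pos: "H \<ge> 1" and delta: "0 < \<delta>" "\<delta> < 1"
    and greedy: "\<forall>hs h x. ucbvi_Q H R (bf_bonus H K \<delta>) hs h x (act hs h x)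
                       = Max (range (ucbvi_Q H R (bf_bonus H K \<delta>) hs h x))"
    and S_eq: "S = real CARD('s)" and A_eq: "A = real CARD('a)"
    and ell_eq: "ell = ln (5 * S * A * (real K * real H) / \<delta>)"
    and K_large: "2500 * real H * S\<^sup>2 * A * ell\<^sup>2 < real K"
begin

abbreviation "bon \<equiv> bf_bonus H K \<delta>"
abbreviation "Vs \<equiv> Vstar P R H"
abbreviation "p \<equiv> \<lambda>x a. pmf (P x a)"

lemma H1: "1 \<le> real H" using H_pos by simp

lemma S1: "1 \<le> S" and A1: "1 \<le> A"
  by (auto simp: S_eq A_eq Suc_leI)

lemma K1: "1 \<le> K"
proof -
  have "0 \<le> 2500 * real H * S\<^sup>2 * A * ell\<^sup>2" using A1 by simp
  then show ?thesis using K_large by linarith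
qed

lemma HSA_ge: "c \<ge> 0 \<Longrightarrow> c \<le> real H * S\<^sup>2 * A * c"
proof -
  assume c: "c \<ge> 0"
  have "1 \<le> S\<^sup>2" using S1 by (simp add: one_le_power)
  then have "1 * 1 * 1 \<le> real H * S\<^sup>2 * A" using A1 H1 by (intro mult_mono) auto
  then show ?thesis using c mult_right_mono[of 1 "real H * S\<^sup>2 * A" c] by simp
qed

lemma exp_ell: "exp ell = 5 * S * A * (real K * real H) / \<delta>"
  unfolding ell_eq using delta S1 A1 K1 H1 by (intro exp_ln) auto

lemma exp_ell_ge: "5 * real K \<le> exp ell"
proof -
  have "5 * 1 * 1 * (real K * 1) \<le> 5 * S * A * (real K * real H)"
    using S1 A1 H1 by (intro mult_mono) auto
  also have "\<dots> \<le> 5 * S * A * (real K * real H) / \<delta>"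
    using delta S1 A1 by (simp add: pos_le_divide_eq mult_left_le)
  finally show ?thesis by (simp add: exp_ell)
qed

lemma ln_K_le: "ln (real K) \<le> ell"
proof -
  have "real K \<le> exp ell" using exp_ell_ge by simp
  then show ?thesis using K1 by (metis ln_exp ln_mono of_nat_0_less_iff less_le_trans zero_less_one)
qed

text \<open>A bootstrap: \<open>ell\<close> \<ge> 1 already forces K > 2500 through
  \<open>K_large\<close>, and then exp \<open>ell\<close> \<ge> 5 K \<ge> 12500 > 3^8 \<ge> exp
  8.\<close>

lemma ell_ge_8: "8 \<le> ell"
proof -
  have "exp 1 \<le> exp ell" using exp_ell_ge K1 exp_le by (smt (verit) of_nat_1 of_nat_le_iff)
  then have "1 \<le> ell" by simp
  then have "1 \<le> ell\<^sup>2" by (simp add: one_le_power)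
  moreover have "2500 * ell\<^sup>2 < real K" using HSA_ge[of "2500 * ell\<^sup>2"] K_large by (simp add: mult_ac)
  ultimately have "2500 < real K" by simp
  then have "12500 \<le> exp ell" using exp_ell_ge by simp
  moreover have "exp (8::real) \<le> 6561"
  proof -
    have "exp 1 ^ 8 \<le> (3::real) ^ 8" by (rule power_mono) (auto simp: exp_le)
    then show ?thesis by (simp flip: exp_of_nat_mult)
  qed
  ultimately have "exp 8 \<le> exp ell" by linarith
  then show ?thesis by simp
qed

lemma Vs_range: "0 \<le> Vs h x" "1 \<le> h \<Longrightarrow> Vs h x \<le> real H"
  using Vstar_range[OF R_range, of P H h x] by (auto simp: of_nat_diff intro: order_trans)

text \<open>The optimal action value Q*.\<close>

definition Qs :: "nat \<Rightarrow> 's \<Rightarrow> 'a \<Rightarrow> real" where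
  "Qs h x a = R x a + wmean (p x a) (Vs (Suc h))"

lemma Qs_le: "1 \<le> h \<Longrightarrow> h \<le> H \<Longrightarrow> Qs h x a \<le> real H"
proof -
  assume h: "1 \<le> h" "h \<le> H"
  have "wmean (p x a) (Vs (Suc h)) \<le> real (H - h)"
    by (rule wmean_le[OF prob_weights_pmf]) (use Vstar_range(2)[OF R_range, of P H "Suc h"] in simp)
  moreover have "real (H - h) \<le> real H - 1" using h by simp
  ultimately show ?thesis using R_range unfolding Qs_def by (smt (verit))
qed

text \<open>The integrand of the third bonus term; \<open>h\<close> is here the step of the
  successor state, one more than the step of the bonus.\<close>

definition fbon :: "('s,'a) hist \<Rightarrow> nat \<Rightarrow> 's \<Rightarrow> real" where
  "fbon hs h y = (if Nprime hs h y = 0 then (real H)\<^sup>2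
     else min (100\<^sup>2 * real H ^ 3 * S\<^sup>2 * A * ell\<^sup>2 / real (Nprime hs h y)) ((real H)\<^sup>2))"

lemma fbon_range: "0 \<le> fbon hs h y" "fbon hs h y \<le> (real H)\<^sup>2"
  using A1 by (auto simp: fbon_def)

lemma bonus_eq: "bon hs h V x a = sqrt (8 * ell * wvar (Phat hs x a) V / real (Nsa hs x a))
    + 14 * real H * ell / (3 * real (Nsa hs x a))
    + sqrt (8 * wmean (Phat hs x a) (fbon hs (Suc h)) / real (Nsa hs x a))"
  unfolding bf_bonus_def Let_def phat_var_eq fbon_def wmean_def
    S_eq[symmetric] A_eq[symmetric] ell_eq[symmetric] by simp

text \<open>No self-normalised exponent for V*, scaled by H, has reached \<open>ell\<close>. The
  sign \<open>s\<close> provides both tails and j / K runs through the grid of t.\<close>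

definition dev_ok :: "('s,'a) hist \<Rightarrow> bool" where
  "dev_ok hs \<longleftrightarrow> (\<forall>x a. \<forall>h\<in>{1..H}. \<forall>s\<in>{-1,1}. \<forall>j\<in>{1..<K}.
     (\<Sum>y\<in>UNIV. real (Ncnt hs x a y) *
        (real j / K * (s * (wmean (p x a) (Vs (Suc h)) - Vs (Suc h) y) / H)
         - (real j / K)\<^sup>2 / (2 * (1 - real j / K)) * (s * (wmean (p x a) (Vs (Suc h)) - Vs (Suc h) y) / H)\<^sup>2)) < ell)"

lemma deviation:
  fixes hs x a h
  defines "n \<equiv> real (Nsa hs x a)" and "\<mu> \<equiv> wmean (p x a) (Vs (Suc h))"
  assumes ok: "dev_ok hs" and n: "4 * ell \<le> n" "n \<le> real K * real H" and h: "1 \<le> h" "h \<le> H"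
    and s: "s = 1 \<or> s = -1"
  shows "s * (\<mu> - wmean (Phat hs x a) (Vs (Suc h))) / H
    \<le> 101/100 * (sqrt (2 * (ell / n) * (wmean (Phat hs x a) (\<lambda>y. (Vs (Suc h) y - \<mu>)\<^sup>2) / (real H)\<^sup>2)) + ell / n)"
proof (rule bernstein_grid[of K])
  let ?q = "Phat hs x a" and ?V = "Vs (Suc h)"
  have n0: "0 < n" using n ell_ge_8 by linarith
  then have N0: "0 < Nsa hs x a" by (simp add: n_def)
  note pw = prob_weights_Phat[OF N0]
  have V: "0 \<le> ?V y" "?V y \<le> real H" for y using Vs_range[of "Suc h" y] by auto
  have mu: "0 \<le> \<mu>" "\<mu> \<le> real H" unfolding \<mu>_def
    by (auto intro!: wmean_nonneg wmean_le prob_weights_pmf V)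
  show "0 < ell / n" using n0 ell_ge_8 by simp
  show "ell / n \<le> 1/4" using n n0 by (simp add: field_simps)
  show "0 \<le> wmean ?q (\<lambda>y. (?V y - \<mu>)\<^sup>2) / (real H)\<^sup>2" by (simp add: wmean_nonneg[OF pw])
  have "wmean ?q (\<lambda>y. (?V y - \<mu>)\<^sup>2) \<le> (real H)\<^sup>2"
  proof (rule wmean_le[OF pw])
    fix y
    have "\<bar>?V y - \<mu>\<bar> \<le> \<bar>real H\<bar>" using V[of y] mu by auto
    then show "(?V y - \<mu>)\<^sup>2 \<le> (real H)\<^sup>2" by (simp only: abs_le_square_iff)
  qed
  then show "wmean ?q (\<lambda>y. (?V y - \<mu>)\<^sup>2) / (real H)\<^sup>2 \<le> 1" using H1 by (simp add: divide_le_eq_1)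
  \<comment> \<open>Since n \<le> K H, the square of the right-hand side is at least 2 K
    \<open>ell\<close> / H, hence at least 5000 \<open>ell\<close>^3 by \<open>K_large\<close>;
    40804 is 202 squared.\<close>
  show "202 \<le> real K * sqrt (2 * (ell / n))"
  proof -
    have "40804 \<le> 2 * (2500 * (ell * ell * ell))"
    proof -
      have "8 * 8 * 8 \<le> ell * ell * ell" using ell_ge_8 by (intro mult_mono) auto
      then show ?thesis by simp
    qed
    also have "\<dots> \<le> 2 * ell * real K / real H"
    proof -
      have "2500 * ell\<^sup>2 * real H \<le> real K"
      proof -
        have "1 \<le> S\<^sup>2 * A" using S1 A1 mult_mono[of 1 "S\<^sup>2" 1 A] by (simp add: one_le_power)
        then have "2500 * ell\<^sup>2 * real H * 1 \<le> 2500 * ell\<^sup>2 * real H * (S\<^sup>2 * A)" by (intro mult_left_mono) auto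
        then show ?thesis using K_large by (simp add: mult_ac)
      qed
      then have "2 * ell * (2500 * ell\<^sup>2 * real H) \<le> 2 * ell * real K" using ell_ge_8 by (intro mult_left_mono) auto
      then show ?thesis using H1 by (simp add: pos_le_divide_eq power2_eq_square mult_ac)
    qed
    also have "\<dots> = (real K)\<^sup>2 * (2 * (ell / (real K * real H)))" using K1 H1 by (simp add: field_simps power2_eq_square)
    also have "\<dots> \<le> (real K)\<^sup>2 * (2 * (ell / n))"
      using n n0 ell_ge_8 by (intro mult_left_mono divide_left_mono) auto
    finally have "sqrt 40804 \<le> sqrt ((real K)\<^sup>2 * (2 * (ell / n)))" by (rule real_sqrt_le_mono)
    moreover have "sqrt 40804 = 202" by (rule real_sqrt_unique) auto
    ultimately show ?thesis unfolding real_sqrt_mult[of "(real K)\<^sup>2"] by simp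
  qed
  fix j assume j: "1 \<le> j" "j < K"
  define t where "t = real j / K"
  define \<kappa> where "\<kappa> = t\<^sup>2 / (2 * (1 - t))"
  define \<xi> where "\<xi> y = s * (\<mu> - ?V y) / H" for y
  have "(\<Sum>y\<in>UNIV. real (Ncnt hs x a y) * (t * \<xi> y - \<kappa> * (\<xi> y)\<^sup>2)) < ell"
    using ok j h s unfolding dev_ok_def t_def \<kappa>_def \<xi>_def \<mu>_def by fastforce
  then have "n * wmean ?q (\<lambda>y. t * \<xi> y - \<kappa> * (\<xi> y)\<^sup>2) < ell" by (simp add: sum_Ncnt_eq[OF N0] n_def)
  then have "wmean ?q (\<lambda>y. t * \<xi> y - \<kappa> * (\<xi> y)\<^sup>2) < ell / n" using n0 by (simp add: pos_less_divide_eq mult.commute)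
  then have "t * wmean ?q \<xi> \<le> \<kappa> * wmean ?q (\<lambda>y. (\<xi> y)\<^sup>2) + ell / n"
    by (simp only: wmean_diff wmean_cmult)
  also have "wmean ?q \<xi> = s * (\<mu> - wmean ?q ?V) / H"
  proof -
    have "\<xi> = (\<lambda>y. s / H * (\<mu> - ?V y))" by (rule ext) (simp add: \<xi>_def)
    then show ?thesis by (simp only: wmean_cmult wmean_diff wmean_const[OF pw]) simp
  qed
  also have "wmean ?q (\<lambda>y. (\<xi> y)\<^sup>2) = wmean ?q (\<lambda>y. (?V y - \<mu>)\<^sup>2) / (real H)\<^sup>2"
  proof -
    have "(\<lambda>y. (\<xi> y)\<^sup>2) = (\<lambda>y. 1 / (real H)\<^sup>2 * (?V y - \<mu>)\<^sup>2)"
      using s by (intro ext) (auto simp: \<xi>_def power_divide power2_commute)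
    then show ?thesis by (simp only: wmean_cmult) simp
  qed
  finally show "real j / K * (s * (\<mu> - wmean ?q ?V) / H) \<le>
    (real j / K)\<^sup>2 / (2 * (1 - real j / K)) * (wmean ?q (\<lambda>y. (?V y - \<mu>)\<^sup>2) / (real H)\<^sup>2) + ell / n"
    by (simp only: t_def \<kappa>_def)
qed

text \<open>The deviation bound is applied to V* under the empirical weights and turned into the
  monotone functional, which is then moved up from V* to \<open>V\<close>. Data dependence of
  \<open>V\<close> is harmless because this move is deterministic.\<close>

lemma optimistic_step:
  assumes ok: "dev_ok hs" and N: "0 < Nsa hs x a" "Nsa hs x a \<le> K * H"
    and h: "1 \<le> h" "h \<le> H" and V: "\<And>y. Vs (Suc h) y \<le> V y" "\<And>y. V y \<le> real H"
  shows "min (real H) (R x a + wmean (Phat hs x a) V + bon hs h V x a) \<ge> Qs h x a"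
proof -
  define n where "n = real (Nsa hs x a)"
  let ?q = "Phat hs x a" and ?W = "Vs (Suc h)"
  define \<mu> where "\<mu> = wmean (p x a) ?W"
  note pw = prob_weights_Phat[OF N(1)]
  have n0: "0 < n" using N by (simp add: n_def)
  have W: "0 \<le> ?W y" "?W y \<le> real H" for y using Vs_range[of "Suc h" y] by auto
  have V0: "0 \<le> V y" for y using W(1)[of y] V(1)[of y] by simp
  have f0: "0 \<le> sqrt (8 * wmean ?q (fbon hs (Suc h)) / n)"
    using n0 by (simp add: wmean_nonneg[OF pw] fbon_range)
  have b: "sqrt (8 * ell * wvar ?q V / n) + 14 * real H * ell / (3 * n) \<le> bon hs h V x a"
    unfolding bonus_eq using f0 by (simp add: n_def)
  have "Qs h x a \<le> R x a + wmean ?q V + bon hs h V x a"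
  proof (cases "14/3 * ell \<le> n")
    \<comment> \<open>With so few visits the linear bonus term alone is at least H.\<close>
    case False
    then have "n \<le> 14 / 3 * ell" by simp
    then have "real H * n \<le> real H * (14/3 * ell)" using H1 by (intro mult_left_mono) auto
    then have "real H \<le> 14 * real H * ell / (3 * n)" using n0 by (simp add: field_simps)
    moreover have "0 \<le> sqrt (8 * ell * wvar ?q V / n)" using n0 ell_ge_8 wvar_nonneg[OF pw] by simp
    moreover have "0 \<le> wmean ?q V" by (rule wmean_nonneg[OF pw V0])
    ultimately show ?thesis using b Qs_le[OF h, of x a] R_range by (smt (verit))
  next
    case True
    define q where "q = ell / n"
    have q0: "0 < q" using n0 ell_ge_8 by (simp add: q_def)
    define D where "D = (\<mu> - wmean ?q ?W) / H"
    define U where "U = wvar ?q ?W / (real H)\<^sup>2"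
    have "D \<le> max (sqrt (14/3 * q * U)) (14/3 * q)"
    proof (rule bernstein_self_bound)
      have "1 * (\<mu> - wmean ?q ?W) / H
        \<le> 101/100 * (sqrt (2 * (ell / n) * (wmean ?q (\<lambda>y. (?W y - \<mu>)\<^sup>2) / (real H)\<^sup>2)) + ell / n)"
        unfolding n_def \<mu>_def
        using True N h ell_ge_8 of_nat_mono[OF N(2)]
        by (intro deviation[OF ok]) (auto simp: n_def)
      also have "wmean ?q (\<lambda>y. (?W y - \<mu>)\<^sup>2) / (real H)\<^sup>2 = U + D\<^sup>2"
        unfolding second_moment_about[OF pw] U_def D_def
        by (simp add: add_divide_distrib power_divide power2_commute[of \<mu>])
      finally show "D \<le> 101/100 * (sqrt (2 * q * (U + D\<^sup>2)) + q)" by (simp add: D_def q_def)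
      show "0 \<le> U" by (simp add: U_def wvar_nonneg[OF pw])
      have "wvar ?q ?W \<le> (real H)\<^sup>2 / 4" by (rule wvar_le_quarter[OF pw]) (use W in auto)
      then show "U \<le> 1/4" using H1 by (simp add: U_def divide_le_eq)
      have "\<mu> \<le> real H" unfolding \<mu>_def by (intro wmean_le prob_weights_pmf W)
      moreover have "0 \<le> wmean ?q ?W" by (rule wmean_nonneg[OF pw W(1)])
      ultimately show "D \<le> 1" using H1 by (simp add: D_def divide_le_eq)
    qed (rule q0)
    then have "real H * D \<le> real H * max (sqrt (14/3 * q * U)) (14/3 * q)" by (intro mult_left_mono) auto
    also have "\<dots> = max (sqrt (14/3 * q) * sqrt (wvar ?q ?W)) ((sqrt (14/3 * q))\<^sup>2 * real H)"
    proof -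
      have 1: "(sqrt (14/3 * q))\<^sup>2 = 14/3 * q" using q0 by simp
      have 2: "real H * sqrt (14/3 * q * U) = sqrt (14/3 * q) * sqrt (wvar ?q ?W)"
        using H1 by (simp add: U_def real_sqrt_mult real_sqrt_divide)
      show ?thesis unfolding 1 2[symmetric] by (simp add: max_mult_distrib_left mult.commute)
    qed
    finally have "\<mu> \<le> wmean ?q ?W + max (sqrt (14/3 * q) * sqrt (wvar ?q ?W)) ((sqrt (14/3 * q))\<^sup>2 * real H)"
      using H1 by (simp add: D_def)
    also have "\<dots> \<le> wmean ?q V + max (sqrt (14/3 * q) * sqrt (wvar ?q V)) ((sqrt (14/3 * q))\<^sup>2 * real H)"
      by (rule mean_plus_deviation_mono[OF pw]) (use W V q0 H1 in auto)
    \<comment> \<open>A maximum of nonnegative terms is at most their sum, and 14/3 \<le> 8 fits the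
      first bonus term.\<close>
    also have "max (sqrt (14/3 * q) * sqrt (wvar ?q V)) ((sqrt (14/3 * q))\<^sup>2 * real H)
        \<le> sqrt (8 * ell * wvar ?q V / n) + 14 * real H * ell / (3 * n)"
    proof -
      have "sqrt (14/3 * q) * sqrt (wvar ?q V) = sqrt (14/3 * q * wvar ?q V)" by (rule real_sqrt_mult[symmetric])
      also have "\<dots> \<le> sqrt (8 * q * wvar ?q V)"
        using q0 wvar_nonneg[OF pw, of V] by (intro real_sqrt_le_mono mult_right_mono) auto
      also have "\<dots> = sqrt (8 * ell * wvar ?q V / n)" by (simp add: q_def)
      finally have 1: "sqrt (14/3 * q) * sqrt (wvar ?q V) \<le> sqrt (8 * ell * wvar ?q V / n)" .
      have 2: "(sqrt (14/3 * q))\<^sup>2 * real H = 14 * real H * ell / (3 * n)" using q0 by (simp add: q_def)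
      have "0 \<le> sqrt (8 * ell * wvar ?q V / n)" "0 \<le> 14 * real H * ell / (3 * n)"
        using n0 ell_ge_8 wvar_nonneg[OF pw] by auto
      then show ?thesis using 1 2 by linarith
    qed
    finally show ?thesis using b unfolding Qs_def \<mu>_def by simp
  qed
  then show ?thesis using Qs_le[OF h] by simp
qed

lemma Qnew_optimistic:
  assumes ok: "dev_ok hs" and N: "\<And>x a. Nsa hs x a \<le> K * H"
    and h: "1 \<le> h" "h \<le> H" and V: "\<And>y. Vs (Suc h) y \<le> V y" "\<And>y. V y \<le> real H"
    and prev: "Qs h x a \<le> prevQ h x a"
  shows "Qs h x a \<le> Qnew H R bon hs prevQ h V x a"
  using optimistic_step[OF ok _ N h V, of x a] prev Qs_le[OF h, of x a]
  by (auto simp: Qnew_def phat_mean_eq)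

lemma Qnew_le_H: "Qnew H R bon hs prevQ h V x a \<le> real H"
  by (auto simp: Qnew_def)

lemma Vback_optimistic:
  assumes ok: "dev_ok hs" and N: "\<And>x a. Nsa hs x a \<le> K * H"
    and prev: "\<And>h x a. 1 \<le> h \<Longrightarrow> h \<le> H \<Longrightarrow> Qs h x a \<le> prevQ h x a"
  shows "m \<le> H \<Longrightarrow> Vs (Suc H - m) x \<le> Vback H R bon hs prevQ m x \<and> Vback H R bon hs prevQ m x \<le> real H"
proof (induction m arbitrary: x)
  case 0
  show ?case using Vstar_range(2)[OF R_range, of P H "Suc H" x] by simp
next
  case (Suc m)
  let ?V = "Vback H R bon hs prevQ m" and ?h = "H - m"
  have h: "1 \<le> ?h" "?h \<le> H" using Suc.prems by auto
  have Sh: "Suc ?h = Suc H - m" using Suc.prems by simp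
  have V: "Vs (Suc ?h) y \<le> ?V y" "?V y \<le> real H" for y using Suc.IH[of y] Suc.prems by (auto simp: Sh)
  have "Vs ?h x \<le> Max (range (Qnew H R bon hs prevQ ?h ?V x))"
  proof (rule Vstar_le[OF R_range h(2)])
    fix a
    have "Qs ?h x a \<le> Qnew H R bon hs prevQ ?h ?V x a"
      by (rule Qnew_optimistic[OF ok N h V]) (rule prev[OF h])
    also have "\<dots> \<le> Max (range (Qnew H R bon hs prevQ ?h ?V x))" by (rule Max_ge) auto
    finally show "R x a + wmean (p x a) (Vs (Suc ?h)) \<le> Max (range (Qnew H R bon hs prevQ ?h ?V x))"
      by (simp add: Qs_def)
  qed
  then show ?case by (auto simp: Qnew_le_H)
qed

text \<open>All prefixes are needed because Q_k is a minimum with Q_{k-1}, which was built from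
  shorter histories; optimism is therefore an induction over episodes around the one over
  steps.\<close>

definition prefix_ok :: "('s,'a) hist \<Rightarrow> bool" where
  "prefix_ok hs \<longleftrightarrow> (\<forall>k. dev_ok (take k hs) \<and> (\<forall>x a. Nsa (take k hs) x a \<le> K * H))"

lemma Qseq_optimistic:
  assumes "prefix_ok hs" "1 \<le> h" "h \<le> H"
  shows "Qs h x a \<le> Qseq H R bon hs j h x a"
  using assms(2,3)
proof (induction j arbitrary: h x a)
  case 0
  then show ?case by (simp add: Qs_le)
next
  case (Suc j)
  have ok: "dev_ok (take j hs)" "\<And>x a. Nsa (take j hs) x a \<le> K * H" using assms(1) by (auto simp: prefix_ok_def)
  note vb = Vback_optimistic[OF ok Suc.IH]
  show ?case unfolding Qseq.simps Qat_def
  proof (rule Qnew_optimistic[OF ok Suc.prems])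
    show "Qs h x a \<le> Qseq H R bon hs j h x a" by (rule Suc.IH[OF Suc.prems])
    fix y
    have "Suc H - (H - h) = Suc h" using Suc.prems by simp
    then show "Vs (Suc h) y \<le> Vback H R bon (take j hs) (Qseq H R bon hs j) (H - h) y"
      "Vback H R bon (take j hs) (Qseq H R bon hs j) (H - h) y \<le> real H"
      using vb[of "H - h" y] by auto
  qed
qed

text \<open>V_{k,h} for the episode that follows \<open>hs\<close>, that is, k is one more than the
  length of \<open>hs\<close>.\<close>

definition Vk :: "('s,'a) hist \<Rightarrow> nat \<Rightarrow> 's \<Rightarrow> real" where
  "Vk hs h = Vback H R bon hs (Qseq H R bon hs (length hs)) (Suc H - h)"

lemma Vk_range:
  assumes "prefix_ok hs" "1 \<le> h" "h \<le> Suc H"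
  shows "Vs h x \<le> Vk hs h x" "Vk hs h x \<le> real H"
proof -
  have ok: "dev_ok hs" "\<And>x a. Nsa hs x a \<le> K * H"
    using assms(1) unfolding prefix_ok_def by (metis take_all_iff order_refl)+
  show "Vs h x \<le> Vk hs h x" "Vk hs h x \<le> real H"
    using Vback_optimistic[OF ok Qseq_optimistic[OF assms(1)], of "Suc H - h" x] assms
    by (auto simp: Vk_def)
qed

lemma Vk_end: "Vk hs (Suc H) x = 0"
  by (simp add: Vk_def)

lemma Vk_le:
  fixes hs h x
  defines "a \<equiv> act hs h x"
  assumes h: "1 \<le> h" "h \<le> H" and N: "0 < Nsa hs x a"
  shows "Vk hs h x \<le> R x a + wmean (Phat hs x a) (Vk hs (Suc h)) + bon hs h (Vk hs (Suc h)) x a"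
proof -
  have 1: "Suc H - h = Suc (H - h)" "H - (H - h) = h" using h by auto
  have u: "ucbvi_Q H R bon hs h x = Qnew H R bon hs (Qseq H R bon hs (length hs)) h (Vk hs (Suc h)) x"
    by (simp add: ucbvi_Q_def Qat_def Vk_def)
  have "Vk hs h x = Max (range (ucbvi_Q H R bon hs h x))"
    unfolding u unfolding Vk_def 1 Vback.simps by simp
  also have "\<dots> = ucbvi_Q H R bon hs h x a" using greedy by (simp add: a_def)
  also have "\<dots> \<le> R x a + wmean (Phat hs x a) (Vk hs (Suc h)) + bon hs h (Vk hs (Suc h)) x a"
    unfolding u using N by (simp add: Qnew_def phat_mean_eq)
  finally show ?thesis .
qed

end

section \<open>One-step error of the optimistic values\<close>

lemma sqrt_le_split:
  assumes "X \<le> c\<^sup>2 * z + d\<^sup>2" "0 \<le> c" "0 \<le> z" "0 \<le> d"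
  shows "sqrt X \<le> c * sqrt z + d"
proof -
  have "sqrt X \<le> sqrt (c\<^sup>2 * z + d\<^sup>2)" using assms(1) by simp
  also have "\<dots> \<le> sqrt (c\<^sup>2 * z) + sqrt (d\<^sup>2)" by (rule sqrt_add_le_add_sqrt) (use assms in auto)
  finally show ?thesis using assms by (simp add: real_sqrt_mult)
qed

text \<open>The bound holds at every step \<open>i\<close>, always with the error of the whole
  episode: i = 0 serves the regret, the other steps serve the sum of the variances.\<close>

lemma unroll_error:
  fixes D e :: "nat \<Rightarrow> 's::finite \<Rightarrow> real" and pol :: "nat \<Rightarrow> 's \<Rightarrow> 'a"
  assumes rec: "\<And>i x. i < H \<Longrightarrow> D i x \<le> c * wmean (pmf (P x (pol (Suc i) x))) (D (Suc i)) + e i x"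
    and e: "\<And>i x. i < H \<Longrightarrow> 0 \<le> e i x" and D_end: "\<And>x. D H x = 0" and c: "1 \<le> c" and i: "i \<le> H"
  shows "wmean (pmf (occ P pol 1 x0 i)) (D i) \<le> c ^ H * (\<Sum>j<H. wmean (pmf (occ P pol 1 x0 j)) (e j))"
proof -
  define E where "E i = wmean (pmf (occ P pol 1 x0 i))" for i
  have ES: "E (Suc i) f = E i (\<lambda>x. wmean (pmf (P x (pol (Suc i) x))) f)" for i f
    unfolding E_def using wmean_occ_Suc[of P pol 1 x0 i f] by simp
  have Ee: "0 \<le> E j (e j)" if "j < H" for j unfolding E_def by (rule wmean_nonneg[OF prob_weights_pmf e[OF that]])
  have "E i (D i) \<le> c ^ (H - i) * (\<Sum>j=i..<H. E j (e j))"
    using i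
  proof (induction rule: inc_induct)
    case base
    show ?case by (simp add: D_end E_def wmean_def)
  next
    case (step n)
    have "E n (D n) \<le> E n (\<lambda>x. c * wmean (pmf (P x (pol (Suc n) x))) (D (Suc n)) + e n x)"
      unfolding E_def by (rule wmean_mono[OF prob_weights_pmf rec]) (use step in auto)
    also have "\<dots> = c * E (Suc n) (D (Suc n)) + E n (e n)"
      unfolding ES unfolding E_def by (simp only: wmean_add wmean_cmult)
    also have "\<dots> \<le> c * (c ^ (H - Suc n) * (\<Sum>j=Suc n..<H. E j (e j))) + c ^ (H - n) * E n (e n)"
    proof (rule add_mono)
      show "c * E (Suc n) (D (Suc n)) \<le> c * (c ^ (H - Suc n) * (\<Sum>j=Suc n..<H. E j (e j)))"
        using step c by (intro mult_left_mono) auto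
      show "E n (e n) \<le> c ^ (H - n) * E n (e n)"
        using one_le_power[OF c, of "H - n"] Ee[OF step(2)] mult_right_mono[of 1 "c ^ (H - n)" "E n (e n)"] by simp
    qed
    also have "c * (c ^ (H - Suc n) * (\<Sum>j=Suc n..<H. E j (e j))) = c ^ (H - n) * (\<Sum>j=Suc n..<H. E j (e j))"
    proof -
      have "H - n = Suc (H - Suc n)" using step by simp
      then show ?thesis by simp
    qed
    also have "c ^ (H - n) * (\<Sum>j=Suc n..<H. E j (e j)) + c ^ (H - n) * E n (e n)
      = c ^ (H - n) * (\<Sum>j=n..<H. E j (e j))"
      using step by (simp add: sum.atLeast_Suc_lessThan algebra_simps)
    finally show ?case .
  qed
  also have "\<dots> \<le> c ^ H * (\<Sum>j=i..<H. E j (e j))"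
    using c Ee by (intro mult_right_mono power_increasing sum_nonneg) auto
  also have "\<dots> \<le> c ^ H * (\<Sum>j<H. E j (e j))"
    using c Ee by (intro mult_left_mono sum_mono2) auto
  finally show ?thesis by (simp add: E_def)
qed

context ucbvi_bf
begin

text \<open>The choice t = 1 / (10 H) keeps the relative inflation harmless when it is compounded
  over H steps.\<close>

definition trans_ok :: "('s,'a) hist \<Rightarrow> bool" where
  "trans_ok hs \<longleftrightarrow> (\<forall>x a z. (\<Sum>y\<in>UNIV. real (Ncnt hs x a y) *
     (1 / (10 * real H) * of_bool (y = z) - (1 / (10 * real H) + (1 / (10 * real H))\<^sup>2) * p x a z)) < ell)"

lemma Phat_le:
  assumes ok: "trans_ok hs" and N: "0 < Nsa hs x a"
  shows "Phat hs x a z \<le> (1 + 1 / (10 * real H)) * p x a z + 10 * real H * ell / real (Nsa hs x a)"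
proof -
  define t where "t = 1 / (10 * real H)"
  define n where "n = real (Nsa hs x a)"
  have t0: "0 < t" using H1 by (simp add: t_def)
  have n0: "0 < n" using N by (simp add: n_def)
  have "(\<Sum>y\<in>UNIV. real (Ncnt hs x a y) * (t * of_bool (y = z) - (t + t\<^sup>2) * p x a z)) < ell"
    using ok unfolding trans_ok_def t_def by blast
  then have "n * wmean (Phat hs x a) (\<lambda>y. t * of_bool (y = z) - (t + t\<^sup>2) * p x a z) < ell"
    by (simp add: sum_Ncnt_eq[OF N] n_def)
  also have "wmean (Phat hs x a) (\<lambda>y. t * of_bool (y = z) - (t + t\<^sup>2) * p x a z)
     = t * wmean (Phat hs x a) (\<lambda>y. of_bool (y = z)) - (t + t\<^sup>2) * p x a z"
    by (simp only: wmean_diff wmean_cmult wmean_const[OF prob_weights_Phat[OF N]])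
  also have "wmean (Phat hs x a) (\<lambda>y. of_bool (y = z)) = Phat hs x a z"
    by (simp add: wmean_def of_bool_def if_distrib[of "\<lambda>x. _ * x"] cong: if_cong)
  also have "n * (t * Phat hs x a z - (t + t\<^sup>2) * p x a z)
     = (n * t) * (Phat hs x a z - (1 + t) * p x a z)"
    by (simp add: algebra_simps power2_eq_square)
  finally have "Phat hs x a z - (1 + t) * p x a z < ell / (n * t)"
    using n0 t0 by (simp add: pos_less_divide_eq mult.commute)
  moreover have "ell / (n * t) = 10 * real H * ell / n" by (simp add: t_def)
  ultimately show ?thesis unfolding t_def n_def by linarith
qed

text \<open>The comparison is made state by state, so \<open>f\<close> may depend on the data; the
  price is the factor S in the additive term.\<close>

lemma wmean_Phat_le:
  assumes ok: "trans_ok hs" and N: "0 < Nsa hs x a" and f: "\<And>y. 0 \<le> f y" "\<And>y. f y \<le> B"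
  shows "wmean (Phat hs x a) f
    \<le> (1 + 1 / (10 * real H)) * wmean (p x a) f + 10 * real H * S * ell * B / real (Nsa hs x a)"
proof -
  let ?c = "10 * real H * ell / real (Nsa hs x a)"
  have c0: "0 \<le> ?c" using ell_ge_8 by simp
  have "wmean (Phat hs x a) f \<le> (\<Sum>y\<in>UNIV. (1 + 1 / (10 * real H)) * (p x a y * f y) + ?c * B)"
    unfolding wmean_def
  proof (rule sum_mono)
    fix y
    have "Phat hs x a y * f y \<le> ((1 + 1 / (10 * real H)) * p x a y + ?c) * f y"
      by (intro mult_right_mono Phat_le[OF ok N] f)
    also have "\<dots> \<le> (1 + 1 / (10 * real H)) * (p x a y * f y) + ?c * B"
      using mult_left_mono[OF f(2)[of y] c0] by (simp only: distrib_right mult.assoc)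
    finally show "Phat hs x a y * f y \<le> (1 + 1 / (10 * real H)) * (p x a y * f y) + ?c * B" .
  qed
  also have "\<dots> = (1 + 1 / (10 * real H)) * wmean (p x a) f + S * (?c * B)"
    by (simp add: sum.distrib wmean_def S_eq flip: sum_distrib_left)
  finally show ?thesis by (simp add: mult_ac)
qed

section \<open>Gap between optimistic value and value of the played policy\<close>

abbreviation Vp :: "('s,'a) hist \<Rightarrow> nat \<Rightarrow> 's \<Rightarrow> real" where
  "Vp hs \<equiv> Vpi P R H (act hs)"

definition gap :: "('s,'a) hist \<Rightarrow> nat \<Rightarrow> 's \<Rightarrow> real" where
  "gap hs h x = Vk hs h x - Vp hs h x"

lemma gap_range:
  assumes "prefix_ok hs" "1 \<le> h" "h \<le> Suc H"
  shows "0 \<le> gap hs h x" "gap hs h x \<le> real H"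
  using Vk_range[OF assms, of x] Vpi_le_Vstar[OF R_range, of P H "act hs" h x]
    Vpi_range(1)[OF R_range, of P H "act hs" h x] by (auto simp: gap_def)

text \<open>Twice this quantity bounds the variance of every function between V^\<pi> and V_k. The
  first part is summable by the law of total variance, the second is H times the error under
  study.\<close>

definition spread :: "('s,'a) hist \<Rightarrow> nat \<Rightarrow> 's \<Rightarrow> 'a \<Rightarrow> real" where
  "spread hs h x a = wvar (p x a) (Vp hs (Suc h)) + real H * wmean (p x a) (gap hs (Suc h))"

lemma spread_nonneg:
  assumes "prefix_ok hs" "h \<le> H"
  shows "0 \<le> spread hs h x a"
  unfolding spread_def using gap_range(1)[OF assms(1), of "Suc h"] assms(2)
  by (intro add_nonneg_nonneg mult_nonneg_nonneg wvar_nonneg wmean_nonneg prob_weights_pmf) auto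

lemma wvar_between_le_spread:
  assumes ok: "prefix_ok hs" and h: "1 \<le> h" "h \<le> H"
    and f: "\<And>y. Vp hs (Suc h) y \<le> f y" "\<And>y. f y \<le> Vk hs (Suc h) y"
  shows "wvar (p x a) f \<le> 2 * spread hs h x a"
proof -
  have h': "1 \<le> Suc h" "Suc h \<le> Suc H" using h by auto
  have "wmean (p x a) (\<lambda>y. (f y - Vp hs (Suc h) y)\<^sup>2) \<le> wmean (p x a) (\<lambda>y. real H * gap hs (Suc h) y)"
  proof (rule wmean_mono[OF prob_weights_pmf])
    fix y
    have d: "0 \<le> f y - Vp hs (Suc h) y" "f y - Vp hs (Suc h) y \<le> gap hs (Suc h) y"
      using f[of y] by (auto simp: gap_def)
    then show "(f y - Vp hs (Suc h) y)\<^sup>2 \<le> real H * gap hs (Suc h) y"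
      unfolding power2_eq_square using gap_range(2)[OF ok h', of y] by (intro mult_mono) auto
  qed
  then show ?thesis
    using wvar_perturb[OF prob_weights_pmf, of "P x a" f "Vp hs (Suc h)"]
    by (simp add: spread_def wmean_cmult)
qed

text \<open>Centring at the true mean serves two purposes: for V* it is the quantity in
  \<open>deviation\<close>, and for V_k it dominates the empirical variance in the bonus. The factor
  22/10 is 2 times the inflation 11/10.\<close>

lemma second_moment_Phat_le:
  assumes ok: "prefix_ok hs" "trans_ok hs" and h: "1 \<le> h" "h \<le> H" and N: "0 < Nsa hs x a"
    and f: "\<And>y. Vp hs (Suc h) y \<le> f y" "\<And>y. f y \<le> Vk hs (Suc h) y"
  shows "wmean (Phat hs x a) (\<lambda>y. (f y - wmean (p x a) f)\<^sup>2)
     \<le> 22/10 * spread hs h x a + 10 * S * real H ^ 3 * ell / real (Nsa hs x a)"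
proof -
  have f_range: "0 \<le> f y \<and> f y \<le> real H" for y
    using f[of y] Vk_range(2)[OF ok(1), of "Suc h" y] h Vpi_range(1)[OF R_range, of P H "act hs" "Suc h" y] by auto
  have m: "0 \<le> wmean (p x a) f" "wmean (p x a) f \<le> real H"
    using f_range by (auto intro!: wmean_nonneg wmean_le prob_weights_pmf)
  have sq: "(f y - wmean (p x a) f)\<^sup>2 \<le> (real H)\<^sup>2" for y
  proof -
    have "\<bar>f y - wmean (p x a) f\<bar> \<le> \<bar>real H\<bar>" using f_range[of y] m by auto
    then show ?thesis by (simp only: abs_le_square_iff)
  qed
  have "wmean (Phat hs x a) (\<lambda>y. (f y - wmean (p x a) f)\<^sup>2)
     \<le> (1 + 1 / (10 * real H)) * wvar (p x a) f + 10 * real H * S * ell * (real H)\<^sup>2 / real (Nsa hs x a)"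
    unfolding wvar_conv by (rule wmean_Phat_le[OF ok(2) N]) (use sq in auto)
  also have "(1 + 1 / (10 * real H)) * wvar (p x a) f \<le> 11/10 * (2 * spread hs h x a)"
    using H1 wvar_nonneg[OF prob_weights_pmf] wvar_between_le_spread[OF ok(1) h f]
    by (intro mult_mono) (auto simp: field_simps)
  finally show ?thesis by (simp add: power2_eq_square power3_eq_cube mult_ac)
qed

lemma local_error:
  fixes hs h x
  defines "a \<equiv> act hs h x"
  defines "n \<equiv> real (Nsa hs x a)"
  assumes ok: "prefix_ok hs" "trans_ok hs" and h: "1 \<le> h" "h \<le> H" and N: "4 * ell \<le> n"
  shows "gap hs h x \<le> (1 + 1 / (10 * real H)) * wmean (p x a) (gap hs (Suc h))
     + (64/10 * sqrt (ell * spread hs h x a / n) + 40 * (real H)\<^sup>2 * S * ell / n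
        + sqrt (88/10 * wmean (p x a) (fbon hs (Suc h)) / n))"
proof -
  let ?q = "Phat hs x a" and ?W = "Vs (Suc h)" and ?V = "Vk hs (Suc h)" and ?U = "Vp hs (Suc h)"
  define \<mu> where "\<mu> = wmean (p x a) ?W"
  define z where "z = ell * spread hs h x a / n"
  define B where "B = S * (real H)\<^sup>2 * ell / n"
  define F where "F = wmean (p x a) (fbon hs (Suc h))"
  have n0: "0 < n" using N ell_ge_8 by linarith
  then have N0: "0 < Nsa hs x a" by (simp add: n_def)
  note pw = prob_weights_Phat[OF N0]
  have h': "1 \<le> Suc h" "Suc h \<le> Suc H" using h by auto
  have ok': "dev_ok hs" "Nsa hs x a \<le> K * H"
    using ok(1) unfolding prefix_ok_def by (metis take_all_iff order_refl)+
  have UW: "?U y \<le> ?W y" for y by (rule Vpi_le_Vstar[OF R_range])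
  have WV: "?W y \<le> ?V y" and VH: "?V y \<le> real H" for y by (rule Vk_range[OF ok(1) h'])+
  have W0: "0 \<le> ?W y" for y by (rule Vs_range)
  have z0: "0 \<le> z" using n0 ell_ge_8 spread_nonneg[OF ok(1) h(2)] by (simp add: z_def)
  have B0: "0 \<le> B" using n0 S1 ell_ge_8 by (simp add: B_def)
  have HB: "real H * ell / n \<le> B"
  proof -
    have "1 \<le> S * real H" using S1 H1 mult_mono[of 1 S 1 "real H"] by simp
    then have "real H * ell / n * 1 \<le> real H * ell / n * (S * real H)"
      using n0 ell_ge_8 by (intro mult_left_mono) auto
    then show ?thesis by (simp add: B_def power2_eq_square mult_ac)
  qed
  \<comment> \<open>All lower-order errors under square roots are measured against B^2, so that each
    root contributes a multiple of \<open>B\<close>.\<close>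
  have cube: "S * real H ^ 3 * ell * ell / (n * n) \<le> B\<^sup>2"
  proof -
    have "1 \<le> S * real H" using S1 H1 mult_mono[of 1 S 1 "real H"] by simp
    then have "S * real H ^ 3 * ell * ell / (n * n) * 1 \<le> S * real H ^ 3 * ell * ell / (n * n) * (S * real H)"
      using n0 S1 ell_ge_8 by (intro mult_left_mono) auto
    then show ?thesis by (simp add: B_def power2_eq_square power3_eq_cube mult_ac)
  qed
  have second: "c * ell * (22/10 * spread hs h x a + 10 * S * real H ^ 3 * ell / n) / n
      \<le> (22/10 * c) * z + (10 * c) * B\<^sup>2" if "0 \<le> c" for c
  proof -
    have "c * ell * (22/10 * spread hs h x a + 10 * S * real H ^ 3 * ell / n) / n
       = (22/10 * c) * z + (10 * c) * (S * real H ^ 3 * ell * ell / (n * n))"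
      using n0 by (simp add: z_def field_simps)
    then show ?thesis using mult_left_mono[OF cube, of "10 * c"] that by linarith
  qed
  have s1: "sqrt (2 * ell * wmean ?q (\<lambda>y. (?W y - \<mu>)\<^sup>2) / n) \<le> 21/10 * sqrt z + 45/10 * B"
  proof (rule sqrt_le_split)
    have "2 * ell * wmean ?q (\<lambda>y. (?W y - \<mu>)\<^sup>2) / n
      \<le> 2 * ell * (22/10 * spread hs h x a + 10 * S * real H ^ 3 * ell / n) / n"
      unfolding \<mu>_def n_def
      by (intro divide_right_mono mult_left_mono second_moment_Phat_le[OF ok h N0 UW WV]) (use ell_ge_8 in auto)
    also note second[of 2]
    also have "22/10 * 2 * z + 10 * 2 * B\<^sup>2 \<le> (21/10)\<^sup>2 * z + (45/10 * B)\<^sup>2"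
      unfolding power_mult_distrib using z0
      by (intro add_mono mult_right_mono) (auto simp: power_divide)
    finally show "2 * ell * wmean ?q (\<lambda>y. (?W y - \<mu>)\<^sup>2) / n \<le> (21/10)\<^sup>2 * z + (45/10 * B)\<^sup>2" by simp
  qed (use z0 B0 in auto)
  have s2: "sqrt (8 * ell * wvar ?q ?V / n) \<le> 42/10 * sqrt z + 9 * B"
  proof (rule sqrt_le_split)
    have "wvar ?q ?V \<le> 22/10 * spread hs h x a + 10 * S * real H ^ 3 * ell / n"
      using order_trans[OF wvar_le_second_moment[OF pw] second_moment_Phat_le[OF ok h N0, of ?V]] UW WV
      unfolding n_def by (meson order_refl order_trans)
    then have "8 * ell * wvar ?q ?V / n
      \<le> 8 * ell * (22/10 * spread hs h x a + 10 * S * real H ^ 3 * ell / n) / n"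
      by (intro divide_right_mono mult_left_mono) (use ell_ge_8 n0 in auto)
    also note second[of 8]
    also have "22/10 * 8 * z + 10 * 8 * B\<^sup>2 \<le> (42/10)\<^sup>2 * z + (9 * B)\<^sup>2"
      unfolding power_mult_distrib using z0
      by (intro add_mono mult_right_mono) (auto simp: power_divide)
    finally show "8 * ell * wvar ?q ?V / n \<le> (42/10)\<^sup>2 * z + (9 * B)\<^sup>2" by simp
  qed (use z0 B0 in auto)
  have F0: "0 \<le> F" unfolding F_def by (intro wmean_nonneg prob_weights_pmf fbon_range)
  have s3: "sqrt (8 * wmean ?q (fbon hs (Suc h)) / n) \<le> 1 * sqrt (88/10 * F / n) + 9 * B"
  proof (rule sqrt_le_split)
    have "wmean ?q (fbon hs (Suc h)) \<le> (1 + 1 / (10 * real H)) * F + 10 * real H * S * ell * (real H)\<^sup>2 / n"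
      unfolding F_def n_def by (rule wmean_Phat_le[OF ok(2) N0]) (rule fbon_range)+
    also have "(1 + 1 / (10 * real H)) * F \<le> 11/10 * F"
      using H1 F0 by (intro mult_right_mono) (auto simp: field_simps)
    finally have "8 * wmean ?q (fbon hs (Suc h)) / n \<le> 8 * (11/10 * F + 10 * real H * S * ell * (real H)\<^sup>2 / n) / n"
      using n0 by (simp add: divide_right_mono)
    also have "\<dots> = 88/10 * F / n + 80 * (S * real H ^ 3 * ell / (n * n))"
      using n0 by (simp add: field_simps power2_eq_square power3_eq_cube)
    also have "S * real H ^ 3 * ell / (n * n) \<le> S * real H ^ 3 * ell * ell / (n * n)"
    proof -
      have "S * real H ^ 3 * ell / (n * n) * 1 \<le> S * real H ^ 3 * ell / (n * n) * ell"
        using n0 S1 ell_ge_8 by (intro mult_left_mono) auto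
      then show ?thesis by simp
    qed
    also note cube
    also have "88/10 * F / n + 80 * B\<^sup>2 \<le> 1\<^sup>2 * (88/10 * F / n) + (9 * B)\<^sup>2"
      unfolding power_mult_distrib one_power2 mult_1_left by (intro add_left_mono mult_right_mono) auto
    finally show "8 * wmean ?q (fbon hs (Suc h)) / n \<le> 1\<^sup>2 * (88/10 * F / n) + (9 * B)\<^sup>2" by simp
  qed (use F0 n0 B0 in auto)
  \<comment> \<open>Optimism used the sign s = 1; here s = -1 bounds overestimation.\<close>
  have devW: "wmean ?q ?W - \<mu> \<le> 101/100 * (sqrt (2 * ell * wmean ?q (\<lambda>y. (?W y - \<mu>)\<^sup>2) / n) + real H * ell / n)"
  proof -
    have "real (Nsa hs x a) \<le> real K * real H" using of_nat_mono[OF ok'(2)] by simp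
    then have "(-1) * (\<mu> - wmean ?q ?W) / H
        \<le> 101/100 * (sqrt (2 * (ell / n) * (wmean ?q (\<lambda>y. (?W y - \<mu>)\<^sup>2) / (real H)\<^sup>2)) + ell / n)"
      unfolding n_def \<mu>_def using N h by (intro deviation[OF ok'(1)]) (auto simp: n_def)
    also have "sqrt (2 * (ell / n) * (wmean ?q (\<lambda>y. (?W y - \<mu>)\<^sup>2) / (real H)\<^sup>2))
        = sqrt (2 * ell * wmean ?q (\<lambda>y. (?W y - \<mu>)\<^sup>2) / n) / H"
    proof -
      have "2 * (ell / n) * (wmean ?q (\<lambda>y. (?W y - \<mu>)\<^sup>2) / (real H)\<^sup>2)
        = 2 * ell * wmean ?q (\<lambda>y. (?W y - \<mu>)\<^sup>2) / n / (real H)\<^sup>2" by simp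
      then show ?thesis by (simp only: real_sqrt_divide real_sqrt_abs abs_of_nat)
    qed
    finally have "(wmean ?q ?W - \<mu>) / H * H
       \<le> 101/100 * (sqrt (2 * ell * wmean ?q (\<lambda>y. (?W y - \<mu>)\<^sup>2) / n) / H + ell / n) * H"
      by (intro mult_right_mono) auto
    also have "\<dots> = 101/100 * (sqrt (2 * ell * wmean ?q (\<lambda>y. (?W y - \<mu>)\<^sup>2) / n) + real H * ell / n)"
      using H1 by (simp add: field_simps)
    finally show ?thesis using H1 by simp
  qed
  \<comment> \<open>The difference V_k - V* depends on the data but is nonnegative, and it lies
    below the gap because V^\<pi> \<le> V*.\<close>
  have devD: "wmean ?q ?V - wmean ?q ?W \<le> wmean (p x a) ?V - wmean (p x a) ?W
     + 1 / (10 * real H) * wmean (p x a) (gap hs (Suc h)) + 10 * B"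
  proof -
    let ?d = "\<lambda>y. ?V y - ?W y"
    have "wmean ?q ?d \<le> (1 + 1 / (10 * real H)) * wmean (p x a) ?d + 10 * real H * S * ell * real H / n"
      unfolding n_def
    proof (rule wmean_Phat_le[OF ok(2) N0])
      show "0 \<le> ?d y" for y using WV[of y] by simp
      show "?d y \<le> real H" for y using VH[of y] W0[of y] by simp
    qed
    moreover have "wmean (p x a) ?d \<le> wmean (p x a) (gap hs (Suc h))"
      by (rule wmean_mono[OF prob_weights_pmf]) (use UW in \<open>simp add: gap_def\<close>)
    then have "1 / (10 * real H) * wmean (p x a) ?d \<le> 1 / (10 * real H) * wmean (p x a) (gap hs (Suc h))"
      by (intro mult_left_mono) auto
    moreover have "10 * real H * S * ell * real H / n = 10 * B" by (simp add: B_def power2_eq_square)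
    ultimately show ?thesis unfolding wmean_diff distrib_right by simp
  qed
  have b: "bon hs h ?V x a \<le> 42/10 * sqrt z + 9 * B + 14/3 * B + (sqrt (88/10 * F / n) + 9 * B)"
  proof -
    have "bon hs h ?V x a = sqrt (8 * ell * wvar ?q ?V / n) + 14/3 * (real H * ell / n)
       + sqrt (8 * wmean ?q (fbon hs (Suc h)) / n)"
      unfolding bonus_eq n_def by simp
    moreover have "b \<le> 42/10 * s + 9 * B + 14/3 * B + (f + 9 * B)"
      if "b = r2 + 14/3 * t + r3" "r2 \<le> 42/10 * s + 9 * B" "r3 \<le> 1 * f + 9 * B" "t \<le> B"
      for b r2 r3 s f t :: real using that by linarith
    ultimately show ?thesis using s2 s3 HB by blast
  qed
  have "gap hs h x = Vk hs h x - (R x a + wmean (p x a) ?U)"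
    unfolding gap_def a_def using Vpi_step[OF h(2), of P R "act hs" x] by simp
  also have "\<dots> \<le> wmean ?q ?V + bon hs h ?V x a - wmean (p x a) ?U"
    using Vk_le[OF h, of hs x] N0 unfolding a_def by simp
  also have "\<dots> \<le> (1 + 1 / (10 * real H)) * wmean (p x a) (gap hs (Suc h))
     + (64/10 * sqrt z + 40 * B + sqrt (88/10 * F / n))"
  proof -
    \<comment> \<open>The constants add up as 2.121 + 4.2 \<le> 6.4 for the root of \<open>z\<close>
      and 5.555 + 10 + 9 + 14/3 + 9 \<le> 40 for \<open>B\<close>.\<close>
    have g: "wmean (p x a) (gap hs (Suc h)) = wmean (p x a) ?V - wmean (p x a) ?U"
      unfolding gap_def by (rule wmean_diff)
    have "wmean ?q ?W - \<mu> \<le> 101/100 * (21/10 * sqrt z + 45/10 * B + B)" using devW s1 HB by simp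
    also have "\<dots> = 2121/1000 * sqrt z + 5555/1000 * B" by simp
    finally have "wmean ?q ?W - \<mu> \<le> 2121/1000 * sqrt z + 5555/1000 * B" .
    moreover have "0 \<le> sqrt z" using z0 by simp
    moreover have "qV + b - pU \<le> pg + cg + (64/10 * s + 40 * B + f)"
      if "qW - pW \<le> 2121/1000 * s + 5555/1000 * B" "0 \<le> s" "qV - qW \<le> pV - pW + cg + 10 * B"
        "b \<le> 42/10 * s + 9 * B + 14/3 * B + (f + 9 * B)" "pg = pV - pU"
      for qV b pU cg pg s f qW pW pV :: real using that B0 by linarith
    ultimately show ?thesis using devD b g unfolding \<mu>_def distrib_right mult_1_left by blast
  qed
  finally show ?thesis by (simp add: z_def B_def F_def mult_ac)
qed

end

section \<open>Summing the errors over a good run\<close>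

context ucbvi_bf
begin

text \<open>Episodes and steps are counted from 0 here: \<open>state_prob hs k i\<close> is the law of the state at
  step \<open>i + 1\<close> of episode \<open>k + 1\<close>, given the first \<open>k\<close> episodes of \<open>hs\<close>.\<close>

definition state_prob :: "('s,'a) hist \<Rightarrow> nat \<Rightarrow> nat \<Rightarrow> 's \<Rightarrow> real" where
  "state_prob hs k i x = pmf (occ P (act (take k hs)) 1 (init (take k hs)) i) x"

text \<open>The conditional mean, given the first \<open>k\<close> episodes, of the number of visits
  to \<open>x\<close>, \<open>a\<close> in the next one.\<close>

definition visit_mean :: "('s,'a) hist \<Rightarrow> 's \<Rightarrow> 'a \<Rightarrow> nat \<Rightarrow> real" where
  "visit_mean hs x a k = (\<Sum>i<H. state_prob hs k i x * of_bool (act (take k hs) (Suc i) x = a))"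

end

text \<open>From here the run is fixed and every statement is deterministic. Visits to a pair may
  reach H per episode, hence the slack H \<open>ell\<close>; a state occupies a given step at most
  once, hence the slack \<open>ell\<close>.\<close>

locale good_run = ucbvi_bf P R H K \<delta> act init S A ell
  for P :: "'s::finite \<Rightarrow> 'a::finite \<Rightarrow> 's pmf" and R :: "'s \<Rightarrow> 'a \<Rightarrow> real"
    and H K :: nat and \<delta> :: real
    and act :: "('s,'a) hist \<Rightarrow> nat \<Rightarrow> 's \<Rightarrow> 'a" and init :: "('s,'a) hist \<Rightarrow> 's"
    and S A ell :: real +
  fixes hs :: "('s,'a) hist"
  assumes run_prefix_ok: "prefix_ok hs"
    and run_trans_ok: "\<And>k. trans_ok (take k hs)"
    and visits_ge: "\<And>k x a. k < K \<Longrightarrow>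
      5/8 * (\<Sum>j<k. visit_mean hs x a j) - real H * ell \<le> real (Nsa (take k hs) x a)"
    and state_visits_ge: "\<And>k i y. k < K \<Longrightarrow> i < H \<Longrightarrow>
      5/8 * (\<Sum>j<k. state_prob hs j (Suc i) y) - ell \<le> real (Nprime (take k hs) (Suc (Suc i)) y)"
begin

abbreviation "hk k \<equiv> take k hs"
abbreviation "ac k i x \<equiv> act (hk k) (Suc i) x"
abbreviation "W k x a \<equiv> (\<Sum>j<k. visit_mean hs x a j)"
abbreviation "good k x a \<equiv> 8 * real H * ell \<le> W k x a"

lemma hk_ok: "prefix_ok (hk k)"
  using run_prefix_ok unfolding prefix_ok_def by (simp add: take_take)

lemma state_prob_range: "0 \<le> state_prob hs k i x" "state_prob hs k i x \<le> 1"
  by (auto simp: state_prob_def pmf_le_1)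

lemma visit_mean_range: "0 \<le> visit_mean hs x a k" "visit_mean hs x a k \<le> real H"
proof -
  show "0 \<le> visit_mean hs x a k"
    unfolding visit_mean_def by (intro sum_nonneg mult_nonneg_nonneg state_prob_range) auto
  have "visit_mean hs x a k \<le> (\<Sum>i<H. 1)"
    unfolding visit_mean_def by (rule sum_mono) (auto simp: state_prob_range)
  then show "visit_mean hs x a k \<le> real H" by simp
qed

text \<open>The threshold 8 H \<open>ell\<close> is where the additive loss H \<open>ell\<close> is
  at most W / 8, so that 5/8 W decreases only to W / 2.\<close>

lemma good_count:
  assumes "k < K" "good k x a"
  shows "W k x a / 2 \<le> real (Nsa (hk k) x a)" "4 * ell \<le> real (Nsa (hk k) x a)" "0 < W k x a"
proof -
  have He: "ell \<le> real H * ell" using H1 ell_ge_8 mult_right_mono[of 1 "real H" ell] by simp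
  show "W k x a / 2 \<le> real (Nsa (hk k) x a)" using visits_ge[OF assms(1), of x a] assms(2) by simp
  then show "4 * ell \<le> real (Nsa (hk k) x a)" using assms(2) He by simp
  show "0 < W k x a" using assms(2) He ell_ge_8 by linarith
qed

section \<open>Totals over episodes, steps and states\<close>

definition tot :: "(nat \<Rightarrow> nat \<Rightarrow> 's \<Rightarrow> real) \<Rightarrow> real" where
  "tot f = (\<Sum>k<K. \<Sum>i<H. \<Sum>x\<in>UNIV. state_prob hs k i x * f k i x)"

lemma tot_nonneg: "(\<And>k i x. k < K \<Longrightarrow> i < H \<Longrightarrow> 0 \<le> f k i x) \<Longrightarrow> 0 \<le> tot f"
  unfolding tot_def by (intro sum_nonneg mult_nonneg_nonneg state_prob_range) auto

lemma tot_add: "tot (\<lambda>k i x. f k i x + g k i x) = tot f + tot g"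
  unfolding tot_def by (simp add: distrib_left sum.distrib)

lemma tot_cmult: "tot (\<lambda>k i x. c * f k i x) = c * tot f"
  unfolding tot_def by (simp add: sum_distrib_left mult_ac)

lemma tot_sqrt_le:
  assumes "\<And>k i x. k < K \<Longrightarrow> i < H \<Longrightarrow> 0 \<le> f k i x" "\<And>k i x. k < K \<Longrightarrow> i < H \<Longrightarrow> 0 \<le> g k i x"
  shows "tot (\<lambda>k i x. sqrt (f k i x * g k i x)) \<le> sqrt (tot f) * sqrt (tot g)"
proof -
  have eq: "tot f = (\<Sum>(k,i,x)\<in>{..<K} \<times> {..<H} \<times> UNIV. state_prob hs k i x * f k i x)" for f
    unfolding tot_def by (simp add: sum.cartesian_product)
  show ?thesis
    using weighted_Cauchy_Schwarz[of "{..<K} \<times> {..<H} \<times> UNIV" "\<lambda>(k,i,x). state_prob hs k i x"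
        "\<lambda>(k,i,x). f k i x" "\<lambda>(k,i,x). g k i x"] assms
    unfolding eq by (auto simp: state_prob_range split_beta)
qed

lemma tot_conv: "tot f = (\<Sum>k<K. \<Sum>i<H. wmean (pmf (occ P (act (hk k)) 1 (init (hk k)) i)) (f k i))"
  unfolding tot_def wmean_def state_prob_def ..

text \<open>Regrouping by state-action pair brings the sum over episodes inside, where the threshold
  and harmonic sum lemmas apply.\<close>

lemma tot_group:
  "tot (\<lambda>k i x. \<phi> k x (ac k i x)) = (\<Sum>x\<in>UNIV. \<Sum>a\<in>UNIV. \<Sum>k<K. visit_mean hs x a k * \<phi> k x a)"
proof -
  have "(\<Sum>i<H. \<Sum>x\<in>UNIV. state_prob hs k i x * \<phi> k x (ac k i x))
      = (\<Sum>x\<in>UNIV. \<Sum>a\<in>UNIV. visit_mean hs x a k * \<phi> k x a)" for k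
  proof -
    have "(\<Sum>i<H. \<Sum>x\<in>UNIV. state_prob hs k i x * \<phi> k x (ac k i x))
       = (\<Sum>i<H. \<Sum>x\<in>UNIV. \<Sum>a\<in>UNIV. state_prob hs k i x * of_bool (ac k i x = a) * \<phi> k x a)"
      by (intro sum.cong refl)
         (simp add: of_bool_def if_distrib[of "\<lambda>x. _ * x"] if_distrib[of "\<lambda>x. x * _"] cong: if_cong)
    also have "\<dots> = (\<Sum>x\<in>UNIV. \<Sum>a\<in>UNIV. \<Sum>i<H. state_prob hs k i x * of_bool (ac k i x = a) * \<phi> k x a)"
      by (subst sum.swap, intro sum.cong refl, rule sum.swap)
    also have "\<dots> = (\<Sum>x\<in>UNIV. \<Sum>a\<in>UNIV. visit_mean hs x a k * \<phi> k x a)"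
      unfolding visit_mean_def sum_distrib_right ..
    finally show ?thesis .
  qed
  then have "tot (\<lambda>k i x. \<phi> k x (ac k i x)) = (\<Sum>k<K. \<Sum>x\<in>UNIV. \<Sum>a\<in>UNIV. visit_mean hs x a k * \<phi> k x a)"
    unfolding tot_def by simp
  also have "\<dots> = (\<Sum>x\<in>UNIV. \<Sum>a\<in>UNIV. \<Sum>k<K. visit_mean hs x a k * \<phi> k x a)"
    by (subst sum.swap, intro sum.cong refl, rule sum.swap)
  finally show ?thesis .
qed

definition inv_count :: "nat \<Rightarrow> 's \<Rightarrow> 'a \<Rightarrow> real" where
  "inv_count k x a = (if good k x a then 1 / real (Nsa (hk k) x a) else 0)"

lemma inv_count_nonneg: "0 \<le> inv_count k x a"
  by (simp add: inv_count_def)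

lemma sum_state_action_const: "(\<Sum>x\<in>(UNIV::'s set). \<Sum>a\<in>(UNIV::'a set). c) = S * A * (c::real)"
  by (simp add: S_eq A_eq)

text \<open>Beyond the threshold N \<ge> W / 2, so each pair contributes at most twice a harmonic
  sum of its conditional means.\<close>

lemma tot_inv_count: "tot (\<lambda>k i x. inv_count k x (ac k i x)) \<le> 2 * S * A * ell"
proof -
  have "(\<Sum>k<K. visit_mean hs x a k * inv_count k x a) \<le> 2 * ell" for x a
  proof -
    have "(\<Sum>k<K. visit_mean hs x a k * inv_count k x a)
       \<le> (\<Sum>k<K. 2 * (if good k x a then visit_mean hs x a k / W k x a else 0))"
    proof (rule sum_mono)
      fix k assume "k \<in> {..<K}"
      then have k: "k < K" by simp
      show "visit_mean hs x a k * inv_count k x a \<le> 2 * (if good k x a then visit_mean hs x a k / W k x a else 0)"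
      proof (cases "good k x a")
        case True
        note g = good_count[OF k True]
        have "1 / real (Nsa (hk k) x a) \<le> 1 / (W k x a / 2)" using g by (intro divide_left_mono) auto
        then have "visit_mean hs x a k * (1 / real (Nsa (hk k) x a)) \<le> visit_mean hs x a k * (1 / (W k x a / 2))"
          by (intro mult_left_mono visit_mean_range)
        then show ?thesis using True by (simp add: inv_count_def mult_ac)
      qed (simp add: inv_count_def)
    qed
    also have "\<dots> = 2 * (\<Sum>k<K. if good k x a then visit_mean hs x a k / W k x a else 0)"
      by (simp add: sum_distrib_left)
    also have "\<dots> \<le> 2 * ell"
      using H1 ell_ge_8 K1 ln_K_le
      by (intro mult_left_mono sum_harmonic_above_threshold visit_mean_range) auto
    finally show ?thesis .
  qed
  then have "tot (\<lambda>k i x. inv_count k x (ac k i x)) \<le> (\<Sum>x\<in>(UNIV::'s set). \<Sum>a\<in>(UNIV::'a set). 2 * ell)"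
    unfolding tot_group by (intro sum_mono)
  then show ?thesis unfolding sum_state_action_const by (simp add: mult_ac)
qed

text \<open>Before a pair is good, the trivial error H is charged; its expected visits in that phase
  total at most 8 H \<open>ell\<close> + H.\<close>

lemma tot_bad: "tot (\<lambda>k i x. if good k x (ac k i x) then 0 else real H) \<le> 9 * (real H)\<^sup>2 * S * A * ell"
proof -
  have "(\<Sum>k<K. visit_mean hs x a k * (if good k x a then 0 else real H)) \<le> 9 * (real H)\<^sup>2 * ell" for x a
  proof -
    have "(\<Sum>k<K. visit_mean hs x a k * (if good k x a then 0 else real H))
        = real H * (\<Sum>k<K. if W k x a < 8 * real H * ell then visit_mean hs x a k else 0)"
      unfolding sum_distrib_left by (rule sum.cong) auto
    also have "\<dots> \<le> real H * (8 * real H * ell + real H)"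
      using ell_ge_8 by (intro mult_left_mono sum_below_threshold visit_mean_range) auto
    also have "\<dots> \<le> real H * (8 * real H * ell + real H * ell)"
    proof -
      have "real H * 1 \<le> real H * ell" using ell_ge_8 by (intro mult_left_mono) auto
      then show ?thesis by (intro mult_left_mono add_left_mono) auto
    qed
    finally show ?thesis by (simp add: power2_eq_square mult_ac)
  qed
  then have "tot (\<lambda>k i x. if good k x (ac k i x) then 0 else real H)
    \<le> (\<Sum>x\<in>(UNIV::'s set). \<Sum>a\<in>(UNIV::'a set). 9 * (real H)\<^sup>2 * ell)"
    unfolding tot_group[of "\<lambda>k x a. if good k x a then 0 else real H"] by (intro sum_mono)
  then show ?thesis unfolding sum_state_action_const by (simp add: mult_ac)
qed

definition fmean :: "nat \<Rightarrow> nat \<Rightarrow> 's \<Rightarrow> real" where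
  "fmean k i x = wmean (p x (ac k i x)) (fbon (hk k) (Suc (Suc i)))"

lemma fmean_nonneg: "0 \<le> fmean k i x"
  unfolding fmean_def by (intro wmean_nonneg prob_weights_pmf fbon_range)

lemma tot_next:
  "tot (\<lambda>k i x. wmean (p x (ac k i x)) (f k i)) = (\<Sum>k<K. \<Sum>i<H. \<Sum>y\<in>UNIV. state_prob hs k (Suc i) y * f k i y)"
  unfolding tot_conv
proof (intro sum.cong refl)
  fix k i
  show "wmean (pmf (occ P (act (hk k)) 1 (init (hk k)) i)) (\<lambda>x. wmean (p x (ac k i x)) (f k i))
    = (\<Sum>y\<in>UNIV. state_prob hs k (Suc i) y * f k i y)"
    using wmean_occ_Suc[of P "act (hk k)" 1 "init (hk k)" i "f k i"]
    by (simp add: wmean_def state_prob_def)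
qed

text \<open>The integrand depends only on successor state and step, so there are H S harmonic sums.
  The cap H^2 covers rarely reached states; 20000 is 2 times 100^2, and the final unit absorbs the
  capped part.\<close>

lemma tot_fmean: "tot fmean \<le> 20001 * real H ^ 4 * S ^ 3 * A * ell ^ 3"
proof -
  define C where "C = 100\<^sup>2 * real H ^ 3 * S\<^sup>2 * A * ell\<^sup>2"
  have C0: "0 \<le> C" using A1 by (simp add: C_def)
  have each: "(\<Sum>k<K. state_prob hs k (Suc i) y * fbon (hk k) (Suc (Suc i)) y) \<le> 9 * (real H)\<^sup>2 * ell + 2 * C * ell"
    if i: "i < H" for i y
  proof -
    let ?w = "\<lambda>k. state_prob hs k (Suc i) y"
    let ?W = "\<lambda>k. \<Sum>j<k. ?w j"
    have "(\<Sum>k<K. ?w k * fbon (hk k) (Suc (Suc i)) y)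
      \<le> (\<Sum>k<K. (real H)\<^sup>2 * (if ?W k < 8 * ell then ?w k else 0)
            + 2 * C * (if 8 * 1 * ell \<le> ?W k then ?w k / ?W k else 0))"
    proof (rule sum_mono)
      fix k assume "k \<in> {..<K}"
      then have k: "k < K" by simp
      show "?w k * fbon (hk k) (Suc (Suc i)) y \<le> (real H)\<^sup>2 * (if ?W k < 8 * ell then ?w k else 0)
            + 2 * C * (if 8 * 1 * ell \<le> ?W k then ?w k / ?W k else 0)"
      proof (cases "?W k < 8 * ell")
        case True
        have "?w k * fbon (hk k) (Suc (Suc i)) y \<le> ?w k * (real H)\<^sup>2"
          by (intro mult_left_mono fbon_range state_prob_range)
        then show ?thesis using True by (simp add: mult.commute)
      next
        case False
        let ?N = "real (Nprime (hk k) (Suc (Suc i)) y)"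
        have N: "?W k / 2 \<le> ?N" using state_visits_ge[OF k i, of y] False by simp
        have W0: "0 < ?W k" using False ell_ge_8 by simp
        have N0: "0 < ?N" using N W0 by linarith
        have "fbon (hk k) (Suc (Suc i)) y \<le> C / ?N" using N0 by (simp add: fbon_def C_def)
        also have "\<dots> \<le> C / (?W k / 2)" using N W0 C0 N0 by (intro divide_left_mono) auto
        finally have "?w k * fbon (hk k) (Suc (Suc i)) y \<le> ?w k * (C / (?W k / 2))"
          by (intro mult_left_mono state_prob_range)
        then show ?thesis using False by (simp add: mult_ac)
      qed
    qed
    also have "\<dots> = (real H)\<^sup>2 * (\<Sum>k<K. if ?W k < 8 * ell then ?w k else 0)
       + 2 * C * (\<Sum>k<K. if 8 * 1 * ell \<le> ?W k then ?w k / ?W k else 0)"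
      by (simp only: sum.distrib sum_distrib_left)
    also have "\<dots> \<le> (real H)\<^sup>2 * (8 * ell + 1) + 2 * C * ell"
      using ell_ge_8 C0 K1 ln_K_le
      by (intro add_mono mult_left_mono sum_below_threshold sum_harmonic_above_threshold state_prob_range) auto
    also have "\<dots> \<le> (real H)\<^sup>2 * (9 * ell) + 2 * C * ell"
      using ell_ge_8 by (intro add_right_mono mult_left_mono) auto
    finally show ?thesis by simp
  qed
  have "tot fmean = (\<Sum>k<K. \<Sum>i<H. \<Sum>y\<in>UNIV. state_prob hs k (Suc i) y * fbon (hk k) (Suc (Suc i)) y)"
    unfolding fmean_def[abs_def] by (rule tot_next)
  also have "\<dots> = (\<Sum>i<H. \<Sum>y\<in>UNIV. \<Sum>k<K. state_prob hs k (Suc i) y * fbon (hk k) (Suc (Suc i)) y)"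
    by (subst sum.swap, intro sum.cong refl, rule sum.swap)
  also have "\<dots> \<le> (\<Sum>i<H. \<Sum>y\<in>(UNIV::'s set). 9 * (real H)\<^sup>2 * ell + 2 * C * ell)"
    by (intro sum_mono each) simp
  also have "\<dots> = real H * S * (9 * (real H)\<^sup>2 * ell) + 20000 * real H ^ 4 * S ^ 3 * A * ell ^ 3"
    by (simp add: S_eq C_def power_numeral_reduce algebra_simps)
  also have "real H * S * (9 * (real H)\<^sup>2 * ell) \<le> 1 * (real H ^ 4 * S ^ 3 * A * ell ^ 3)"
  proof -
    have "9 \<le> ell\<^sup>2" using ell_ge_8 power_mono[of 8 ell 2] by simp
    then have "9 * 1 * 1 * 1 \<le> ell\<^sup>2 * real H * S\<^sup>2 * A"
      using H1 S1 A1 by (intro mult_mono) (auto simp: one_le_power)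
    then have "real H ^ 3 * S * ell * 9 \<le> real H ^ 3 * S * ell * (ell\<^sup>2 * real H * S\<^sup>2 * A)"
      using S1 ell_ge_8 by (intro mult_left_mono) auto
    then show ?thesis by (simp add: power_numeral_reduce mult_ac)
  qed
  finally show ?thesis by (simp add: mult_ac)
qed

section \<open>The self-bounding inequality for the total error\<close>

definition err :: "nat \<Rightarrow> nat \<Rightarrow> 's \<Rightarrow> real" where
  "err k i x = (let a = ac k i x; n = real (Nsa (hk k) x a) in
     if good k x a then 64/10 * sqrt (ell * spread (hk k) (Suc i) x a / n) + 40 * (real H)\<^sup>2 * S * ell / n
        + sqrt (88/10 * fmean k i x / n)
     else real H)"

lemma err_nonneg: "i < H \<Longrightarrow> 0 \<le> err k i x"
  unfolding err_def Let_def using S1 ell_ge_8 spread_nonneg[OF hk_ok, of "Suc i"] fmean_nonneg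
  by (auto intro!: add_nonneg_nonneg mult_nonneg_nonneg divide_nonneg_nonneg)

definition epi_err :: "nat \<Rightarrow> real" where
  "epi_err k = (\<Sum>i<H. wmean (pmf (occ P (act (hk k)) 1 (init (hk k)) i)) (err k i))"

lemma tot_err: "tot err = (\<Sum>k<K. epi_err k)"
  unfolding tot_conv epi_err_def ..

lemma epi_err_nonneg: "0 \<le> epi_err k"
  unfolding epi_err_def by (intro sum_nonneg wmean_nonneg prob_weights_pmf err_nonneg) auto

text \<open>Compounded over H steps, the inflation stays below exp (1/10) \<le> 1 + 1/10 +
  1/100.\<close>

lemma inflation_le: "(1 + 1 / (10 * real H)) ^ H \<le> 111/100"
proof -
  have "(1 + 1 / (10 * real H)) ^ H \<le> exp (1 / (10 * real H)) ^ H"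
    using H1 by (intro power_mono exp_ge_add_one_self) (simp add: add_nonneg_nonneg)
  also have "\<dots> = exp (1/10)" using H1 by (simp flip: exp_of_nat_mult)
  also have "\<dots> \<le> 111/100" using exp_bound[of "1/10::real"] by (simp add: power2_eq_square)
  finally show ?thesis .
qed

lemma gap_mean_le:
  assumes k: "k < K" and i: "i \<le> H"
  shows "wmean (pmf (occ P (act (hk k)) 1 (init (hk k)) i)) (gap (hk k) (Suc i)) \<le> 111/100 * epi_err k"
proof -
  have "wmean (pmf (occ P (act (hk k)) 1 (init (hk k)) i)) (gap (hk k) (Suc i))
     \<le> (1 + 1 / (10 * real H)) ^ H * epi_err k"
    unfolding epi_err_def
  proof (rule unroll_error[where D = "\<lambda>i. gap (hk k) (Suc i)"])
    fix j x assume j: "j < H"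
    let ?a = "act (hk k) (Suc j) x"
    have h: "1 \<le> Suc j" "Suc j \<le> H" using j by auto
    show "gap (hk k) (Suc j) x
       \<le> (1 + 1 / (10 * real H)) * wmean (p x ?a) (gap (hk k) (Suc (Suc j))) + err k j x"
    proof (cases "good k x ?a")
      case True
      then show ?thesis
        using local_error[OF hk_ok run_trans_ok h, of k x] good_count(2)[OF k True]
        by (simp add: err_def Let_def fmean_def)
    next
      case False
      have "0 \<le> (1 + 1 / (10 * real H)) * wmean (p x ?a) (gap (hk k) (Suc (Suc j)))"
        using h gap_range(1)[OF hk_ok, of "Suc (Suc j)" k]
        by (intro mult_nonneg_nonneg wmean_nonneg prob_weights_pmf) auto
      moreover have "gap (hk k) (Suc j) x \<le> real H" using gap_range(2)[OF hk_ok, of "Suc j"] h by simp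
      ultimately show ?thesis using False by (simp add: err_def)
    qed
    show "0 \<le> err k j x" by (rule err_nonneg[OF j])
  next
    show "gap (hk k) (Suc H) x = 0" for x by (simp add: gap_def Vk_end Vpi_end)
  qed (use i in auto)
  also have "\<dots> \<le> 111/100 * epi_err k"
    by (intro mult_right_mono inflation_le epi_err_nonneg)
  finally show ?thesis .
qed

text \<open>Total variance supplies H^2 per episode. The gap at each of the H steps is at most
  111/100 times the episode error, and the weight H in \<open>spread\<close> makes this H^2 times
  the total error.\<close>

lemma tot_spread:
  "tot (\<lambda>k i x. spread (hk k) (Suc i) x (ac k i x)) \<le> (real H)\<^sup>2 * (real K + 111/100 * tot err)"
proof -
  have "tot (\<lambda>k i x. wvar (p x (ac k i x)) (Vp (hk k) (Suc (Suc i)))) \<le> (\<Sum>k<K. (real H)\<^sup>2)"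
    unfolding tot_conv by (intro sum_mono total_variance_bound R_range)
  moreover have "tot (\<lambda>k i x. wmean (p x (ac k i x)) (gap (hk k) (Suc (Suc i)))) \<le> real H * (111/100 * tot err)"
  proof -
    have "tot (\<lambda>k i x. wmean (p x (ac k i x)) (gap (hk k) (Suc (Suc i))))
      = (\<Sum>k<K. \<Sum>i<H. wmean (pmf (occ P (act (hk k)) 1 (init (hk k)) (Suc i))) (gap (hk k) (Suc (Suc i))))"
      unfolding tot_next by (simp add: wmean_def state_prob_def)
    also have "\<dots> \<le> (\<Sum>k<K. \<Sum>i<H. 111/100 * epi_err k)"
      by (intro sum_mono gap_mean_le) auto
    also have "\<dots> = real H * (111/100 * tot err)"
      unfolding tot_err by (simp add: sum_distrib_left)
    finally show ?thesis .
  qed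
  then have "real H * tot (\<lambda>k i x. wmean (p x (ac k i x)) (gap (hk k) (Suc (Suc i))))
     \<le> real H * (real H * (111/100 * tot err))" by (intro mult_left_mono) auto
  ultimately show ?thesis
    unfolding spread_def tot_add tot_cmult by (simp add: power2_eq_square algebra_simps)
qed

text \<open>Cauchy-Schwarz makes the variance part a multiple of Q sqrt (K + 111/100 G), with G the
  total error itself; the part with G is split so that half of G returns to the left.\<close>

lemma tot_err_le:
  "tot err \<le> 1444 * ((real H)\<^sup>2 * S\<^sup>2 * A * ell\<^sup>2) + 1812/100 * (real H * ell * sqrt (S * A * real K))"
proof -
  define U where "U = (real H)\<^sup>2 * S\<^sup>2 * A * ell\<^sup>2"
  define G where "G = tot err"
  define Q where "Q = real H * ell * sqrt (S * A)"
  let ?g = "\<lambda>k i x. inv_count k x (ac k i x)"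
  let ?sp = "\<lambda>k i x. spread (hk k) (Suc i) x (ac k i x)"
  have G0: "0 \<le> G" unfolding G_def by (rule tot_nonneg) (rule err_nonneg)
  have Q0: "0 \<le> Q" using S1 A1 ell_ge_8 by (simp add: Q_def)
  have U0: "0 \<le> U" using A1 by (simp add: U_def)
  have SS: "S \<le> S\<^sup>2" using S1 by (simp add: power2_eq_square)
  have Q2: "Q\<^sup>2 \<le> U"
  proof -
    have "Q\<^sup>2 = (real H)\<^sup>2 * ell\<^sup>2 * A * S" using S1 A1 by (simp add: Q_def power_mult_distrib)
    also have "\<dots> \<le> (real H)\<^sup>2 * ell\<^sup>2 * A * S\<^sup>2" using SS A1 by (intro mult_left_mono) auto
    finally show ?thesis by (simp add: U_def mult_ac)
  qed
  have sp0: "0 \<le> ?sp k i x" if "i < H" for k i x using spread_nonneg[OF hk_ok, of "Suc i"] that by simp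
  have split: "err k i x = (if good k x (ac k i x) then 0 else real H)
      + (64/10 * sqrt (?g k i x * (ell * ?sp k i x)) + (40 * (real H)\<^sup>2 * S * ell * ?g k i x
      + sqrt (?g k i x * (88/10 * fmean k i x))))" for k i x
    by (simp add: err_def inv_count_def Let_def)
  have "G = tot (\<lambda>k i x. if good k x (ac k i x) then 0 else real H)
     + (64/10 * tot (\<lambda>k i x. sqrt (?g k i x * (ell * ?sp k i x)))
     + (40 * (real H)\<^sup>2 * S * ell * tot ?g
     + tot (\<lambda>k i x. sqrt (?g k i x * (88/10 * fmean k i x)))))"
    unfolding G_def split[abs_def] tot_add tot_cmult ..
  moreover have "tot (\<lambda>k i x. if good k x (ac k i x) then 0 else real H) \<le> 2 * U"
  proof -
    have "9 * S \<le> 2 * ell * S\<^sup>2" using SS ell_ge_8 S1 by (intro mult_mono) auto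
    then have "(real H)\<^sup>2 * A * ell * (9 * S) \<le> (real H)\<^sup>2 * A * ell * (2 * ell * S\<^sup>2)"
      using A1 ell_ge_8 by (intro mult_left_mono) auto
    then show ?thesis using tot_bad by (simp add: U_def power2_eq_square mult_ac)
  qed
  moreover have "40 * (real H)\<^sup>2 * S * ell * tot ?g \<le> 80 * U"
  proof -
    have "40 * (real H)\<^sup>2 * S * ell * tot ?g \<le> 40 * (real H)\<^sup>2 * S * ell * (2 * S * A * ell)"
      using S1 ell_ge_8 by (intro mult_left_mono tot_inv_count) auto
    then show ?thesis by (simp add: U_def power2_eq_square mult_ac)
  qed
  moreover have "tot (\<lambda>k i x. sqrt (?g k i x * (88/10 * fmean k i x))) \<le> 594 * U"
  proof -
    have "tot (\<lambda>k i x. sqrt (?g k i x * (88/10 * fmean k i x))) \<le> sqrt (tot ?g) * sqrt (tot (\<lambda>k i x. 88/10 * fmean k i x))"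
      by (intro tot_sqrt_le) (auto simp: inv_count_nonneg fmean_nonneg)
    also have "\<dots> = sqrt (tot ?g * (88/10 * tot fmean))" unfolding tot_cmult by (rule real_sqrt_mult[symmetric])
    also have "\<dots> \<le> 594 * U"
    proof (rule real_le_lsqrt)
      have "tot ?g * (88/10 * tot fmean) \<le> (2 * S * A * ell) * (88/10 * (20001 * real H ^ 4 * S ^ 3 * A * ell ^ 3))"
        using S1 A1 ell_ge_8
        by (intro mult_mono tot_inv_count tot_fmean mult_left_mono) (auto intro!: tot_nonneg fmean_nonneg)
      also have "\<dots> = 3520176/10 * U\<^sup>2" by (simp add: U_def power_numeral_reduce)
      also have "\<dots> \<le> (594 * U)\<^sup>2" by (simp add: power_mult_distrib)
      finally show "tot ?g * (88/10 * tot fmean) \<le> (594 * U)\<^sup>2" .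
    qed (use U0 in auto)
    finally show ?thesis .
  qed
  moreover have "64/10 * tot (\<lambda>k i x. sqrt (?g k i x * (ell * ?sp k i x))) \<le> 906/100 * (Q * sqrt (real K)) + (G / 2 + 46 * U)"
  proof -
    have "tot (\<lambda>k i x. sqrt (?g k i x * (ell * ?sp k i x))) \<le> sqrt (tot ?g) * sqrt (tot (\<lambda>k i x. ell * ?sp k i x))"
      using ell_ge_8 by (intro tot_sqrt_le) (auto simp: inv_count_nonneg sp0)
    also have "\<dots> = sqrt (tot ?g * (ell * tot ?sp))" unfolding tot_cmult by (rule real_sqrt_mult[symmetric])
    also have "\<dots> \<le> sqrt ((2 * S * A * ell) * (ell * ((real H)\<^sup>2 * (real K + 111/100 * G))))"
      using S1 A1 ell_ge_8 unfolding G_def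
      by (intro real_sqrt_le_mono mult_mono tot_inv_count tot_spread mult_left_mono)
         (auto intro!: mult_nonneg_nonneg tot_nonneg sp0)
    also have "(2 * S * A * ell) * (ell * ((real H)\<^sup>2 * (real K + 111/100 * G))) = 2 * (Q\<^sup>2 * (real K + 111/100 * G))"
      using S1 A1 by (simp add: Q_def power_mult_distrib power2_eq_square)
    also have "sqrt (2 * (Q\<^sup>2 * (real K + 111/100 * G))) = sqrt 2 * (Q * sqrt (real K + 111/100 * G))"
      using Q0 by (simp only: real_sqrt_mult real_sqrt_abs abs_of_nonneg)
    also have "\<dots> \<le> 1415/1000 * (Q * sqrt (real K + 111/100 * G))"
      using Q0 G0 by (intro mult_right_mono real_le_lsqrt) (auto simp: power2_eq_square)
    finally have "tot (\<lambda>k i x. sqrt (?g k i x * (ell * ?sp k i x))) \<le> 1415/1000 * (Q * sqrt (real K + 111/100 * G))" .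
    moreover have "0 \<le> Q * sqrt (real K + 111/100 * G)" using Q0 G0 by simp
    moreover have "64/10 * t \<le> 906/100 * r" if "t \<le> 1415/1000 * r" "0 \<le> r" for t r :: real
      using that by linarith
    ultimately have "64/10 * tot (\<lambda>k i x. sqrt (?g k i x * (ell * ?sp k i x))) \<le> 906/100 * (Q * sqrt (real K + 111/100 * G))"
      by blast
    also have "\<dots> \<le> 906/100 * (Q * (sqrt (real K) + sqrt (111/100 * G)))"
      using Q0 G0 by (intro mult_left_mono sqrt_add_le_add_sqrt) auto
    also have "\<dots> = 906/100 * (Q * sqrt (real K)) + (906/100 * Q) * sqrt (111/100 * G)"
      by (simp add: distrib_left)
    also have "(906/100 * Q) * sqrt (111/100 * G) \<le> G / 2 + 46 * U"
    proof -
      let ?r = "sqrt (111/100 * G)"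
      have r2: "?r * ?r = 111/100 * G" using G0 by simp
      \<comment> \<open>The weight 100/111 makes the coefficient of \<open>G\<close> exactly 1/2;
        the other square is then about 45.6 Q^2, below 46 U.\<close>
      have "0 \<le> (100/111 * ?r - 906/100 * Q)\<^sup>2" by simp
      then have "2 * (100/111) * ((906/100 * Q) * ?r) \<le> (100/111)\<^sup>2 * (?r * ?r) + (906/100)\<^sup>2 * Q\<^sup>2"
        by (simp add: power2_eq_square algebra_simps)
      also have "\<dots> \<le> (100/111)\<^sup>2 * (111/100 * G) + (906/100)\<^sup>2 * U" unfolding r2 using Q2 by simp
      finally have "(906/100 * Q) * ?r \<le> 111/200 * ((100/111)\<^sup>2 * (111/100 * G) + (906/100)\<^sup>2 * U)"
        by simp
      also have "\<dots> \<le> G / 2 + 46 * U" using U0 by (simp add: power2_eq_square)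
      finally show ?thesis .
    qed
    finally show ?thesis by simp
  qed
  \<comment> \<open>2 + 80 + 594 + 46 = 722, and moving G / 2 to the left doubles this and the
    factor 906/100.\<close>
  moreover have "g \<le> 1444 * U + 1812/100 * r"
    if "g = a + (b + (c + d))" "a \<le> 2 * U" "c \<le> 80 * U" "d \<le> 594 * U" "b \<le> 906/100 * r + (g / 2 + 46 * U)"
    for g a b c d r :: real using that by linarith
  ultimately have "G \<le> 1444 * U + 1812/100 * (Q * sqrt (real K))" by blast
  then show ?thesis by (simp add: G_def U_def Q_def real_sqrt_mult mult_ac)
qed

text \<open>Optimism at the first step bounds the regret by the gap there, and the inflation 111/100
  leaves the constants below 2500 and 30.\<close>

lemma regret_le:
  "regret P R H act init K hs
    \<le> 2500 * ((real H)\<^sup>2 * S\<^sup>2 * A * ell\<^sup>2) + 30 * (real H * ell * sqrt (S * A * real K))"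
proof -
  have "regret P R H act init K hs = (\<Sum>k<K. Vs 1 (init (hk k)) - Vp (hk k) 1 (init (hk k)))"
    unfolding regret_def by (rule sum.reindex_bij_witness[of _ Suc "\<lambda>k. k - 1"]) auto
  also have "\<dots> \<le> (\<Sum>k<K. 111/100 * epi_err k)"
  proof (rule sum_mono)
    fix k assume "k \<in> {..<K}"
    then have k: "k < K" by simp
    have "Vs 1 (init (hk k)) - Vp (hk k) 1 (init (hk k)) \<le> gap (hk k) 1 (init (hk k))"
      using Vk_range(1)[OF hk_ok, of 1] by (simp add: gap_def)
    also have "\<dots> \<le> 111/100 * epi_err k"
      using gap_mean_le[OF k, of 0] wmean_occ_0[of P "act (hk k)" 1 "init (hk k)"] by (simp del: occ.simps)
    finally show "Vs 1 (init (hk k)) - Vp (hk k) 1 (init (hk k)) \<le> 111/100 * epi_err k" .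
  qed
  also have "\<dots> = 111/100 * tot err" unfolding tot_err by (simp add: sum_distrib_left)
  also have "\<dots> \<le> 2500 * ((real H)\<^sup>2 * S\<^sup>2 * A * ell\<^sup>2) + 30 * (real H * ell * sqrt (S * A * real K))"
  proof -
    have "0 \<le> (real H)\<^sup>2 * S\<^sup>2 * A * ell\<^sup>2" "0 \<le> real H * ell * sqrt (S * A * real K)"
      using S1 A1 ell_ge_8 by auto
    then show ?thesis using tot_err_le by linarith
  qed
  finally show ?thesis .
qed

end

section \<open>Probability of a good run\<close>

lemma prob_union_le:
  fixes M :: "'b pmf"
  assumes "finite I" "\<And>i. i \<in> I \<Longrightarrow> measure_pmf.prob M (B i) \<le> c"
  shows "measure_pmf.prob M (\<Union>i\<in>I. B i) \<le> real (card I) * c"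
proof -
  have "measure_pmf.prob M (\<Union>i\<in>I. B i) \<le> (\<Sum>i\<in>I. measure_pmf.prob M (B i))"
    using assms(1) by (intro measure_pmf.finite_measure_subadditive_finite) auto
  also have "\<dots> \<le> (\<Sum>i\<in>I. c)" by (intro sum_mono assms(2))
  finally show ?thesis by simp
qed

context ucbvi_bf
begin

abbreviation "M \<equiv> gen_hist P H act init K"

lemma exp_minus_ell: "exp (- ell) = \<delta> / (5 * S * A * (real K * real H))"
  using delta by (simp add: exp_minus exp_ell)

text \<open>Pairs, steps, signs and grid points give at most 2 S A H K events of probability exp
  (-ell) each; prefixes are already covered by the maximal inequality.\<close>

lemma prob_dev: "measure_pmf.prob M {hs. \<exists>k. \<not> dev_ok (take k hs)} \<le> 2 * \<delta> / 5"
proof -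
  define z where "z x a h s j y =
        real j / K * (s * (wmean (p x a) (Vs (Suc h)) - Vs (Suc h) y) / H)
         - (real j / K)\<^sup>2 / (2 * (1 - real j / K)) * (s * (wmean (p x a) (Vs (Suc h)) - Vs (Suc h) y) / H)\<^sup>2"
    for x a h j y and s :: real
  define B where "B = (\<lambda>(x,a,h,s,j). {hs. \<exists>k. ell \<le> (\<Sum>y\<in>UNIV. real (Ncnt (take k hs) x a y) * z x a h s j y)})"
  define I where "I = (UNIV :: 's set) \<times> (UNIV :: 'a set) \<times> {1..H} \<times> {-1,1::real} \<times> {1..<K}"
  have "{hs. \<exists>k. \<not> dev_ok (take k hs)} \<subseteq> (\<Union>i\<in>I. B i)"
  proof
    fix hs assume "hs \<in> {hs. \<exists>k. \<not> dev_ok (take k hs)}"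
    then obtain k x a h s j where "h \<in> {1..H}" "s \<in> {-1,1}" "j \<in> {1..<K}"
      "\<not> (\<Sum>y\<in>UNIV. real (Ncnt (take k hs) x a y) * z x a h s j y) < ell"
      unfolding dev_ok_def z_def by blast
    then show "hs \<in> (\<Union>i\<in>I. B i)"
      by (intro UN_I[of "(x,a,h,s,j)"]) (auto simp: I_def B_def not_less)
  qed
  then have "measure_pmf.prob M {hs. \<exists>k. \<not> dev_ok (take k hs)} \<le> measure_pmf.prob M (\<Union>i\<in>I. B i)"
    by (intro measure_pmf.finite_measure_mono) auto
  also have "\<dots> \<le> real (card I) * exp (- ell)"
  proof (rule prob_union_le)
    fix i assume i: "i \<in> I"
    obtain x a h s j where eq: "i = (x,a,h,s,j)" by (cases i) auto
    have s: "s = 1 \<or> s = -1" and j: "1 \<le> j" "j < K" using i by (auto simp: I_def eq)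
    define \<mu> where "\<mu> = wmean (p x a) (Vs (Suc h))"
    have V: "0 \<le> Vs (Suc h) y" "Vs (Suc h) y \<le> real H" for y using Vs_range[of "Suc h" y] by auto
    have mu: "0 \<le> \<mu>" "\<mu> \<le> real H" unfolding \<mu>_def
      by (auto intro!: wmean_nonneg wmean_le prob_weights_pmf V)
    have "measure_pmf.expectation (P x a) (\<lambda>y. exp (z x a h s j y)) \<le> 1"
      unfolding z_def \<mu>_def[symmetric]
    proof (rule self_normalized_exp_bound)
      show "-1 \<le> s * (\<mu> - Vs (Suc h) y) / H" for y
        using s V[of y] mu H1 by (auto simp: pos_le_divide_eq)
      have "(\<lambda>y. s * (\<mu> - Vs (Suc h) y) / H) = (\<lambda>y. s / H * (\<mu> - Vs (Suc h) y))" by auto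
      then show "wmean (p x a) (\<lambda>y. s * (\<mu> - Vs (Suc h) y) / H) = 0"
        by (simp only: wmean_cmult wmean_diff wmean_const[OF prob_weights_pmf] \<mu>_def) simp
    qed (use j in auto)
    then show "measure_pmf.prob M (B i) \<le> exp (- ell)"
      unfolding B_def eq prod.case by (rule transition_sum_concentration)
  qed (simp add: I_def)
  also have "real (card I) = S * A * (real H * (2 * (real K - 1)))"
    using K1 by (simp add: I_def card_cartesian_product S_eq A_eq of_nat_diff)
  also have "\<dots> * exp (- ell) \<le> (S * A * (real H * (2 * real K))) * exp (- ell)"
    using S1 A1 by (intro mult_right_mono mult_left_mono) auto
  also have "\<dots> = 2 * \<delta> / 5"
    unfolding exp_minus_ell using S1 A1 H1 K1 by (simp add: field_simps)
  finally show ?thesis .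
qed

lemma prob_trans: "measure_pmf.prob M {hs. \<exists>k. \<not> trans_ok (take k hs)} \<le> \<delta> / 5"
proof -
  define t where "t = 1 / (10 * real H)"
  have t: "0 \<le> t" "t \<le> 1" using H1 by (auto simp: t_def field_simps)
  define B where "B = (\<lambda>(x,a,z). {hs. \<exists>k. ell \<le> (\<Sum>y\<in>UNIV. real (Ncnt (take k hs) x a y) *
     (t * of_bool (y = z) - (t + t\<^sup>2) * p x a z))})"
  define I where "I = (UNIV :: ('s \<times> 'a \<times> 's) set)"
  have "{hs. \<exists>k. \<not> trans_ok (take k hs)} \<subseteq> (\<Union>i\<in>I. B i)"
  proof
    fix hs assume "hs \<in> {hs. \<exists>k. \<not> trans_ok (take k hs)}"
    then obtain k x a z where "\<not> (\<Sum>y\<in>UNIV. real (Ncnt (take k hs) x a y) *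
     (t * of_bool (y = z) - (t + t\<^sup>2) * p x a z)) < ell"
      unfolding trans_ok_def t_def by blast
    then show "hs \<in> (\<Union>i\<in>I. B i)"
      by (intro UN_I[of "(x,a,z)"]) (auto simp: I_def B_def not_less)
  qed
  then have "measure_pmf.prob M {hs. \<exists>k. \<not> trans_ok (take k hs)} \<le> measure_pmf.prob M (\<Union>i\<in>I. B i)"
    by (intro measure_pmf.finite_measure_mono) auto
  also have "\<dots> \<le> real (card I) * exp (- ell)"
  proof (rule prob_union_le)
    fix i assume i: "i \<in> I"
    obtain x a z where eq: "i = (x,a,z)" by (cases i) auto
    show "measure_pmf.prob M (B i) \<le> exp (- ell)"
      unfolding B_def eq prod.case by (intro transition_sum_concentration indicator_exp_bound t)
  qed (simp add: I_def)
  also have "real (card I) = S * A * S"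
    by (simp add: I_def S_eq A_eq card_cartesian_product flip: UNIV_Times_UNIV)
  also have "\<dots> \<le> S * A * (real K * real H)"
  proof -
    \<comment> \<open>\<open>K_large\<close> makes K exceed S, so indexing the events by a successor
      state costs no more than the factor K H in \<open>ell\<close>.\<close>
    have "S \<le> real K"
    proof -
      have "1 * S \<le> (2500 * real H * S * A * ell\<^sup>2) * S"
      proof (rule mult_right_mono)
        have "1 \<le> ell\<^sup>2" using ell_ge_8 by (simp add: one_le_power)
        then have "1 * 1 * 1 * 1 * 1 \<le> 2500 * real H * S * A * ell\<^sup>2"
          using H1 S1 A1 by (intro mult_mono) auto
        then show "1 \<le> 2500 * real H * S * A * ell\<^sup>2" by simp
      qed (use S1 in auto)
      then show ?thesis using K_large by (simp add: power2_eq_square mult_ac)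
    qed
    also have "\<dots> \<le> real K * real H" using H1 by (simp add: mult_le_cancel_left1)
    finally show ?thesis using S1 A1 by (intro mult_left_mono) auto
  qed
  then have "S * A * S * exp (- ell) \<le> S * A * (real K * real H) * exp (- ell)" by (intro mult_right_mono) auto
  also have "\<dots> = \<delta> / 5"
    unfolding exp_minus_ell using S1 A1 H1 K1 by (simp add: field_simps)
  finally show ?thesis .
qed

text \<open>Dividing by H brings the visits of an episode into the unit interval that
  \<open>episode_count_concentration\<close> requires.\<close>

lemma prob_visits:
  "measure_pmf.prob M {hs. \<exists>k\<le>length hs. \<exists>x a.
     ell \<le> (\<Sum>i<k. 5/8 * (visit_mean hs x a i / H) - real (visits x a (hs ! i)) / H)} \<le> \<delta> / 5"
    (is "measure_pmf.prob M ?F \<le> _")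
proof -
  define m where "m x a hs = measure_pmf.expectation (gen_steps P (act hs) 1 H (init hs)) (\<lambda>ep. real (visits x a ep) / H)"
    for x a hs
  have m: "visit_mean hs x a i / H = m x a (take i hs)" for hs x a i
    unfolding m_def visits_def visit_mean_def state_prob_def
    using expectation_visits[of P "act (take i hs)" 1 H "init (take i hs)" x a]
    by simp
  define B where "B = (\<lambda>(x,a). {hs. \<exists>k\<le>length hs. ell \<le> (\<Sum>i<k. 5/8 * m x a (take i hs) - real (visits x a (hs ! i)) / H)})"
  have "?F \<subseteq> (\<Union>i\<in>UNIV. B i)" unfolding m B_def by auto
  then have "measure_pmf.prob M ?F \<le> measure_pmf.prob M (\<Union>i\<in>UNIV. B i)"
    by (intro measure_pmf.finite_measure_mono) auto
  also have "\<dots> \<le> real (card (UNIV :: ('s \<times> 'a) set)) * exp (- ell)"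
  proof (rule prob_union_le)
    fix i :: "'s \<times> 'a"
    obtain x a where eq: "i = (x,a)" by (cases i)
    have "0 \<le> real (visits x a ep) / H \<and> real (visits x a ep) / H \<le> 1" if "length ep = H" for ep
      using visits_le[of x a ep] that H1 by (simp add: divide_le_eq)
    then show "measure_pmf.prob M (B i) \<le> exp (- ell)"
      unfolding B_def eq prod.case m_def by (rule episode_count_concentration)
  qed simp
  also have "real (card (UNIV :: ('s \<times> 'a) set)) = S * A * 1"
    by (simp add: S_eq A_eq card_cartesian_product flip: UNIV_Times_UNIV)
  also have "\<dots> * exp (- ell) \<le> S * A * (real K * real H) * exp (- ell)"
    using S1 A1 H1 K1 mult_mono[of 1 "real K" 1 "real H"] by (intro mult_right_mono mult_left_mono) auto
  also have "\<dots> = \<delta> / 5"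
    unfolding exp_minus_ell using S1 A1 H1 K1 by (simp add: field_simps)
  finally show ?thesis .
qed

lemma prob_state_visits:
  "measure_pmf.prob M {hs. \<exists>k\<le>length hs. \<exists>i<H. \<exists>y.
     ell \<le> (\<Sum>j<k. 5/8 * state_prob hs j (Suc i) y - of_bool (state_at (hs ! j) (Suc (Suc i)) = y))} \<le> \<delta> / 5"
    (is "measure_pmf.prob M ?F \<le> _")
proof -
  define m where "m i y hs = measure_pmf.expectation (gen_steps P (act hs) 1 H (init hs))
      (\<lambda>ep. of_bool (state_at ep (Suc (Suc i)) = y) :: real)" for i y hs
  have m: "state_prob hs j (Suc i) y = m i y (take j hs)" if "i < H" for hs i y j
    unfolding m_def state_prob_def by (rule expectation_state_at[OF that, symmetric])
  define B where "B = (\<lambda>(i,y). {hs. \<exists>k\<le>length hs. ell \<le> (\<Sum>j<k. 5/8 * m i y (take j hs) -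
      of_bool (state_at (hs ! j) (Suc (Suc i)) = y))})"
  define I where "I = {..<H} \<times> (UNIV :: 's set)"
  have "?F \<subseteq> (\<Union>i\<in>I. B i)"
  proof
    fix hs assume "hs \<in> ?F"
    then obtain k i y where "k \<le> length hs" and i: "i < H" and
      "ell \<le> (\<Sum>j<k. 5/8 * state_prob hs j (Suc i) y - of_bool (state_at (hs ! j) (Suc (Suc i)) = y))" by auto
    then show "hs \<in> (\<Union>i\<in>I. B i)" unfolding m[OF i] by (intro UN_I[of "(i,y)"]) (auto simp: I_def B_def)
  qed
  then have "measure_pmf.prob M ?F \<le> measure_pmf.prob M (\<Union>i\<in>I. B i)"
    by (intro measure_pmf.finite_measure_mono) auto
  also have "\<dots> \<le> real (card I) * exp (- ell)"
  proof (rule prob_union_le)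
    fix iy assume "iy \<in> I"
    obtain i y where eq: "iy = (i,y)" by (cases iy)
    show "measure_pmf.prob M (B iy) \<le> exp (- ell)"
      unfolding B_def eq prod.case m_def by (rule episode_count_concentration) auto
  qed (simp add: I_def)
  also have "real (card I) = S * (1 * (1 * real H))" by (simp add: S_eq I_def card_cartesian_product)
  also have "\<dots> * exp (- ell) \<le> S * (A * (real K * real H)) * exp (- ell)"
    using S1 A1 H1 K1 by (intro mult_right_mono mult_left_mono mult_mono) auto
  also have "\<dots> = \<delta> / 5"
    unfolding exp_minus_ell using S1 A1 H1 K1 by (simp add: field_simps)
  finally show ?thesis .
qed

lemma good_runI:
  assumes len: "length hs = K" and ep_len: "\<And>ep. ep \<in> set hs \<Longrightarrow> length ep = H"
    and dev: "\<And>k. dev_ok (take k hs)" and trans: "\<And>k. trans_ok (take k hs)"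
    and vis: "\<And>k x a. k \<le> length hs \<Longrightarrow>
      (\<Sum>i<k. 5/8 * (visit_mean hs x a i / H) - real (visits x a (hs ! i)) / H) < ell"
    and st: "\<And>k i y. k \<le> length hs \<Longrightarrow> i < H \<Longrightarrow>
      (\<Sum>j<k. 5/8 * state_prob hs j (Suc i) y - of_bool (state_at (hs ! j) (Suc (Suc i)) = y)) < ell"
  shows "good_run P R H K \<delta> act init S A ell hs"
proof
  have N: "Nsa (take k hs) x a \<le> K * H" for k x a
  proof -
    have "Nsa (take k hs) x a \<le> (\<Sum>i<length (take k hs). H)"
      unfolding Nsa_eq_sum_visits
    proof (rule sum_mono)
      fix i assume "i \<in> {..<length (take k hs)}"
      then have "take k hs ! i \<in> set hs" by simp
      then show "visits x a (take k hs ! i) \<le> H" using visits_le[of x a "take k hs ! i"] ep_len by simp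
    qed
    also have "\<dots> \<le> K * H" using len by (simp add: mult_right_mono)
    finally show ?thesis .
  qed
  show "prefix_ok hs" unfolding prefix_ok_def using dev N by simp
  show "trans_ok (take k hs)" for k by (rule trans)
  show "5/8 * (\<Sum>j<k. visit_mean hs x a j) - real H * ell \<le> real (Nsa (take k hs) x a)" if k: "k < K" for k x a
  proof -
    have N: "real (Nsa (take k hs) x a) = (\<Sum>i<k. real (visits x a (hs ! i)))"
      unfolding Nsa_eq_sum_visits using k len by simp
    have "(\<Sum>i<k. 5/8 * (visit_mean hs x a i / H) - real (visits x a (hs ! i)) / H) < ell"
      using vis k len by simp
    also have "(\<Sum>i<k. 5/8 * (visit_mean hs x a i / H) - real (visits x a (hs ! i)) / H)
      = (5/8 * (\<Sum>j<k. visit_mean hs x a j) - real (Nsa (take k hs) x a)) / H"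
      unfolding N by (simp add: sum_subtractf sum_distrib_left sum_divide_distrib diff_divide_distrib)
    finally show ?thesis using H1 by (simp add: pos_divide_less_eq mult.commute)
  qed
  show "5/8 * (\<Sum>j<k. state_prob hs j (Suc i) y) - ell \<le> real (Nprime (take k hs) (Suc (Suc i)) y)"
    if k: "k < K" and i: "i < H" for k i y
  proof -
    have "real (Nprime (take k hs) (Suc (Suc i)) y) = (\<Sum>j<k. of_bool (state_at (hs ! j) (Suc (Suc i)) = y))"
      unfolding Nprime_eq_sum using k len by simp
    then show ?thesis using st[of k i y] k len i by (simp add: sum_subtractf sum_distrib_left)
  qed
qed

lemma regret_bound_high_prob:
  "1 - \<delta> \<le> measure_pmf.prob M {hs. regret P R H act init K hs
     \<le> 2500 * ((real H)\<^sup>2 * S\<^sup>2 * A * ell\<^sup>2) + 30 * (real H * ell * sqrt (S * A * real K))}"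
    (is "_ \<le> measure_pmf.prob M ?good")
proof -
  define F1 where "F1 = {hs. \<exists>k. \<not> dev_ok (take k hs)}"
  define F2 where "F2 = {hs. \<exists>k. \<not> trans_ok (take k hs)}"
  define F3 where "F3 = {hs. \<exists>k\<le>length hs. \<exists>x a.
     ell \<le> (\<Sum>i<k. 5/8 * (visit_mean hs x a i / H) - real (visits x a (hs ! i)) / H)}"
  define F4 where "F4 = {hs. \<exists>k\<le>length hs. \<exists>i<H. \<exists>y.
     ell \<le> (\<Sum>j<k. 5/8 * state_prob hs j (Suc i) y - of_bool (state_at (hs ! j) (Suc (Suc i)) = y))}"
  \<comment> \<open>The inclusion is only almost sure: the lengths of history and episodes are known
    on the support alone.\<close>
  have "measure_pmf.prob M (- ?good) \<le> measure_pmf.prob M (F1 \<union> (F2 \<union> (F3 \<union> F4)))"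
  proof (rule measure_pmf.finite_measure_mono_AE)
    show "AE hs in measure_pmf M. hs \<in> - ?good \<longrightarrow> hs \<in> F1 \<union> (F2 \<union> (F3 \<union> F4))"
    proof (subst AE_measure_pmf_iff, intro ballI impI)
      fix hs assume hs: "hs \<in> set_pmf M" and bad: "hs \<in> - ?good"
      show "hs \<in> F1 \<union> (F2 \<union> (F3 \<union> F4))"
      proof (rule ccontr)
        assume "hs \<notin> F1 \<union> (F2 \<union> (F3 \<union> F4))"
        then have n: "hs \<notin> F1" "hs \<notin> F2" "hs \<notin> F3" "hs \<notin> F4" by auto
        have "good_run P R H K \<delta> act init S A ell hs"
        proof (rule good_runI)
          show "length hs = K" by (rule length_gen_hist[OF hs])
          show "length ep = H" if "ep \<in> set hs" for ep by (rule length_episode_gen_hist[OF hs that])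
          show "dev_ok (take k hs)" for k using n(1) by (auto simp: F1_def)
          show "trans_ok (take k hs)" for k using n(2) by (auto simp: F2_def)
          show "(\<Sum>i<k. 5/8 * (visit_mean hs x a i / H) - real (visits x a (hs ! i)) / H) < ell"
            if "k \<le> length hs" for k x a using n(3) that unfolding F3_def by (metis (mono_tags, lifting) mem_Collect_eq not_less)
          show "(\<Sum>j<k. 5/8 * state_prob hs j (Suc i) y - of_bool (state_at (hs ! j) (Suc (Suc i)) = y)) < ell"
            if "k \<le> length hs" "i < H" for k i y using n(4) that unfolding F4_def by (metis (mono_tags, lifting) mem_Collect_eq not_less)
        qed
        then show False using good_run.regret_le bad by blast
      qed
    qed
  qed simp
  also have "\<dots> \<le> measure_pmf.prob M F1 + (measure_pmf.prob M F2 + (measure_pmf.prob M F3 + measure_pmf.prob M F4))"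
    by (intro order_trans[OF measure_Un_le] add_left_mono order_refl) auto
  also have "\<dots> \<le> 2 * \<delta> / 5 + (\<delta> / 5 + (\<delta> / 5 + \<delta> / 5))"
    unfolding F1_def F2_def F3_def F4_def
    by (intro add_mono prob_dev prob_trans prob_visits prob_state_visits)
  finally show ?thesis using measure_pmf.prob_compl[of ?good M] by (simp add: Compl_eq_Diff_UNIV)
qed

end

section \<open>Combination of the regimes of large and small K\<close>

theorem theorem2:
  fixes P :: "'s::finite \<Rightarrow> 'a::finite \<Rightarrow> 's pmf"
    and R :: "'s \<Rightarrow> 'a \<Rightarrow> real"
    and H K :: nat and \<delta> :: real
    and act :: "('s,'a) hist \<Rightarrow> nat \<Rightarrow> 's \<Rightarrow> 'a"
    and init :: "('s,'a) hist \<Rightarrow> 's"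
  assumes R_range: "\<forall>x a. 0 \<le> R x a \<and> R x a \<le> 1"
    and H_pos: "H \<ge> 1" and K_pos: "K \<ge> 1" and delta_pos: "\<delta> > 0"
    and greedy: "\<forall>hs h x. ucbvi_Q H R (bf_bonus H K \<delta>) hs h x (act hs h x)
                       = Max (range (ucbvi_Q H R (bf_bonus H K \<delta>) hs h x))"
  shows "measure_pmf.prob (gen_hist P H act init K)
           {hs. regret P R H act init K hs
                \<le> (let S = real CARD('s); A = real CARD('a); Hr = real H;
                       L = ln (5 * Hr * S * A * (real K * Hr) / \<delta>)
                   in 30 * Hr * L * sqrt (S * A * real K) + 2500 * Hr^2 * S^2 * A * L^2
                      + 4 * Hr powr (3/2) * sqrt (real K * L))}
         \<ge> 1 - \<delta>"
proof (cases "\<delta> < 1")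
  case False
  then have "1 - \<delta> \<le> 0" by simp
  then show ?thesis by (rule order_trans) simp
next
  case True
  define S A where "S = real CARD('s)" and "A = real CARD('a)"
  define ell where "ell = ln (5 * S * A * (real K * real H) / \<delta>)"
  define L where "L = ln (5 * real H * S * A * (real K * real H) / \<delta>)"
  define bound where "bound = 30 * real H * L * sqrt (S * A * real K) + 2500 * (real H)\<^sup>2 * S\<^sup>2 * A * L\<^sup>2
                      + 4 * real H powr (3/2) * sqrt (real K * L)"
  have S1: "1 \<le> S" and A1: "1 \<le> A" by (auto simp: S_def A_def Suc_leI)
  have H1: "1 \<le> real H" and K1: "1 \<le> real K" using H_pos K_pos by auto
  have arg: "1 \<le> 5 * S * A * (real K * real H) / \<delta>"
  proof -
    have "1 * 1 * 1 * (1 * 1) \<le> 5 * S * A * (real K * real H)"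
      using S1 A1 H1 K1 by (intro mult_mono) auto
    then show ?thesis using True delta_pos by (simp add: pos_le_divide_eq)
  qed
  then have ell0: "0 \<le> ell" by (simp add: ell_def)
  have ellL: "ell \<le> L"
    unfolding ell_def L_def
  proof (rule ln_mono)
    show "0 < 5 * S * A * (real K * real H) / \<delta>" using arg by simp
    have "1 * (5 * S * A * (real K * real H) / \<delta>) \<le> real H * (5 * S * A * (real K * real H) / \<delta>)"
      using arg H1 by (intro mult_right_mono) auto
    then show "5 * S * A * (real K * real H) / \<delta> \<le> 5 * real H * S * A * (real K * real H) / \<delta>"
      by (simp add: mult_ac)
  qed
  have sq: "(real H)\<^sup>2 * S\<^sup>2 * A * ell\<^sup>2 \<le> (real H)\<^sup>2 * S\<^sup>2 * A * L\<^sup>2"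
    using ellL ell0 A1 by (intro mult_left_mono power_mono) auto
  have lin: "real H * ell * sqrt (S * A * real K) \<le> real H * L * sqrt (S * A * real K)"
    using ellL S1 A1 by (intro mult_right_mono mult_left_mono) auto
  have lin0: "0 \<le> real H * ell * sqrt (S * A * real K)" using ell0 S1 A1 by simp
  have last0: "0 \<le> 4 * real H powr (3/2) * sqrt (real K * L)" using ell0 ellL by simp
  have bound: "2500 * ((real H)\<^sup>2 * S\<^sup>2 * A * ell\<^sup>2) + 30 * (real H * ell * sqrt (S * A * real K)) \<le> bound"
    unfolding bound_def using sq lin last0 unfolding mult.assoc by linarith
  have "1 - \<delta> \<le> measure_pmf.prob (gen_hist P H act init K) {hs. regret P R H act init K hs \<le> bound}"
  proof (cases "2500 * real H * S\<^sup>2 * A * ell\<^sup>2 < real K")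
    case True': True
    interpret ucbvi_bf P R H K \<delta> act init S A ell
      using R_range H_pos delta_pos True greedy True' by unfold_locales (auto simp: S_def A_def ell_def)
    have "1 - \<delta> \<le> measure_pmf.prob M {hs. regret P R H act init K hs
     \<le> 2500 * ((real H)\<^sup>2 * S\<^sup>2 * A * ell\<^sup>2) + 30 * (real H * ell * sqrt (S * A * real K))}"
      by (rule regret_bound_high_prob)
    also have "\<dots> \<le> measure_pmf.prob M {hs. regret P R H act init K hs \<le> bound}"
      using bound by (intro measure_pmf.finite_measure_mono) auto
    finally show ?thesis .
  next
    case False
    have "regret P R H act init K hs \<le> bound" for hs
    proof -
      have "regret P R H act init K hs \<le> (\<Sum>k=1..K. real H)"
        unfolding regret_def
      proof (rule sum_mono)
        fix k
        show "Vstar P R H 1 (init (take (k - 1) hs)) - Vpi P R H (act (take (k - 1) hs)) 1 (init (take (k - 1) hs)) \<le> real H"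
          using Vstar_range(2)[OF R_range, of P H 1 "init (take (k - 1) hs)"]
            Vpi_range(1)[OF R_range, of P H "act (take (k - 1) hs)" 1 "init (take (k - 1) hs)"] by simp
      qed
      also have "\<dots> = real H * real K" by simp
      also have "\<dots> \<le> real H * (2500 * real H * S\<^sup>2 * A * ell\<^sup>2)" using False by (intro mult_left_mono) auto
      also have "\<dots> = 2500 * ((real H)\<^sup>2 * S\<^sup>2 * A * ell\<^sup>2)" by (simp add: power2_eq_square)
      finally show ?thesis using bound lin0 by linarith
    qed
    then show ?thesis using delta_pos by simp
  qed
  then show ?thesis unfolding bound_def L_def S_def A_def Let_def .
qed

end
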